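(* Let $f:\mathbb{RP}^1\to\mathbb{R}$ be a smooth function with at least four sign changes. Then there exist orientation preserving diffeomorphisms $\varphi$ and $g$ of $\mathbb{RP}^1$ such that $f\circ\varphi=S(g)$, where $S(g)$ denotes the Schwarzian derivative of $g$, regarded as a function on $\mathbb{RP}^1$ by means of the angular parameter.
   Context: $\mathbb{RP}^1$ is the real projective line, with angular parameter $\theta\in\mathbb{R}/\pi\mathbb{Z}$ (the line through the origin of $\mathbb{R}^2$ spanned by $(\cos\theta,\sin\theta)$) and affine coordinate $x=\tan\theta$. Schwarzian derivative: for a diffeomorphism $g$ of $\mathbb{RP}^1$, written in an affine coordinate $x$ as $x\mapsto g(x)$, the Schwarzian is the quadratic differential $$\left(\frac{g'''}{g'}-\frac32\left(\frac{g''}{g'}\right)^2\right)dx^2 ,$$ which is a globally defined smooth quadratic differential on $\mathbb{RP}^1$. The function $S(g)$ on $\mathbb{RP}^1$ is its coefficient with respect to $d\theta^2$, i.e. the Schwarzian quadratic differential equals $S(g)(\theta)\,d\theta^2$. Equivalently, if $\tilde g:\mathbb{R}\to\mathbb{R}$ with $\tilde g(\theta+\pi)=\tilde g(\theta)+\pi$ is a lift of the orientation preserving diffeomorphism $g$ in the angular parameter, then $$S(g)=\frac{\tilde g'''}{\tilde g'}-\frac32\left(\frac{\tilde g''}{\tilde g'}\right)^2+2(\tilde g')^2-2 .$$ A continuous function on $\mathbb{RP}^1$ (a circle) has at least four sign changes if there are four cyclically ordered distinct points at which it is non-zero and takes values of alternating signs (cyclically). *)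

theory Defs
  imports "HOL-Analysis.Analysis"
begin

typedef rp1 = "{L :: (real \<times> real) set. subspace L \<and> dim L = 1}"
proof -
  have "dim (span {(1::real, 0::real)}) = 1"
    by (simp add: dim_span dim_singleton zero_prod_def)
  then show ?thesis
    using subspace_span by blast
qed

definition rp1_angle :: "real \<Rightarrow> rp1" where
  "rp1_angle \<theta> = Abs_rp1 (span {(cos \<theta>, sin \<theta>)})"

(* The slope; unspecified at the vertical line, the point at infinity of this coordinate. *)
definition rp1_affine :: "rp1 \<Rightarrow> real" where
  "rp1_affine p = (THE x. (1, x) \<in> Rep_rp1 p)"

definition rp1_infinity :: rp1 where
  "rp1_infinity = Abs_rp1 (span {(0, 1)})"

definition rp1_of_affine :: "real \<Rightarrow> rp1" where
  "rp1_of_affine x = Abs_rp1 (span {(1, x)})"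

definition smooth_real :: "(real \<Rightarrow> real) \<Rightarrow> bool" where
  "smooth_real h \<longleftrightarrow> (\<forall>k x. (deriv ^^ k) h differentiable (at x))"

definition rp1_smooth :: "(rp1 \<Rightarrow> real) \<Rightarrow> bool" where
  "rp1_smooth f \<longleftrightarrow> smooth_real (f \<circ> rp1_angle)"

definition rp1_lift :: "(real \<Rightarrow> real) \<Rightarrow> (rp1 \<Rightarrow> rp1) \<Rightarrow> bool" where
  "rp1_lift h g \<longleftrightarrow> (\<forall>\<theta>. g (rp1_angle \<theta>) = rp1_angle (h \<theta>))"

(* rp1_angle is the universal covering of the projective line and a local diffeomorphism,
   so a self-map is smooth iff it has a smooth lift. *)
definition rp1_smooth_map :: "(rp1 \<Rightarrow> rp1) \<Rightarrow> bool" where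
  "rp1_smooth_map g \<longleftrightarrow> (\<exists>h. smooth_real h \<and> rp1_lift h g)"

definition rp1_diffeomorphism :: "(rp1 \<Rightarrow> rp1) \<Rightarrow> bool" where
  "rp1_diffeomorphism g \<longleftrightarrow> bij g \<and> rp1_smooth_map g \<and> rp1_smooth_map (inv g)"

(* Two smooth lifts of the same map differ by a constant, so the choice of lift is immaterial. *)
definition rp1_orientation_preserving :: "(rp1 \<Rightarrow> rp1) \<Rightarrow> bool" where
  "rp1_orientation_preserving g \<longleftrightarrow>
     (\<exists>h. smooth_real h \<and> rp1_lift h g \<and> (\<forall>\<theta>. deriv h \<theta> > 0))"

definition schwarzian_expr :: "(real \<Rightarrow> real) \<Rightarrow> real \<Rightarrow> real" where
  "schwarzian_expr G x =
     (deriv ^^ 3) G x / deriv G x - 3 / 2 * ((deriv ^^ 2) G x / deriv G x)\<^sup>2"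

(* The coefficient with respect to d\<theta>^2 of the quadratic differential that equals
   schwarzian_expr G x dx^2 in the affine coordinate x = tan \<theta>, so dx^2 = (tan' \<theta>)^2 d\<theta>^2.
   The points where the domain or the image is at infinity are covered by smoothness of the
   coefficient. The description is well defined for orientation preserving diffeomorphisms:
   see rp1_schwarzian_unique and rp1_schwarzian_lift below. *)
definition is_rp1_schwarzian :: "(rp1 \<Rightarrow> rp1) \<Rightarrow> (rp1 \<Rightarrow> real) \<Rightarrow> bool" where
  "is_rp1_schwarzian g s \<longleftrightarrow>
     rp1_smooth s \<and>
     (\<forall>\<theta>. rp1_angle \<theta> \<noteq> rp1_infinity \<longrightarrow> g (rp1_angle \<theta>) \<noteq> rp1_infinity \<longrightarrow>
        s (rp1_angle \<theta>) =
          schwarzian_expr (rp1_affine \<circ> g \<circ> rp1_of_affine) (tan \<theta>) * (deriv tan \<theta>)\<^sup>2)"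

definition rp1_schwarzian :: "(rp1 \<Rightarrow> rp1) \<Rightarrow> rp1 \<Rightarrow> real" where
  "rp1_schwarzian g = (THE s. is_rp1_schwarzian g s)"

definition at_least_four_sign_changes :: "(rp1 \<Rightarrow> real) \<Rightarrow> bool" where
  "at_least_four_sign_changes f \<longleftrightarrow>
     (\<exists>a b c d. a < b \<and> b < c \<and> c < d \<and> d < a + pi \<and>
        f (rp1_angle a) * f (rp1_angle b) < 0 \<and>
        f (rp1_angle b) * f (rp1_angle c) < 0 \<and>
        f (rp1_angle c) * f (rp1_angle d) < 0 \<and>
        f (rp1_angle d) * f (rp1_angle a) < 0)"

lemma Rep_rp1_Abs_span:
  assumes "v \<noteq> (0::real \<times> real)"
  shows "Rep_rp1 (Abs_rp1 (span {v})) = span {v}"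
  using assms by (subst Abs_rp1_inverse) (simp_all add: dim_span dim_singleton)

lemma Abs_rp1_span_eq_iff:
  assumes "v \<noteq> (0::real \<times> real)" "w \<noteq> 0"
  shows "Abs_rp1 (span {v}) = Abs_rp1 (span {w}) \<longleftrightarrow> fst v * snd w = snd v * fst w"
proof
  assume "Abs_rp1 (span {v}) = Abs_rp1 (span {w})"
  then have "span {v} = span {w}"
    using Rep_rp1_Abs_span assms by metis
  then have "v \<in> span {w}"
    using span_base by blast
  then obtain k where "v = k *\<^sub>R w"
    by (auto simp: span_singleton)
  then show "fst v * snd w = snd v * fst w"
    by simp
next
  assume eq: "fst v * snd w = snd v * fst w"
  have sub: "span {v} \<subseteq> span {w}"
    if "fst v * snd w = snd v * fst w" "w \<noteq> 0" for v w :: "real \<times> real"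
  proof -
    have "\<exists>k. v = k *\<^sub>R w"
    proof (cases "fst w = 0")
      case True
      then have "snd w \<noteq> 0" "fst v = 0"
        using that by (auto simp: prod_eq_iff)
      then show ?thesis
        using True by (intro exI[of _ "snd v / snd w"]) (auto simp: prod_eq_iff)
    next
      case False
      then show ?thesis
        using that(1) by (intro exI[of _ "fst v / fst w"]) (auto simp: prod_eq_iff field_simps)
    qed
    then show ?thesis
      by (metis span_mul span_base singletonI span_minimal subspace_span empty_subsetI insert_subset)
  qed
  have "span {v} = span {w}"
    using sub[of v w] sub[of w v] assms eq by (auto simp: mult.commute)
  then show "Abs_rp1 (span {v}) = Abs_rp1 (span {w})"
    by simp
qed

lemma cos_sin_nonzero: "(cos \<theta>, sin \<theta>) \<noteq> (0::real \<times> real)"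
  using sin_zero_abs_cos_one[of \<theta>] by (auto simp: zero_prod_def)

lemma rp1_angle_eq_iff: "rp1_angle a = rp1_angle b \<longleftrightarrow> sin (a - b) = 0"
  unfolding rp1_angle_def
  by (subst Abs_rp1_span_eq_iff) (auto simp: cos_sin_nonzero sin_diff algebra_simps)

lemma rp1_angle_eq_infinity_iff: "rp1_angle a = rp1_infinity \<longleftrightarrow> cos a = 0"
  unfolding rp1_angle_def rp1_infinity_def
  using Abs_rp1_span_eq_iff[OF cos_sin_nonzero[of a], of "(0, 1)"] by (simp add: zero_prod_def)

lemma rp1_angle_surj: "\<exists>\<theta>. p = rp1_angle \<theta>"
proof -
  obtain L where L: "p = Abs_rp1 L" "subspace L" "dim L = 1"
    using Abs_rp1_cases by (metis (mono_tags, lifting) mem_Collect_eq)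
  obtain B where B: "B \<subseteq> L" "independent B" "L \<subseteq> span B" "card B = dim L"
    using basis_exists by metis
  then obtain v where v: "B = {v}"
    using L(3) card_1_singletonE by metis
  have v0: "v \<noteq> 0"
    using B(2) v dependent_zero by blast
  have Lv: "L = span {v}"
    using B v L(2) by (metis span_minimal subset_antisym)
  define r where "r = sqrt ((fst v)\<^sup>2 + (snd v)\<^sup>2)"
  have rpos: "r > 0"
    using v0 unfolding r_def by (auto simp: prod_eq_iff sum_power2_gt_zero_iff)
  have "(fst v / r)\<^sup>2 + (snd v / r)\<^sup>2 = 1"
    using rpos by (simp add: power_divide add_divide_distrib[symmetric])
      (auto simp: r_def)
  then obtain \<theta> where "fst v / r = cos \<theta>" "snd v / r = sin \<theta>"
    using sincos_total_2pi by metis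
  then have "fst v = r * cos \<theta>" "snd v = r * sin \<theta>"
    using rpos by (auto simp: field_simps)
  then have "p = rp1_angle \<theta>"
    unfolding L(1) Lv rp1_angle_def
    by (subst Abs_rp1_span_eq_iff) (use v0 cos_sin_nonzero in auto)
  then show ?thesis ..
qed

lemma rp1_of_affine_eq: "rp1_of_affine x = rp1_angle (arctan x)"
  unfolding rp1_of_affine_def rp1_angle_def
  using Abs_rp1_span_eq_iff[OF _ cos_sin_nonzero[of "arctan x"], of "(1, x)"]
  by (simp add: zero_prod_def cos_arctan sin_arctan)

lemma rp1_affine_angle:
  assumes "cos \<theta> \<noteq> 0"
  shows "rp1_affine (rp1_angle \<theta>) = tan \<theta>"
proof -
  have "(1, x) \<in> span {(cos \<theta>, sin \<theta>)} \<longleftrightarrow> x = tan \<theta>" for x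
  proof
    assume "(1, x) \<in> span {(cos \<theta>, sin \<theta>)}"
    then obtain k where "1 = k * cos \<theta>" "x = k * sin \<theta>"
      by (auto simp: span_singleton)
    then show "x = tan \<theta>"
      using assms by (simp add: tan_def field_simps)
  next
    assume "x = tan \<theta>"
    then have "(1, x) = (1 / cos \<theta>) *\<^sub>R (cos \<theta>, sin \<theta>)"
      using assms by (simp add: tan_def)
    then show "(1, x) \<in> span {(cos \<theta>, sin \<theta>)}"
      by (metis span_mul span_base singletonI)
  qed
  then show ?thesis
    unfolding rp1_affine_def rp1_angle_def by (subst Rep_rp1_Abs_span) (auto simp: cos_sin_nonzero)
qed

lemma smooth_real_deriv: "smooth_real h \<Longrightarrow> smooth_real (deriv h)"
  unfolding smooth_real_def by (metis funpow_Suc_right o_apply)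

lemma smooth_real_has_deriv:
  "smooth_real h \<Longrightarrow> (h has_real_derivative deriv h x) (at x)"
  unfolding smooth_real_def
  by (metis DERIV_deriv_iff_real_differentiable funpow_0)

lemma smooth_real_iff:
  "smooth_real h \<longleftrightarrow> (\<forall>x. h differentiable at x) \<and> smooth_real (deriv h)"
  unfolding smooth_real_def
  by (metis funpow_0 funpow_Suc_right not0_implies_Suc o_apply)

lemma smooth_real_coinduct:
  assumes "P h"
    and step: "\<And>h. P h \<Longrightarrow> \<exists>h'. (\<forall>x. (h has_real_derivative h' x) (at x)) \<and> P h'"
  shows "smooth_real h"
proof -
  have "P ((deriv ^^ k) h)" for k
  proof (induction k)
    case (Suc k)
    then obtain h' where h': "\<forall>x. ((deriv ^^ k) h has_real_derivative h' x) (at x)" "P h'"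
      using step by blast
    then have "deriv ((deriv ^^ k) h) = h'"
      using DERIV_imp_deriv by blast
    then show ?case using h' by simp
  qed (use assms in simp)
  then show ?thesis
    unfolding smooth_real_def using step real_differentiable_def by blast
qed

(* The algebra generated by smooth functions and quotients by smooth nonvanishing ones. *)
inductive smooth_alg :: "(real \<Rightarrow> real) \<Rightarrow> bool" where
  base: "smooth_real h \<Longrightarrow> smooth_alg h"
| const: "smooth_alg (\<lambda>_. c)"
| add: "smooth_alg u \<Longrightarrow> smooth_alg v \<Longrightarrow> smooth_alg (\<lambda>x. u x + v x)"
| mult: "smooth_alg u \<Longrightarrow> smooth_alg v \<Longrightarrow> smooth_alg (\<lambda>x. u x * v x)"
| inverse: "smooth_alg u \<Longrightarrow> (\<And>x. u x \<noteq> 0) \<Longrightarrow> smooth_alg (\<lambda>x. inverse (u x))"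

lemma smooth_alg_deriv:
  "smooth_alg h \<Longrightarrow> \<exists>h'. (\<forall>x. (h has_real_derivative h' x) (at x)) \<and> smooth_alg h'"
proof (induction rule: smooth_alg.induct)
  case (base h)
  then show ?case
    using smooth_real_has_deriv smooth_real_deriv smooth_alg.base by blast
next
  case (const c)
  show ?case
    using smooth_alg.const[of 0] by (intro exI[of _ "\<lambda>_. 0"]) auto
next
  case (add u v)
  then obtain u' v' where "\<forall>x. (u has_real_derivative u' x) (at x)" "smooth_alg u'"
    "\<forall>x. (v has_real_derivative v' x) (at x)" "smooth_alg v'" by blast
  then show ?case
    by (intro exI[of _ "\<lambda>x. u' x + v' x"]) (auto intro!: smooth_alg.add DERIV_add)
next
  case (mult u v)
  then obtain u' v' where "\<forall>x. (u has_real_derivative u' x) (at x)" "smooth_alg u'"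
    "\<forall>x. (v has_real_derivative v' x) (at x)" "smooth_alg v'" by blast
  with mult show ?case
    by (intro exI[of _ "\<lambda>x. u' x * v x + v' x * u x"])
       (auto intro!: smooth_alg.add smooth_alg.mult DERIV_mult)
next
  case (inverse u)
  then obtain u' where u': "\<forall>x. (u has_real_derivative u' x) (at x)" "smooth_alg u'"
    by blast
  have i: "smooth_alg (\<lambda>x. inverse (u x))"
    using inverse by (intro smooth_alg.inverse) auto
  have d: "((\<lambda>x. inverse (u x)) has_real_derivative
      (-1) * (u' x * (inverse (u x) * inverse (u x)))) (at x)" for x
    using u'(1) inverse.hyps(2)[of x]
    by (auto intro!: derivative_eq_intros simp: power2_eq_square)
  show ?case
  proof (intro exI conjI allI)
    show "smooth_alg (\<lambda>x. (-1) * (u' x * (inverse (u x) * inverse (u x))))"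
      using i u'(2) by (intro smooth_alg.mult smooth_alg.const)
  qed (rule d)
qed

lemma smooth_alg_smooth: "smooth_alg h \<Longrightarrow> smooth_real h"
  using smooth_real_coinduct[of smooth_alg] smooth_alg_deriv by blast

definition schwarzian_angle_expr :: "(real \<Rightarrow> real) \<Rightarrow> real \<Rightarrow> real" where
  "schwarzian_angle_expr h \<theta> = schwarzian_expr h \<theta> + 2 * (deriv h \<theta>)\<^sup>2 - 2"

lemma smooth_schwarzian_angle_expr:
  assumes "smooth_real h" "\<And>\<theta>. deriv h \<theta> > 0"
  shows "smooth_real (schwarzian_angle_expr h)"
proof -
  have s: "smooth_alg (deriv h)" "smooth_alg (deriv (deriv h))" "smooth_alg (deriv (deriv (deriv h)))"
    using assms by (auto intro!: smooth_alg.base smooth_real_deriv)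
  have i: "smooth_alg (\<lambda>x. inverse (deriv h x))"
    using s assms(2) by (intro smooth_alg.inverse) (auto simp: less_imp_neq[symmetric])
  have "smooth_alg (\<lambda>x. deriv (deriv (deriv h)) x * inverse (deriv h x) +
     ((-3/2) * ((deriv (deriv h) x * inverse (deriv h x)) * (deriv (deriv h) x * inverse (deriv h x)))
      + (2 * (deriv h x * deriv h x) + (-2))))"
    using s i by (intro smooth_alg.intros(2-4))
  moreover have "schwarzian_angle_expr h = (\<lambda>x. deriv (deriv (deriv h)) x * inverse (deriv h x) +
     ((-3/2) * ((deriv (deriv h) x * inverse (deriv h x)) * (deriv (deriv h) x * inverse (deriv h x)))
      + (2 * (deriv h x * deriv h x) + (-2))))"
  proof
    fix x
    have d: "(deriv ^^ 2) h = deriv (deriv h)" "(deriv ^^ 3) h = deriv (deriv (deriv h))"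
      by (simp_all add: numeral_2_eq_2 numeral_3_eq_3)
    have alg: "c / a - 3 / 2 * (b / a)\<^sup>2 + 2 * a\<^sup>2 - 2 =
        c * i + ((-3/2) * ((b * i) * (b * i)) + (2 * (a * a) + (-2)))"
      if "i = inverse a" for a b c i :: real
      unfolding divide_inverse[of c a] divide_inverse[of b a] that[symmetric] power2_eq_square
      by (simp add: algebra_simps)
    show "schwarzian_angle_expr h x = deriv (deriv (deriv h)) x * inverse (deriv h x) +
     ((-3/2) * ((deriv (deriv h) x * inverse (deriv h x)) * (deriv (deriv h) x * inverse (deriv h x)))
      + (2 * (deriv h x * deriv h x) + (-2)))"
      unfolding schwarzian_angle_expr_def schwarzian_expr_def d by (rule alg[OF refl])
  qed
  ultimately show ?thesis
    using smooth_alg_smooth by simp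
qed

lemma schwarzian_tan_conj:
  assumes h: "smooth_real h" and pos: "\<And>\<theta>. deriv h \<theta> > 0"
    and cx: "cos (h (arctan x)) \<noteq> 0"
    and G: "\<And>y. cos (h (arctan y)) \<noteq> 0 \<Longrightarrow> G y = tan (h (arctan y))"
  shows "schwarzian_expr G x * (1 + x\<^sup>2)\<^sup>2 = schwarzian_angle_expr h (arctan x)"
proof -
  define U where "U = {y. cos (h (arctan y)) \<noteq> 0}"
  define T where "T y = tan (h (arctan y))" for y
  define h1 where "h1 = deriv h"
  define h2 where "h2 = deriv h1"
  define h3 where "h3 = deriv h2"
  have dh [derivative_intros]:
    "(h has_real_derivative h1 t) (at t)" "(h1 has_real_derivative h2 t) (at t)"
    "(h2 has_real_derivative h3 t) (at t)" for t
    unfolding h1_def h2_def h3_def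
    using h by (auto intro!: smooth_real_has_deriv smooth_real_deriv)
  have h1pos: "h1 t > 0" for t using pos h1_def by simp
  have ch: "continuous_on UNIV h"
    using dh(1) by (meson DERIV_continuous continuous_at_imp_continuous_on)
  have "open U"
    unfolding U_def
    by (intro open_Collect_neq continuous_intros continuous_on_compose2[OF ch]) auto
  have xU: "x \<in> U" using cx U_def by simp
  have u0: "1 + y\<^sup>2 \<noteq> 0" for y :: real
    by (metis add_pos_nonneg less_irrefl zero_le_power2 zero_less_one)
  define G1 where "G1 y = (1 + (T y)\<^sup>2) * h1 (arctan y) / (1 + y\<^sup>2)" for y
  define Q where "Q y = 2 * T y * h1 (arctan y) + h2 (arctan y) / h1 (arctan y) - 2 * y" for y
  define P where "P y = Q y / (1 + y\<^sup>2)" for y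
  define Q1 where "Q1 y = 2 * (G1 y * h1 (arctan y) + T y * (h2 (arctan y) / (1 + y\<^sup>2)))
     + (h3 (arctan y) / h1 (arctan y) - (h2 (arctan y) / h1 (arctan y))\<^sup>2) / (1 + y\<^sup>2) - 2" for y
  define P1 where "P1 y = (Q1 y * (1 + y\<^sup>2) - Q y * (2 * y)) / ((1 + y\<^sup>2) * (1 + y\<^sup>2))" for y
  have da: "(arctan has_real_derivative inverse (1 + y\<^sup>2)) (at y)" for y
    by (rule DERIV_arctan)
  have c: "((\<lambda>y. k (arctan y)) has_real_derivative k' (arctan y) / (1 + y\<^sup>2)) (at y)"
    if "\<And>t. (k has_real_derivative k' t) (at t)" for k k' y
    using DERIV_chain2[OF that da] by (simp add: divide_inverse)
  note ch1 = c[OF dh(1)] c[OF dh(2)] c[OF dh(3)]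
  have dT: "(T has_real_derivative G1 y) (at y)" if "y \<in> U" for y
  proof -
    have "(T has_real_derivative inverse ((cos (h (arctan y)))\<^sup>2) * (h1 (arctan y) / (1 + y\<^sup>2))) (at y)"
      unfolding T_def using that U_def by (intro DERIV_chain2[OF DERIV_tan ch1(1)]) auto
    moreover have "inverse ((cos (h (arctan y)))\<^sup>2) = 1 + (T y)\<^sup>2"
      using that U_def tan_sec[of "h (arctan y)"] by (simp add: T_def power_inverse)
    ultimately show ?thesis by (simp add: G1_def)
  qed
  have dr: "((\<lambda>t. h2 t / h1 t) has_real_derivative h3 t / h1 t - (h2 t / h1 t)\<^sup>2) (at t)" for t
    using DERIV_divide[OF dh(3,2), of t] h1pos[of t]
    by (simp add: diff_divide_distrib power2_eq_square)
  have du: "((\<lambda>y. 1 + y\<^sup>2) has_real_derivative 2 * y) (at y)" for y :: real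
    by (auto intro!: derivative_eq_intros)
  have dQ: "(Q has_real_derivative Q1 y) (at y)" if "y \<in> U" for y
  proof -
    have "((\<lambda>y. 2 * (T y * h1 (arctan y)) + h2 (arctan y) / h1 (arctan y) - 2 * y)
        has_real_derivative
        2 * (G1 y * h1 (arctan y) + h2 (arctan y) / (1 + y\<^sup>2) * T y)
        + (h3 (arctan y) / h1 (arctan y) - (h2 (arctan y) / h1 (arctan y))\<^sup>2) / (1 + y\<^sup>2) - 2 * 1) (at y)"
      by (intro DERIV_diff DERIV_add DERIV_cmult DERIV_mult dT[OF that] ch1(2) c[OF dr] DERIV_ident)
    then show ?thesis
      by (simp add: Q_def[abs_def] Q1_def mult.assoc mult.commute[of "T y"])
  qed
  have dP: "(P has_real_derivative P1 y) (at y)" if "y \<in> U" for y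
    unfolding P_def[abs_def] P1_def by (rule DERIV_divide[OF dQ[OF that] du u0])
  have dG1: "(G1 has_real_derivative G1 y * P y) (at y)" if "y \<in> U" for y
  proof -
    have alg: "((2 * t * (w * k / u) * k + k2 / u * w) * u - w * k * (2 * y)) / (u * u)
        = w * k / u * ((2 * t * k + k2 / k - 2 * y) / u)"
      if "u \<noteq> 0" "k \<noteq> 0" for t w k k2 u y :: real
      using that by (simp add: field_simps)
    have "((\<lambda>y. 1 + (T y)\<^sup>2) has_real_derivative 2 * T y * G1 y) (at y)"
      by (rule derivative_eq_intros dT[OF that] refl | simp)+
    then have "(G1 has_real_derivative
        ((2 * T y * G1 y * h1 (arctan y) + h2 (arctan y) / (1 + y\<^sup>2) * (1 + (T y)\<^sup>2)) * (1 + y\<^sup>2)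
          - (1 + (T y)\<^sup>2) * h1 (arctan y) * (2 * y)) / ((1 + y\<^sup>2) * (1 + y\<^sup>2))) (at y)"
      unfolding G1_def[abs_def] by (intro DERIV_divide DERIV_mult ch1(2) du u0)
    also have "((2 * T y * G1 y * h1 (arctan y) + h2 (arctan y) / (1 + y\<^sup>2) * (1 + (T y)\<^sup>2)) * (1 + y\<^sup>2)
          - (1 + (T y)\<^sup>2) * h1 (arctan y) * (2 * y)) / ((1 + y\<^sup>2) * (1 + y\<^sup>2)) = G1 y * P y"
      unfolding G1_def P_def Q_def
      by (rule alg) (use u0[of y] h1pos[of "arctan y"] in auto)
    finally show ?thesis .
  qed
  have dG2: "((\<lambda>y. G1 y * P y) has_real_derivative G1 y * ((P y)\<^sup>2 + P1 y)) (at y)" if "y \<in> U" for y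
    by (rule derivative_eq_intros dG1[OF that] dP[OF that] refl)+
       (simp add: power2_eq_square algebra_simps)
  have tr: "deriv F y = F' y"
    if "\<And>y. y \<in> U \<Longrightarrow> F y = K y" "\<And>y. y \<in> U \<Longrightarrow> (K has_real_derivative F' y) (at y)" "y \<in> U"
    for F K F' y
  proof (rule DERIV_imp_deriv)
    show "(F has_real_derivative F' y) (at y)"
      using has_field_derivative_transform_within_open[OF that(2)[OF that(3)] \<open>open U\<close> that(3)] that(1)
      by metis
  qed
  have D1: "deriv G y = G1 y" if "y \<in> U" for y
    by (rule tr[of G T G1]) (use G dT that in \<open>auto simp: U_def T_def\<close>)
  have D2: "deriv (deriv G) y = G1 y * P y" if "y \<in> U" for y
    by (rule tr[of "deriv G" G1 "\<lambda>y. G1 y * P y"]) (use D1 dG1 that in auto)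
  have D3: "deriv (deriv (deriv G)) y = G1 y * ((P y)\<^sup>2 + P1 y)" if "y \<in> U" for y
    by (rule tr[of "deriv (deriv G)" "\<lambda>y. G1 y * P y" "\<lambda>y. G1 y * ((P y)\<^sup>2 + P1 y)"])
       (use D2 dG2 that in auto)
  have "1 + (T x)\<^sup>2 \<noteq> 0" by (rule u0)
  then have G10: "G1 x \<noteq> 0"
    using h1pos[of "arctan x"] u0[of x] by (simp add: G1_def)
  have S: "schwarzian_expr G x = P1 x - (P x)\<^sup>2 / 2"
    unfolding schwarzian_expr_def using D1[OF xU] D2[OF xU] D3[OF xU] G10
    by (simp add: numeral_2_eq_2 numeral_3_eq_3 field_simps)
  have "schwarzian_expr G x * (1 + x\<^sup>2)\<^sup>2 =
      Q1 x * (1 + x\<^sup>2) - 2 * x * Q x - (Q x)\<^sup>2 / 2"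
  proof -
    have alg: "((q1 * u - q * (2 * y)) / (u * u) - (q / u)\<^sup>2 / 2) * u\<^sup>2 = q1 * u - 2 * y * q - q\<^sup>2 / 2"
      if "u \<noteq> 0" for q1 q u y :: real
      using that by (simp add: field_simps power2_eq_square)
    show ?thesis
      unfolding S P1_def P_def by (rule alg[OF u0])
  qed
  also have "\<dots> = h3 (arctan x) / h1 (arctan x) - 3 / 2 * (h2 (arctan x) / h1 (arctan x))\<^sup>2
      + 2 * (h1 (arctan x))\<^sup>2 - 2"
  proof -
    define r where "r = h2 (arctan x) / h1 (arctan x)"
    have e: "h2 (arctan x) = r * h1 (arctan x)"
      unfolding r_def using h1pos[of "arctan x"] by simp
    have alg: "(2 * ((1 + t\<^sup>2) * k / u * k + t * (r * k / u)) + (z - r\<^sup>2) / u - 2) * u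
        = 2 * ((1 + t\<^sup>2) * k * k + t * (r * k)) + (z - r\<^sup>2) - 2 * u"
      if "u \<noteq> 0" for t k r z u :: real
      using that by (simp add: field_simps)
    have "Q1 x * (1 + x\<^sup>2) = 2 * ((1 + (T x)\<^sup>2) * h1 (arctan x) * h1 (arctan x)
        + T x * (r * h1 (arctan x))) + (h3 (arctan x) / h1 (arctan x) - r\<^sup>2) - 2 * (1 + x\<^sup>2)"
      unfolding Q1_def G1_def r_def[symmetric] unfolding e by (rule alg[OF u0])
    moreover have "Q x = 2 * T x * h1 (arctan x) + r - 2 * x"
      by (simp add: Q_def r_def)
    moreover have "2 * ((1 + t\<^sup>2) * k * k + t * (r * k)) + (z - r\<^sup>2) - 2 * (1 + y\<^sup>2)
        - 2 * y * (2 * t * k + r - 2 * y) - (2 * t * k + r - 2 * y)\<^sup>2 / 2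
        = z - 3 / 2 * r\<^sup>2 + 2 * k\<^sup>2 - 2" for t k r z y :: real
      by (simp add: power2_eq_square field_simps)
    ultimately show ?thesis
      unfolding r_def[symmetric] by simp
  qed
  finally show ?thesis
    by (simp add: schwarzian_angle_expr_def schwarzian_expr_def numeral_2_eq_2 numeral_3_eq_3
        h1_def h2_def h3_def)
qed

lemma lift_deriv_periodic:
  assumes h: "smooth_real h" and l: "rp1_lift h g" and ab: "rp1_angle a = rp1_angle b"
  shows "deriv h a = deriv h b" "(deriv ^^ 2) h a = (deriv ^^ 2) h b"
    "(deriv ^^ 3) h a = (deriv ^^ 3) h b"
proof -
  define c where "c = b - a"
  have "sin c = 0"
    using ab[symmetric] by (simp add: rp1_angle_eq_iff c_def)
  have per: "sin (h (t + c) - h t) = 0" for t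
  proof -
    have "rp1_angle (t + c) = rp1_angle t"
      using \<open>sin c = 0\<close> by (simp add: rp1_angle_eq_iff)
    then have "rp1_angle (h (t + c)) = rp1_angle (h t)"
      using l unfolding rp1_lift_def by metis
    then show ?thesis by (simp add: rp1_angle_eq_iff)
  qed
  have dsh: "((\<lambda>t. k (t + c)) has_real_derivative deriv k (t + c)) (at t)"
    if "smooth_real k" for k t
    using smooth_real_has_deriv[OF that, of "t + c"] by (simp add: DERIV_shift)
  have p1: "deriv h (t + c) = deriv h t" for t
  proof -
    have "((\<lambda>t. sin (h (t + c) - h t)) has_real_derivative
        cos (h (t + c) - h t) * (deriv h (t + c) - deriv h t)) (at t)"
      by (rule derivative_eq_intros dsh[OF h] smooth_real_has_deriv[OF h] refl)+
    moreover have "((\<lambda>t. sin (h (t + c) - h t)) has_real_derivative 0) (at t)"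
      by (simp add: per)
    ultimately have "cos (h (t + c) - h t) * (deriv h (t + c) - deriv h t) = 0"
      using DERIV_unique by blast
    moreover have "cos (h (t + c) - h t) \<noteq> 0"
      using per[of t] sin_zero_abs_cos_one by fastforce
    ultimately show ?thesis by simp
  qed
  have pn: "deriv k (t + c) = deriv k t"
    if "smooth_real k" "\<And>t. k (t + c) = k t" for k t
    using dsh[OF that(1), of t] smooth_real_has_deriv[OF that(1), of t] that(2)
    by (simp add: DERIV_unique)
  have p2: "deriv (deriv h) (t + c) = deriv (deriv h) t" for t
    using pn[of "deriv h"] p1 smooth_real_deriv[OF h] by simp
  have p3: "deriv (deriv (deriv h)) (t + c) = deriv (deriv (deriv h)) t" for t
    using pn[of "deriv (deriv h)"] p2 smooth_real_deriv[OF smooth_real_deriv[OF h]] by simp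
  show "deriv h a = deriv h b" "(deriv ^^ 2) h a = (deriv ^^ 2) h b"
    "(deriv ^^ 3) h a = (deriv ^^ 3) h b"
    using p1[of a] p2[of a] p3[of a]
    by (simp_all add: c_def numeral_2_eq_2 numeral_3_eq_3)
qed

lemma countable_zeros_along:
  assumes h: "smooth_real h" and pos: "\<And>\<theta>. deriv h \<theta> > 0"
  shows "countable {\<theta>. cos (h \<theta>) = 0}"
proof -
  have inj: "inj h"
  proof (rule injI, rule ccontr)
    fix a b assume ab: "h a = h b" "a \<noteq> b"
    have lt: "h a < h b" if "a < b" for a b
      by (rule DERIV_pos_imp_increasing[OF that]) (use smooth_real_has_deriv[OF h] pos in blast)
    show False using lt[of a b] lt[of b a] ab by linarith
  qed
  have "{t :: real. cos t = 0} \<subseteq> (\<lambda>i. of_int i * (pi / 2)) ` UNIV"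
    by (auto simp: cos_zero_iff_int)
  then have "countable {t :: real. cos t = 0}"
    by (rule countable_subset) simp
  then have "countable {\<theta>. h \<theta> \<in> {t. cos t = 0}}"
    using inj by (rule countable_image_inj)
  then show ?thesis by simp
qed

lemma rp1_schwarzian_exists:
  assumes h: "smooth_real h" and pos: "\<And>\<theta>. deriv h \<theta> > 0" and l: "rp1_lift h g"
  shows "\<exists>s. is_rp1_schwarzian g s \<and> (\<forall>\<theta>. s (rp1_angle \<theta>) = schwarzian_angle_expr h \<theta>)"
proof -
  have wd: "schwarzian_angle_expr h a = schwarzian_angle_expr h b"
    if "rp1_angle a = rp1_angle b" for a b
    using lift_deriv_periodic[OF h l that]
    by (simp add: schwarzian_angle_expr_def schwarzian_expr_def)
  define s where "s p = schwarzian_angle_expr h (SOME \<theta>. p = rp1_angle \<theta>)" for p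
  have s: "s (rp1_angle \<theta>) = schwarzian_angle_expr h \<theta>" for \<theta>
    unfolding s_def by (rule wd) (metis (mono_tags, lifting) someI)
  have "rp1_smooth s"
    using smooth_schwarzian_angle_expr[OF h pos] s by (simp add: rp1_smooth_def comp_def)
  moreover have "s (rp1_angle \<theta>) =
      schwarzian_expr (rp1_affine \<circ> g \<circ> rp1_of_affine) (tan \<theta>) * (deriv tan \<theta>)\<^sup>2"
    if "rp1_angle \<theta> \<noteq> rp1_infinity" "g (rp1_angle \<theta>) \<noteq> rp1_infinity" for \<theta>
  proof -
    have c: "cos \<theta> \<noteq> 0" using that(1) rp1_angle_eq_infinity_iff by simp
    have eq: "rp1_angle (arctan (tan \<theta>)) = rp1_angle \<theta>"
      using c unfolding rp1_angle_eq_iff sin_diff sin_arctan cos_arctan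
      by (simp add: tan_def)
    have c2: "cos (h (arctan (tan \<theta>))) \<noteq> 0"
      using that(2) l eq rp1_angle_eq_infinity_iff unfolding rp1_lift_def by metis
    have "schwarzian_expr (rp1_affine \<circ> g \<circ> rp1_of_affine) (tan \<theta>) * (1 + (tan \<theta>)\<^sup>2)\<^sup>2 =
        schwarzian_angle_expr h (arctan (tan \<theta>))"
    proof (rule schwarzian_tan_conj[OF h pos c2])
      fix y assume "cos (h (arctan y)) \<noteq> 0"
      then show "(rp1_affine \<circ> g \<circ> rp1_of_affine) y = tan (h (arctan y))"
        using l by (simp add: rp1_of_affine_eq rp1_lift_def rp1_affine_angle)
    qed
    moreover have "deriv tan \<theta> = 1 + (tan \<theta>)\<^sup>2"
      using DERIV_imp_deriv[OF DERIV_tan[OF c]] tan_sec[OF c] by (simp add: power_inverse)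
    ultimately show ?thesis
      using s wd[OF eq] by simp
  qed
  ultimately show ?thesis
    using s unfolding is_rp1_schwarzian_def by blast
qed

lemma rp1_schwarzian_unique:
  assumes h: "smooth_real h" and pos: "\<And>\<theta>. deriv h \<theta> > 0" and l: "rp1_lift h g"
    and s: "is_rp1_schwarzian g s" and s': "is_rp1_schwarzian g s'"
  shows "s = s'"
proof -
  define N where "N = {\<theta> :: real. cos \<theta> = 0} \<union> {\<theta>. cos (h \<theta>) = 0}"
  have sid: "smooth_real (\<lambda>x. x)"
  proof (rule smooth_alg_smooth, rule smooth_alg.base)
    have "smooth_real (deriv (\<lambda>x::real. x))"
      using smooth_alg_smooth[OF smooth_alg.const[of 1]] by simp
    then show "smooth_real (\<lambda>x. x)"
      by (subst smooth_real_iff) simp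
  qed
  have "countable N"
    unfolding N_def
    using countable_zeros_along[OF sid] countable_zeros_along[OF h pos] by simp
  have "interior N = {}"
  proof (rule ccontr)
    assume "interior N \<noteq> {}"
    then obtain t where "t \<in> interior N" "t \<notin> N"
      using open_minus_countable[OF \<open>countable N\<close> _ open_interior] by blast
    then show False
      using interior_subset[of N] by (simp add: subset_eq)
  qed
  then have dense: "closure (- N) = UNIV"
    by (simp add: closure_complement)
  have cont: "continuous_on UNIV (q \<circ> rp1_angle)" if "rp1_smooth q" for q
    unfolding continuous_on_eq_continuous_at[OF open_UNIV]
    using smooth_real_has_deriv[THEN DERIV_continuous] that rp1_smooth_def by blast
  have eq: "(s \<circ> rp1_angle) \<theta> - (s' \<circ> rp1_angle) \<theta> = 0" for \<theta>
  proof (rule continuous_constant_on_closure[of "- N" "\<lambda>t. (s \<circ> rp1_angle) t - (s' \<circ> rp1_angle) t"])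
    show "continuous_on (closure (- N)) (\<lambda>t. (s \<circ> rp1_angle) t - (s' \<circ> rp1_angle) t)"
      unfolding dense
      using s s' cont[of s] cont[of s'] unfolding is_rp1_schwarzian_def
      by (simp add: continuous_on_diff comp_def)
    fix t assume "t \<in> - N"
    then have "rp1_angle t \<noteq> rp1_infinity" "g (rp1_angle t) \<noteq> rp1_infinity"
      using l by (auto simp: N_def rp1_angle_eq_infinity_iff rp1_lift_def)
    then show "(s \<circ> rp1_angle) t - (s' \<circ> rp1_angle) t = 0"
      using s s' unfolding is_rp1_schwarzian_def by simp
  qed (use dense in auto)
  show "s = s'"
  proof
    fix p
    obtain \<theta> where "p = rp1_angle \<theta>"
      using rp1_angle_surj by blast
    then show "s p = s' p"
      using eq[of \<theta>] by simp
  qed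
qed

lemma rp1_schwarzian_lift:
  assumes "smooth_real h" "\<And>\<theta>. deriv h \<theta> > 0" "rp1_lift h g"
  shows "rp1_schwarzian g (rp1_angle \<theta>) =
    (deriv ^^ 3) h \<theta> / deriv h \<theta> - 3 / 2 * ((deriv ^^ 2) h \<theta> / deriv h \<theta>)\<^sup>2
      + 2 * (deriv h \<theta>)\<^sup>2 - 2"
proof -
  obtain s where s: "is_rp1_schwarzian g s"
    "\<And>\<theta>. s (rp1_angle \<theta>) = schwarzian_angle_expr h \<theta>"
    using rp1_schwarzian_exists[OF assms] by blast
  have "rp1_schwarzian g = s"
    unfolding rp1_schwarzian_def
    by (rule the_equality, rule s(1)) (rule rp1_schwarzian_unique[OF assms _ s(1)])
  then show ?thesis
    by (simp add: s(2) schwarzian_angle_expr_def schwarzian_expr_def)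
qed

end

(* S(g) = F means that the angle of g is the angle of the curve formed by two solutions of Hill's
   equation y'' + (1 + F/2) y = 0 with Wronskian 1, and g closes up to a diffeomorphism iff this
   curve turns exactly by pi over one period, in particular iff the monodromy is -1.  So a
   reparametrisation phi with trivial monodromy for F = f o phi is needed.  Let phi rest for time
   about pi/4 near each of four zeros of f that separate the points of alternating signs, and for
   short times of order eps near these four points, at angles about 0, pi/4, pi/2, 3pi/4.  Then F is
   of size eps in L^1, and to first order in eps the monodromy is governed by the integrals of F,
   F cos 2 theta and F sin 2 theta.  Because of the alternating signs the short times can be
   balanced so that these vanish, and they depend nondegenerately on the times.  Brouwer's theorem
   then gives times for which the monodromy is exactly trivial. *)

theory Submission
  imports Defs
begin

text \<open>The whole time pi has to be spent somewhere, while perturbation theory needs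
  \<open>f\<close> to be small along the way; long rests at zeros of \<open>f\<close> reconcile the
  two. At the four equally spaced angles the pairs (1, exp (2 i \<theta>)) are (1, 1), (1, i), (1,
  -1), (1, -i). Their alternating sum vanishes, so equal strengths are balanced, and up to scaling
  this is the only linear relation. Hence three of the four strength directions remain to control
  the three real parameters of a monodromy in SL(2, R). The strengths act at order
  \<open>\<epsilon>\<close>, whereas all errors are of order
  \<open>M ^ 4 * \<epsilon>\<^sup>2\<close>. Here \<open>M\<close> bounds \<open>f\<close> and also
  the reciprocals of its values at the pulses, because the strengths are normalised by these values.
  A diffeomorphism can neither rest completely nor jump, so the times become smooth, strictly
  positive densities with tails. A rest has weight of order one, so both \<open>f\<close> in its
  window and the mass of its tails must be of size \<open>\<epsilon>\<^sup>2\<close>.\<close>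

section \<open>Smooth functions\<close>

lemma smooth_real_antiderivative:
  assumes "\<And>x. (H has_real_derivative h x) (at x)" "smooth_real h"
  shows "smooth_real H"
proof -
  have "deriv H = h"
    using assms(1) DERIV_imp_deriv by blast
  then show ?thesis
    using assms by (subst smooth_real_iff) (auto simp: real_differentiable_def)
qed

lemma smooth_real_const: "smooth_real (\<lambda>x. c)"
  by (rule smooth_alg_smooth[OF smooth_alg.const])

lemma smooth_real_ident: "smooth_real (\<lambda>x. x)"
  by (rule smooth_real_antiderivative[OF _ smooth_real_const[of 1]]) simp

lemma smooth_real_add: "smooth_real u \<Longrightarrow> smooth_real v \<Longrightarrow> smooth_real (\<lambda>x. u x + v x)"
  by (rule smooth_alg_smooth) (intro smooth_alg.add smooth_alg.base)

lemma smooth_real_mult: "smooth_real u \<Longrightarrow> smooth_real v \<Longrightarrow> smooth_real (\<lambda>x. u x * v x)"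
  by (rule smooth_alg_smooth) (intro smooth_alg.mult smooth_alg.base)

lemma smooth_real_inverse:
  "smooth_real u \<Longrightarrow> (\<And>x. u x \<noteq> 0) \<Longrightarrow> smooth_real (\<lambda>x. inverse (u x))"
  by (rule smooth_alg_smooth) (intro smooth_alg.inverse smooth_alg.base)

lemma smooth_real_divide:
  "smooth_real u \<Longrightarrow> smooth_real v \<Longrightarrow> (\<And>x. v x \<noteq> 0) \<Longrightarrow> smooth_real (\<lambda>x. u x / v x)"
  unfolding divide_inverse by (intro smooth_real_mult smooth_real_inverse)

lemma smooth_real_diff: "smooth_real u \<Longrightarrow> smooth_real v \<Longrightarrow> smooth_real (\<lambda>x. u x - v x)"
  using smooth_real_add[OF _ smooth_real_mult[OF smooth_real_const[of "-1"], of v], of u] by simp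

lemma smooth_real_sum:
  "(\<And>i. i \<in> I \<Longrightarrow> smooth_real (u i)) \<Longrightarrow> smooth_real (\<lambda>x. \<Sum>i\<in>I. u i x)"
  by (induction I rule: infinite_finite_induct)
     (auto intro: smooth_real_const smooth_real_add)

lemma smooth_real_power: "smooth_real u \<Longrightarrow> smooth_real (\<lambda>x. u x ^ n)"
  by (induction n) (auto intro: smooth_real_const smooth_real_mult)

lemma smooth_real_continuous: "smooth_real h \<Longrightarrow> continuous_on A h"
  by (rule DERIV_continuous_on[of A h "deriv h"])
     (rule has_field_derivative_at_within[OF smooth_real_has_deriv])

text \<open>Smoothness is proved by bootstrapping: if the derivatives of the generators lie in the algebra
  generated by them over the smooth functions, then the whole algebra consists of smooth functions.\<close>

inductive smooth_gen :: "(real \<Rightarrow> real) set \<Rightarrow> (real \<Rightarrow> real) \<Rightarrow> bool" for G where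
  base: "smooth_real h \<Longrightarrow> smooth_gen G h"
| gen: "h \<in> G \<Longrightarrow> smooth_gen G h"
| add: "smooth_gen G u \<Longrightarrow> smooth_gen G v \<Longrightarrow> smooth_gen G (\<lambda>x. u x + v x)"
| mult: "smooth_gen G u \<Longrightarrow> smooth_gen G v \<Longrightarrow> smooth_gen G (\<lambda>x. u x * v x)"

lemma smooth_gen_smooth:
  assumes G: "\<And>h. h \<in> G \<Longrightarrow> \<exists>h'. (\<forall>x. (h has_real_derivative h' x) (at x)) \<and> smooth_gen G h'"
    and "smooth_gen G h"
  shows "smooth_real h"
proof (rule smooth_real_coinduct[of "smooth_gen G"])
  show "smooth_gen G h" by fact
  show "\<exists>h'. (\<forall>x. (h has_real_derivative h' x) (at x)) \<and> smooth_gen G h'" if "smooth_gen G h" for h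
    using that
  proof induction
    case (base h)
    then show ?case
      using smooth_real_has_deriv smooth_real_deriv smooth_gen.base by blast
  next
    case (gen h)
    then show ?case by (rule G)
  next
    case (add u v)
    then obtain u' v' where "\<forall>x. (u has_real_derivative u' x) (at x)" "smooth_gen G u'"
      "\<forall>x. (v has_real_derivative v' x) (at x)" "smooth_gen G v'" by blast
    then show ?case
      by (intro exI[of _ "\<lambda>x. u' x + v' x"]) (auto intro!: smooth_gen.add DERIV_add)
  next
    case (mult u v)
    then obtain u' v' where "\<forall>x. (u has_real_derivative u' x) (at x)" "smooth_gen G u'"
      "\<forall>x. (v has_real_derivative v' x) (at x)" "smooth_gen G v'" by blast
    with mult show ?case
      by (intro exI[of _ "\<lambda>x. u' x * v x + v' x * u x"])
         (auto intro!: smooth_gen.add smooth_gen.mult DERIV_mult)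
  qed
qed

text \<open>All pullbacks along \<open>k\<close> serve as generators at once: the chain rule turns
  the pullback of \<open>h\<close> into the pullback of \<open>deriv h\<close> times the smooth
  function \<open>deriv k\<close>.\<close>

lemma smooth_real_compose:
  assumes "smooth_real h" and k: "smooth_real k"
  shows "smooth_real (\<lambda>x. h (k x))"
proof (rule smooth_gen_smooth[of "{\<lambda>x. h (k x) | h. smooth_real h}"])
  let ?G = "{\<lambda>x. h (k x) | h. smooth_real h}"
  show "smooth_gen ?G (\<lambda>x. h (k x))"
    using assms(1) by (intro smooth_gen.gen) auto
  fix w assume "w \<in> ?G"
  then obtain h where h: "smooth_real h" "w = (\<lambda>x. h (k x))" by auto
  have "smooth_gen ?G (\<lambda>x. deriv h (k x) * deriv k x)"
    using smooth_real_deriv[OF h(1)] smooth_real_deriv[OF k]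
    by (intro smooth_gen.mult smooth_gen.base[of "deriv k"] smooth_gen.gen) auto
  moreover have "(w has_real_derivative deriv h (k x) * deriv k x) (at x)" for x
    unfolding h(2)
    by (rule DERIV_chain2[OF smooth_real_has_deriv[OF h(1)] smooth_real_has_deriv[OF k]])
  ultimately show "\<exists>h'. (\<forall>x. (w has_real_derivative h' x) (at x)) \<and> smooth_gen ?G h'"
    by (intro exI[of _ "\<lambda>x. deriv h (k x) * deriv k x"]) auto
qed

lemma smooth_real_sin_cos: "smooth_real sin" "smooth_real cos"
proof -
  let ?G = "{sin, cos :: real \<Rightarrow> real}"
  have G: "\<exists>h'. (\<forall>x. (h has_real_derivative h' x) (at x)) \<and> smooth_gen ?G h'" if "h \<in> ?G" for h
    using that
  proof (elim insertE emptyE)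
    assume "h = sin"
    then show ?thesis
      by (intro exI[of _ cos]) (auto intro!: smooth_gen.gen)
  next
    assume "h = cos"
    moreover have "smooth_gen ?G (\<lambda>x. (-1) * sin x)"
      by (intro smooth_gen.mult smooth_gen.base[OF smooth_real_const] smooth_gen.gen) auto
    ultimately show ?thesis
      by (intro exI[of _ "\<lambda>x. (-1) * sin x"]) (auto intro!: derivative_eq_intros)
  qed
  show "smooth_real sin" "smooth_real cos"
    using smooth_gen_smooth[OF G] by (auto intro: smooth_gen.gen)
qed

lemmas smooth_real_cos = smooth_real_compose[OF smooth_real_sin_cos(2)]

section \<open>Lifts\<close>

lemma deriv_pos_strict_mono:
  assumes "smooth_real h" "\<And>t. deriv h t > 0"
  shows "strict_mono h"
  by (rule strict_monoI, rule DERIV_pos_imp_increasing, assumption)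
     (use smooth_real_has_deriv[OF assms(1)] assms(2) in blast)

lemma quasi_periodic_int:
  fixes h :: "real \<Rightarrow> real"
  assumes "\<And>t. h (t + pi) = h t + pi"
  shows "h (t + of_int n * pi) = h t + of_int n * pi"
proof -
  have nat: "h (t + of_nat n * pi) = h t + of_nat n * pi" for n t
  proof (induction n)
    case (Suc n)
    then show ?case using assms[of "t + of_nat n * pi"] by (simp add: algebra_simps)
  qed simp
  show ?thesis
  proof (cases "n \<ge> 0")
    case True
    then show ?thesis using nat[of t "nat n"] by simp
  next
    case False
    \<comment> \<open>The forward case starts at the shifted point, from which \<open>- n\<close>
      steps lead back to \<open>t\<close>.\<close>
    then show ?thesis using nat[of "t + of_int n * pi" "nat (- n)"] by simp
  qed
qed

text \<open>Injectivity is monotonicity. Surjectivity is the intermediate value theorem, since the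
  values \<open>h 0 + of_int n * pi\<close> at multiples of pi are unbounded in both
  directions.\<close>

lemma quasi_periodic_bij:
  assumes h: "smooth_real h" and pos: "\<And>t. deriv h t > 0" and per: "\<And>t. h (t + pi) = h t + pi"
  shows "bij h"
proof -
  have "\<exists>t. h t = y" for y
  proof -
    obtain n where n: "(y - h 0) / pi < of_nat n"
      using reals_Archimedean2 by blast
    obtain m where m: "(h 0 - y) / pi < of_nat m"
      using reals_Archimedean2 by blast
    have "y \<le> h (of_nat n * pi)"
      using quasi_periodic_int[of h, OF per, of 0 "int n"] n by (simp add: field_simps)
    moreover have "h (- of_nat m * pi) \<le> y"
      using quasi_periodic_int[of h, OF per, of 0 "- int m"] m by (simp add: field_simps)
    moreover have "- real m * pi \<le> real n * pi" 
      by (rule mult_right_mono) auto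
    ultimately show ?thesis
      using IVT'[of h "- of_nat m * pi" y "of_nat n * pi"] smooth_real_continuous[OF h] by blast
  qed
  then have "surj h" unfolding surj_def by metis
  then show ?thesis
    using deriv_pos_strict_mono[OF h pos] by (simp add: bij_def strict_mono_imp_inj_on)
qed

lemma has_derivative_inv_lift:
  assumes h: "smooth_real h" and pos: "\<And>t. deriv h t > 0" and "bij h"
  shows "(inv h has_real_derivative inverse (deriv h (inv h x))) (at x)"
proof -
  have inj: "inj h" and surj: "surj h" using \<open>bij h\<close> by (auto simp: bij_def)
  have mono: "strict_mono (inv h)"
  proof (rule strict_monoI)
    fix x y :: real assume "x < y"
    then show "inv h x < inv h y"
      using strict_mono_less[OF deriv_pos_strict_mono[OF h pos]] surj by (metis surj_f_inv_f)
  qed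
  have cont: "isCont (inv h) x"
  proof (rule isCont_inverse_function[of 1 "inv h x" "inv h" h, simplified surj_f_inv_f[OF surj]])
    show "\<And>z. \<bar>z - inv h x\<bar> \<le> 1 \<Longrightarrow> inv h (h z) = z"
      using inj by simp
    show "\<And>z. \<bar>z - inv h x\<bar> \<le> 1 \<Longrightarrow> isCont h z"
      using h DERIV_isCont smooth_real_has_deriv by blast
  qed simp
  show ?thesis
    by (rule DERIV_inverse_function[OF smooth_real_has_deriv[OF h], of "inv h" x "x - 1" "x + 1"])
       (use pos[of "inv h x"] cont surj in \<open>auto simp: surj_f_inv_f\<close>)
qed

text \<open>The functions \<open>k (inv h x)\<close> with \<open>k\<close> smooth are closed under
  differentiation, because the derivative of \<open>inv h\<close> is the smooth function 1 /
  \<open>deriv h\<close> evaluated at \<open>inv h x\<close>.\<close>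

lemma smooth_real_inv:
  assumes h: "smooth_real h" and pos: "\<And>t. deriv h t > 0" and "bij h"
  shows "smooth_real (inv h)"
proof (rule smooth_real_coinduct[of "\<lambda>w. \<exists>k. smooth_real k \<and> w = (\<lambda>x. k (inv h x))"])
  show "\<exists>k. smooth_real k \<and> inv h = (\<lambda>x. k (inv h x))"
    using smooth_real_ident by (intro exI[of _ "\<lambda>x. x"]) auto
  fix w assume "\<exists>k. smooth_real k \<and> w = (\<lambda>x. k (inv h x))"
  then obtain k where k: "smooth_real k" "w = (\<lambda>x. k (inv h x))" by blast
  define k' where "k' x = deriv k x * inverse (deriv h x)" for x
  have "smooth_real k'"
    unfolding k'_def using k h pos
    by (intro smooth_real_mult smooth_real_inverse smooth_real_deriv) (auto simp: less_imp_neq[symmetric])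
  moreover have "(w has_real_derivative k' (inv h x)) (at x)" for x
    unfolding k(2) k'_def
    by (rule DERIV_chain2[OF smooth_real_has_deriv[OF k(1)] has_derivative_inv_lift[OF assms]])
  ultimately show "\<exists>w'. (\<forall>x. (w has_real_derivative w' x) (at x)) \<and>
      (\<exists>k. smooth_real k \<and> w' = (\<lambda>x. k (inv h x)))"
    by (intro exI[of _ "\<lambda>x. k' (inv h x)"]) auto
qed

lemma rp1_angle_eq_imp_shift:
  assumes "rp1_angle a = rp1_angle b"
  obtains n :: int where "a = b + of_int n * pi"
proof -
  obtain n where "a - b = of_int n * pi"
    using assms by (auto simp: rp1_angle_eq_iff sin_zero_iff_int2)
  then show ?thesis by (intro that[of n]) simp
qed

lemma rp1_angle_shift: "rp1_angle (t + of_int n * pi) = rp1_angle t"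
  by (simp add: rp1_angle_eq_iff sin_zero_iff_int2)

lemma quasi_periodic_lift:
  assumes "\<And>t. h (t + pi) = h t + pi"
  shows "\<exists>g. rp1_lift h g"
proof -
  have wd: "rp1_angle (h a) = rp1_angle (h b)" if ab: "rp1_angle a = rp1_angle b" for a b
  proof -
    obtain n where "a = b + of_int n * pi" by (rule rp1_angle_eq_imp_shift[OF ab])
    then show ?thesis by (simp add: quasi_periodic_int[of h, OF assms] rp1_angle_shift)
  qed
  have "rp1_lift h (\<lambda>p. rp1_angle (h (SOME t. p = rp1_angle t)))"
    unfolding rp1_lift_def by (intro allI wd) (metis (mono_tags, lifting) someI)
  then show ?thesis by blast
qed

text \<open>A lift that commutes with the deck transformation t -> t + pi descends to the projective
  line. Its inverse commutes with it too and descends to the inverse map.\<close>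

lemma quasi_periodic_diffeomorphism:
  assumes h: "smooth_real h" and pos: "\<And>t. deriv h t > 0" and per: "\<And>t. h (t + pi) = h t + pi"
  obtains g where "rp1_lift h g" "rp1_diffeomorphism g" "rp1_orientation_preserving g"
proof -
  have bij: "bij h" by (rule quasi_periodic_bij[OF assms])
  then have inj: "inj h" and surj: "surj h" by (auto simp: bij_def)
  have iper: "inv h (t + pi) = inv h t + pi" for t
    by (rule inv_f_eq[OF inj]) (simp add: per surj_f_inv_f[OF surj])
  obtain g where g: "rp1_lift h g" using quasi_periodic_lift[of h, OF per] by blast
  obtain g' where g': "rp1_lift (inv h) g'" using quasi_periodic_lift[of "inv h", OF iper] by blast
  have "g' (g p) = p \<and> g (g' p) = p" for p
  proof -
    obtain t where "p = rp1_angle t" using rp1_angle_surj by blast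
    then show ?thesis
      using g g' inj surj by (simp add: rp1_lift_def surj_f_inv_f)
  qed
  then have "g' \<circ> g = id" "g \<circ> g' = id"
    by (auto simp: fun_eq_iff)
  then have "bij g" "inv g = g'"
    using o_bij inv_unique_comp by blast+
  then have "rp1_diffeomorphism g"
    unfolding rp1_diffeomorphism_def rp1_smooth_map_def
    using g g' h smooth_real_inv[OF h pos bij] by blast
  moreover have "rp1_orientation_preserving g"
    unfolding rp1_orientation_preserving_def using g h pos by blast
  ultimately show ?thesis using that g by blast
qed

section \<open>Linear systems in the plane\<close>

text \<open>The primitive is wanted on the whole line, hence the passage through an interval with
  infinite end points.\<close>

lemma antiderivative_exists:
  fixes f :: "real \<Rightarrow> 'a::euclidean_space"
  assumes "continuous_on UNIV f"
  shows "\<exists>F. F t0 = 0 \<and> (\<forall>t. (F has_vector_derivative f t) (at t))"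
proof -
  have "\<exists>F. \<forall>t. -\<infinity> < ereal t \<longrightarrow> ereal t < \<infinity> \<longrightarrow> (F has_vector_derivative f t) (at t)"
    using assms by (intro einterval_antiderivative) (auto simp: continuous_on_eq_continuous_at)
  then obtain F where F: "\<And>t. (F has_vector_derivative f t) (at t)" by auto
  have "((\<lambda>t. F t - F t0) has_vector_derivative f t) (at t)" for t
    using F[of t] by (auto intro!: derivative_eq_intros)
  then show ?thesis
    by (intro exI[of _ "\<lambda>t. F t - F t0"]) auto
qed

text \<open>The induction step of the Picard estimates. Both sides of \<open>t0\<close> are treated
  together by moving outward from \<open>t0\<close> in the direction \<open>\<sigma>\<close> and
  applying the mean value inequality with the primitive of the majorant.\<close>

lemma antiderivative_power_bound:
  fixes F :: "real \<Rightarrow> complex"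
  assumes F: "\<And>t. (F has_vector_derivative f t) (at t)" "F t0 = 0"
    and bound: "\<And>t. \<bar>t - t0\<bar> \<le> R \<Longrightarrow> norm (f t) \<le> K * (c * (K * \<bar>t - t0\<bar>) ^ n / fact n)"
    and t: "\<bar>t - t0\<bar> \<le> R"
  shows "norm (F t) \<le> c * (K * \<bar>t - t0\<bar>) ^ Suc n / fact (Suc n)"
proof (cases "t = t0")
  case False
  define \<sigma> where "\<sigma> = sgn (t - t0)"
  define T where "T = \<bar>t - t0\<bar>"
  have \<sigma>: "t = t0 + \<sigma> * T" "\<bar>\<sigma>\<bar> = 1" and T: "0 < T" "T \<le> R"
    using False t by (auto simp: \<sigma>_def T_def sgn_real_def abs_real_def)
  have dF: "((\<lambda>u. F (t0 + \<sigma> * u)) has_vector_derivative \<sigma> *\<^sub>R f (t0 + \<sigma> * u)) (at u)" for u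
  proof -
    have "((\<lambda>u. t0 + \<sigma> * u) has_vector_derivative \<sigma>) (at u)"
      unfolding has_real_derivative_iff_has_vector_derivative[symmetric]
      by (auto intro!: derivative_eq_intros)
    then show ?thesis
      using vector_diff_chain_at[of "\<lambda>u. t0 + \<sigma> * u" \<sigma> u F "f (t0 + \<sigma> * u)"] F(1)
      by (simp add: o_def)
  qed
  have "norm (F (t0 + \<sigma> * T) - F (t0 + \<sigma> * 0)) \<le>
      c * (K * T) ^ Suc n / fact (Suc n) - c * (K * 0) ^ Suc n / fact (Suc n)"
  proof (rule differentiable_bound_general[OF T(1), where f' = "\<lambda>u. \<sigma> *\<^sub>R f (t0 + \<sigma> * u)"
        and \<phi>' = "\<lambda>u. K * (c * (K * u) ^ n / fact n)"])
    show "continuous_on {0..T} (\<lambda>u. F (t0 + \<sigma> * u))"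
      using dF by (meson continuous_at_imp_continuous_on has_vector_derivative_continuous)
    show "continuous_on {0..T} (\<lambda>u. c * (K * u) ^ Suc n / fact (Suc n))"
      by (intro continuous_intros) auto
    show "norm (\<sigma> *\<^sub>R f (t0 + \<sigma> * u)) \<le> K * (c * (K * u) ^ n / fact n)" if "0 < u" "u < T" for u
      using bound[of "t0 + \<sigma> * u"] that T \<sigma>(2) by (simp add: abs_mult)
    show "((\<lambda>u. c * (K * u) ^ Suc n / fact (Suc n)) has_vector_derivative
        K * (c * (K * u) ^ n / fact n)) (at u)" for u
      unfolding has_real_derivative_iff_has_vector_derivative[symmetric]
      by (rule derivative_eq_intros refl | simp)+
  qed (use dF in auto)
  then show ?thesis
    unfolding \<sigma>(1)[symmetric] T_def[symmetric] by (simp add: F(2))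
qed (use F(2) in simp)

text \<open>Every real-linear map of the plane has the form w -> a w + b cnj w, so this covers all
  linear systems. The \<open>x n\<close> are the increments of Picard iteration, the terms of order
  n in the coefficients; on compact intervals an exponential series dominates them.\<close>

lemma plane_ode_exists:
  fixes P Q :: "real \<Rightarrow> complex"
  assumes P: "continuous_on UNIV P" and Q: "continuous_on UNIV Q"
  shows "\<exists>z. z t0 = v \<and> (\<forall>t. (z has_vector_derivative P t * z t + Q t * cnj (z t)) (at t))"
proof -
  define L where "L t w = P t * w + Q t * cnj w" for t w
  have L_norm: "norm (L t w) \<le> (norm (P t) + norm (Q t)) * norm w" for t w
    unfolding L_def by (rule order.trans[OF norm_triangle_ineq]) (simp add: norm_mult algebra_simps)
  have cont_L: "continuous_on UNIV (\<lambda>t. L t (x t))" if "continuous_on UNIV x" for x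
    unfolding L_def using P Q that by (intro continuous_intros)
  \<comment> \<open>Continuity is carried in the invariant because it provides the next primitive;
    the clause for 0 fixes the start of the iteration.\<close>
  have "\<exists>x. \<forall>n. (continuous_on UNIV (x n) \<and> (n = 0 \<longrightarrow> x n = (\<lambda>_. v))) \<and>
      (x (Suc n) t0 = 0 \<and> (\<forall>t. (x (Suc n) has_vector_derivative L t (x n t)) (at t)))"
  proof (rule dependent_nat_choice)
    fix x :: "real \<Rightarrow> complex" and n :: nat
    assume "continuous_on UNIV x \<and> (n = 0 \<longrightarrow> x = (\<lambda>_. v))"
    then obtain y where "y t0 = 0" "\<And>t. (y has_vector_derivative L t (x t)) (at t)"
      using antiderivative_exists[OF cont_L] by blast
    moreover from this have "continuous_on UNIV y"
      by (meson continuous_at_imp_continuous_on has_vector_derivative_continuous)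
    ultimately show "\<exists>y. (continuous_on UNIV y \<and> (Suc n = 0 \<longrightarrow> y = (\<lambda>_. v))) \<and>
      (y t0 = 0 \<and> (\<forall>t. (y has_vector_derivative L t (x t)) (at t)))"
      by auto
  qed auto
  then obtain x where x0: "x 0 = (\<lambda>_. v)" and xs: "\<And>n. x (Suc n) t0 = 0"
    and dx: "\<And>n t. (x (Suc n) has_vector_derivative L t (x n t)) (at t)" by auto
  define z where "z t = (\<Sum>n. x n t)" for t
  \<comment> \<open>The radius serves only the uniform estimates; \<open>z\<close> does not depend
    on it, so a radius can be chosen for each time separately.\<close>
  have main: "(\<lambda>n. x n t0) sums z t0 \<and> (\<forall>t. \<bar>t - t0\<bar> < R \<longrightarrow> (z has_vector_derivative L t (z t)) (at t))"
    if R: "R > 0" for R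
  proof -
    define S where "S = cball t0 R"
    have S: "t \<in> S \<longleftrightarrow> \<bar>t - t0\<bar> \<le> R" for t
      by (auto simp: S_def dist_real_def)
    have "bounded ((\<lambda>t. norm (P t) + norm (Q t)) ` S)"
      unfolding S_def
      by (intro compact_imp_bounded compact_continuous_image continuous_intros compact_cball
          continuous_on_subset[OF P] continuous_on_subset[OF Q] subset_UNIV)
    then obtain K where K: "K > 0" "\<And>t. t \<in> S \<Longrightarrow> norm (P t) + norm (Q t) \<le> K"
      unfolding bounded_pos by (auto simp: image_iff Ball_def) (metis abs_le_D1)
    have LK: "norm (L t w) \<le> K * norm w" if "t \<in> S" for t w
      by (rule order.trans[OF L_norm]) (intro mult_right_mono K(2) that norm_ge_zero)
    have x_bound: "\<bar>t - t0\<bar> \<le> R \<Longrightarrow> norm (x n t) \<le> norm v * (K * \<bar>t - t0\<bar>) ^ n / fact n" for n t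
    proof (induction n arbitrary: t)
      case (Suc n)
      show ?case
      proof (rule antiderivative_power_bound[OF dx xs _ Suc.prems])
        fix t assume t: "\<bar>t - t0\<bar> \<le> R"
        show "norm (L t (x n t)) \<le> K * (norm v * (K * \<bar>t - t0\<bar>) ^ n / fact n)"
          using LK[of t "x n t"] mult_left_mono[OF Suc.IH[OF t], of K] t K(1)
          unfolding S[symmetric] by linarith
      qed
    qed (simp add: x0)
    have m: "norm (x n t) \<le> norm v * ((K * R) ^ n / fact n)" if "t \<in> S" for n t
    proof -
      have "(K * \<bar>t - t0\<bar>) ^ n \<le> (K * R) ^ n"
        using that K(1) unfolding S by (intro power_mono mult_left_mono) auto
      then have "norm v * (K * \<bar>t - t0\<bar>) ^ n / fact n \<le> norm v * (K * R) ^ n / fact n"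
        by (intro divide_right_mono mult_left_mono) auto
      then show ?thesis
        using x_bound[of t n] that unfolding S by simp
    qed
    have summ: "summable (\<lambda>n. norm v * ((K * R) ^ n / fact n))"
      using summable_exp[of "K * R"] by (intro summable_mult) (simp add: field_simps)
    have ul: "uniform_limit S (\<lambda>n t. \<Sum>i<n. x i t) z sequentially"
      unfolding z_def by (rule Weierstrass_m_test[OF m summ])
    have sums: "(\<lambda>n. x n t) sums z t" if "t \<in> S" for t
      unfolding sums_def by (rule tendsto_uniform_limitI[OF ul that])
    \<comment> \<open>The derivatives of the terms; the value at 0 is the derivative of the constant
      \<open>x 0\<close>.\<close>
    define d where "d n t = (case n of 0 \<Rightarrow> 0 | Suc m \<Rightarrow> L t (x m t))" for n t
    have sum_d: "(\<Sum>i<Suc n. d i t) = L t (\<Sum>i<n. x i t)" for n t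
      unfolding sum.lessThan_Suc_shift
      by (simp add: d_def L_def sum.distrib sum_distrib_left)
    have "\<exists>g. \<forall>t\<in>S. (\<lambda>n. x n t) sums g t \<and> (g has_derivative (\<lambda>h. h *\<^sub>R L t (z t))) (at t within S)"
    proof (rule has_derivative_series[where f' = "\<lambda>n t h. h *\<^sub>R d n t" and x = t0])
      show "convex S" "t0 \<in> S" using R by (auto simp: S_def)
      show "(\<lambda>n. x n t0) sums z t0" by (rule sums) fact
      show "(x n has_derivative (\<lambda>h. h *\<^sub>R d n t)) (at t within S)" for n t
        using dx by (cases n)
          (auto simp: d_def x0 has_vector_derivative_def intro: has_derivative_at_withinI)
      fix e :: real assume e: "e > 0"
      then have "\<forall>\<^sub>F n in sequentially. \<forall>t\<in>S. dist (\<Sum>i<n. x i t) (z t) < e / K"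
        using ul K(1) unfolding uniform_limit_iff by simp
      \<comment> \<open>By \<open>sum_d\<close> a partial sum of derivatives is \<open>L\<close> of
        a partial sum with one term fewer.\<close>
      then have "\<forall>\<^sub>F n in sequentially. \<forall>t\<in>S. dist (\<Sum>i<n - 1. x i t) (z t) < e / K"
        by (rule eventually_compose_filterlim) (simp add: filterlim_minus_const_nat_at_top)
      moreover have "\<forall>\<^sub>F n in sequentially. n > 0"
        by (rule eventually_gt_at_top)
      ultimately show "\<forall>\<^sub>F n in sequentially. \<forall>t\<in>S. \<forall>h.
          norm ((\<Sum>i<n. h *\<^sub>R d i t) - h *\<^sub>R L t (z t)) \<le> e * norm h"
      proof eventually_elim
        case (elim n)
        then obtain m where n: "n = Suc m" using gr0_conv_Suc by blast
        show ?case
        proof (intro ballI allI)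
          fix t h assume t: "t \<in> S"
          have "norm ((\<Sum>i<n. d i t) - L t (z t)) = norm (L t ((\<Sum>i<m. x i t) - z t))"
            unfolding n sum_d by (simp add: L_def algebra_simps)
          also have "\<dots> \<le> K * (e / K)"
            using elim t n K(1) by (intro order.trans[OF LK[OF t]] mult_left_mono)
              (auto simp: dist_norm less_imp_le)
          finally have "norm ((\<Sum>i<n. d i t) - L t (z t)) \<le> e" using K(1) by simp
          then have "\<bar>h\<bar> * norm ((\<Sum>i<n. d i t) - L t (z t)) \<le> \<bar>h\<bar> * e"
            by (intro mult_left_mono) auto
          then show "norm ((\<Sum>i<n. h *\<^sub>R d i t) - h *\<^sub>R L t (z t)) \<le> e * norm h"
            by (simp flip: scaleR_sum_right scaleR_diff_right) (simp add: mult.commute)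
        qed
      qed
    qed
    then obtain g where g: "\<And>t. t \<in> S \<Longrightarrow> (\<lambda>n. x n t) sums g t"
      "\<And>t. t \<in> S \<Longrightarrow> (g has_derivative (\<lambda>h. h *\<^sub>R L t (z t))) (at t within S)" by blast
    have gz: "g t = z t" if "t \<in> S" for t
      using g(1)[OF that] sums[OF that] sums_unique2 by blast
    have "(z has_vector_derivative L t (z t)) (at t)" if t: "\<bar>t - t0\<bar> < R" for t
    proof -
      have "(z has_derivative (\<lambda>h. h *\<^sub>R L t (z t))) (at t within S)"
        by (rule has_derivative_transform[OF _ _ g(2)]) (use t S gz in auto)
      moreover have "at t within S = at t"
        by (rule at_within_interior) (use t in \<open>auto simp: S_def dist_real_def\<close>)
      ultimately show ?thesis
        by (simp add: has_vector_derivative_def)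
    qed
    then show ?thesis using sums[of t0] R S by auto
  qed
  \<comment> \<open>All increments after the first vanish at \<open>t0\<close>, so the series there
    is just \<open>v\<close>.\<close>
  have "(\<lambda>n. x n t0) sums (\<Sum>n\<in>{0}. x n t0)"
  proof (rule sums_finite)
    fix n :: nat assume "n \<notin> {0}"
    then show "x n t0 = 0" using xs by (cases n) auto
  qed simp
  then have "(\<lambda>n. x n t0) sums v" by (simp add: x0)
  then have "z t0 = v"
    using conjunct1[OF main[of 1]] sums_unique2 by simp
  moreover have "(z has_vector_derivative L t (z t)) (at t)" for t
    using main[of "\<bar>t - t0\<bar> + 1"] by simp
  ultimately show ?thesis unfolding L_def by blast
qed

text \<open>A replacement for Gronwall's inequality: at a point where \<open>norm (Z \<tau>)\<close>
  attains its maximum N, integration gives N <= N / 2 + the integral of \<open>r\<close>, whence the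
  factor 2.\<close>

lemma small_system_bound:
  fixes Z :: "real \<Rightarrow> complex"
  assumes der: "\<And>\<tau>. \<tau> \<in> {s..t} \<Longrightarrow> (Z has_vector_derivative Z' \<tau>) (at \<tau>)"
    and b: "continuous_on {s..t} b" "\<And>\<tau>. \<tau> \<in> {s..t} \<Longrightarrow> 0 \<le> b \<tau>"
    and r: "continuous_on {s..t} r" "\<And>\<tau>. \<tau> \<in> {s..t} \<Longrightarrow> 0 \<le> r \<tau>"
    and bound: "\<And>\<tau>. \<tau> \<in> {s..t} \<Longrightarrow> norm (Z' \<tau>) \<le> b \<tau> * norm (Z \<tau>) + r \<tau>"
    and "Z s = 0" and small: "integral {s..t} b \<le> 1 / 2" and \<tau>: "\<tau> \<in> {s..t}"
  shows "norm (Z \<tau>) \<le> 2 * integral {s..t} r"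
proof -
  have "continuous_on {s..t} Z"
    using der by (meson continuous_at_imp_continuous_on has_vector_derivative_continuous)
  then obtain m where m: "m \<in> {s..t}" "\<And>\<sigma>. \<sigma> \<in> {s..t} \<Longrightarrow> norm (Z \<sigma>) \<le> norm (Z m)"
    using continuous_attains_sup[of "{s..t}" "\<lambda>\<sigma>. norm (Z \<sigma>)"] \<tau>
    by (metis atLeastatMost_empty_iff compact_Icc continuous_on_norm empty_iff)
  define N where "N = norm (Z m)"
  have sub: "{s..m} \<subseteq> {s..t}" using m(1) by auto
  have ib: "b integrable_on {s..t}" "r integrable_on {s..t}"
    using b r by (auto intro: integrable_continuous_real)
  have ib': "(\<lambda>\<sigma>. b \<sigma> * N + r \<sigma>) integrable_on {s..u}" if "{s..u} \<subseteq> {s..t}" for u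
    by (intro integrable_continuous_real continuous_intros
        continuous_on_subset[OF b(1) that] continuous_on_subset[OF r(1) that])
  have Z': "(Z' has_integral (Z m - Z s)) {s..m}"
  proof (rule fundamental_theorem_of_calculus)
    show "(Z has_vector_derivative Z' \<sigma>) (at \<sigma> within {s..m})" if "\<sigma> \<in> {s..m}" for \<sigma>
      by (rule has_vector_derivative_at_within[OF der]) (use that sub in auto)
  qed (use m(1) in auto)
  have "N = norm (integral {s..m} Z')"
    using Z' \<open>Z s = 0\<close> by (simp add: N_def integral_unique)
  also have "\<dots> \<le> integral {s..m} (\<lambda>\<sigma>. b \<sigma> * N + r \<sigma>)"
  proof (rule integral_norm_bound_integral)
    fix \<sigma> assume "\<sigma> \<in> {s..m}"
    then have "\<sigma> \<in> {s..t}" using sub by auto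
    then show "norm (Z' \<sigma>) \<le> b \<sigma> * N + r \<sigma>"
      using bound[of \<sigma>] mult_left_mono[OF m(2) b(2), of \<sigma> \<sigma>] by (simp add: N_def)
  qed (use Z' ib'[OF sub] in auto)
  also have "\<dots> \<le> integral {s..t} (\<lambda>\<sigma>. b \<sigma> * N + r \<sigma>)"
    by (rule integral_subset_le[OF sub ib'[OF sub] ib'[OF order.refl]])
      (use b(2) r(2) in \<open>auto simp: N_def\<close>)
  also have "\<dots> = integral {s..t} b * N + integral {s..t} r"
    by (subst integral_add[OF integrable_on_mult_left[OF ib(1)] ib(2)]) simp
  finally have "N \<le> integral {s..t} b * N + integral {s..t} r" .
  moreover have "integral {s..t} b * N \<le> 1 / 2 * N"
    by (intro mult_right_mono small) (simp add: N_def)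
  ultimately show ?thesis using m(2)[OF \<tau>] by (simp add: N_def)
qed

section \<open>Hill's equation and the Schwarzian\<close>

text \<open>A plane curve with Wronskian 1 turns with speed 1 / R, where R is its squared length, so
  \<open>G\<close> is its angle. Differentiating 1 / R twice by Hill's equation produces
  \<open>V\<close> and \<open>N\<close> besides \<open>F\<close>; Lagrange's identity eliminates the
  square of \<open>V\<close>, and the terms in \<open>N\<close> cancel.\<close>

lemma hill_angle_smooth:
  assumes Y: "\<And>t. (Y1 has_real_derivative P1 t) (at t)" "\<And>t. (Y2 has_real_derivative P2 t) (at t)"
    and P: "\<And>t. (P1 has_real_derivative - (1 + F t / 2) * Y1 t) (at t)"
      "\<And>t. (P2 has_real_derivative - (1 + F t / 2) * Y2 t) (at t)"
    and W: "\<And>t. Y1 t * P2 t - P1 t * Y2 t = 1"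
    and G: "\<And>t. (G has_real_derivative 1 / ((Y1 t)\<^sup>2 + (Y2 t)\<^sup>2)) (at t)"
  shows "(deriv ^^ 3) G t / deriv G t - 3 / 2 * ((deriv ^^ 2) G t / deriv G t)\<^sup>2
      + 2 * (deriv G t)\<^sup>2 - 2 = F t"
proof -
  define R where "R t = (Y1 t)\<^sup>2 + (Y2 t)\<^sup>2" for t
  define V where "V t = Y1 t * P1 t + Y2 t * P2 t" for t
  define N where "N t = (P1 t)\<^sup>2 + (P2 t)\<^sup>2" for t
  define V' where "V' t = N t - (1 + F t / 2) * R t" for t
  have R: "R t > 0" for t
    using W[of t] unfolding R_def by (auto simp: sum_power2_gt_zero_iff)
  have dR: "(R has_real_derivative 2 * V t) (at t)" for t
    unfolding R_def[abs_def] V_def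
    by (rule derivative_eq_intros Y refl)+ (simp add: algebra_simps)
  have dV: "(V has_real_derivative V' t) (at t)" for t
    unfolding V_def[abs_def] V'_def N_def R_def
    by (rule derivative_eq_intros Y P refl)+ (simp add: algebra_simps power2_eq_square)
  define r where "r t = inverse (R t)" for t
  have r: "r t \<noteq> 0" "R t * r t = 1" for t
    using R[of t] by (auto simp: r_def)
  have dr: "(r has_real_derivative - 2 * V t * (r t)\<^sup>2) (at t)" for t
    using DERIV_inverse'[OF dR, of t] R[of t]
    by (simp add: r_def[abs_def] power2_eq_square mult_ac)
  have D1: "deriv G = r"
    using G by (auto simp: R_def r_def inverse_eq_divide intro!: DERIV_imp_deriv)
  have D2: "deriv r = (\<lambda>t. - 2 * V t * (r t)\<^sup>2)"
    using dr by (auto intro!: DERIV_imp_deriv)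
  have "((\<lambda>t. - 2 * V t * (r t)\<^sup>2) has_real_derivative
      - 2 * V' t * (r t)\<^sup>2 + 8 * (V t)\<^sup>2 * (r t) ^ 3) (at t)" for t
    by (rule derivative_eq_intros dr dV refl)+
       (simp add: power2_eq_square power3_eq_cube algebra_simps)
  from DERIV_imp_deriv[OF this, of t]
  have D3: "deriv (deriv r) t / r t = - 2 * V' t * r t + 8 * (V t)\<^sup>2 * (r t)\<^sup>2"
    unfolding D2 using r(1)[of t] by (simp add: field_simps power2_eq_square power3_eq_cube)
  \<comment> \<open>Lagrange's identity for the vectors (Y1, Y2) and (P1, P2), whose determinant is
    1.\<close>
  have "(V t)\<^sup>2 + (Y1 t * P2 t - P1 t * Y2 t)\<^sup>2 = R t * N t"
    unfolding V_def R_def N_def by (simp add: algebra_simps power2_eq_square)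
  then have VN: "(V t)\<^sup>2 = R t * N t - 1"
    unfolding W by simp
  have D2': "deriv r t / r t = - 2 * V t * r t"
    unfolding D2 using r(1)[of t] by (simp add: power2_eq_square)
  have "deriv (deriv r) t / r t - 3 / 2 * (deriv r t / r t)\<^sup>2 + 2 * (r t)\<^sup>2 - 2
      = - 2 * V' t * r t + 2 * ((V t)\<^sup>2 + 1) * (r t)\<^sup>2 - 2"
    unfolding D3 D2' by (simp add: power2_eq_square algebra_simps)
  also have "\<dots> = - 2 * (N t * r t) + (2 + F t) * (R t * r t) + 2 * (R t * r t) * (N t * r t) - 2"
    unfolding VN V'_def by (simp add: power2_eq_square algebra_simps)
  also have "\<dots> = F t"
    unfolding r(2) by simp
  finally show ?thesis
    by (simp add: numeral_2_eq_2 numeral_3_eq_3 D1)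
qed

text \<open>\<open>E\<close> is the cosine of the difference between \<open>G\<close> and the polar
  angle of the curve. It has derivative 0 and starts at 1, which identifies \<open>G\<close> with
  the polar angle without choosing a branch of the argument.\<close>

lemma hill_angle_polar:
  assumes Y: "\<And>t. (Y1 has_real_derivative P1 t) (at t)" "\<And>t. (Y2 has_real_derivative P2 t) (at t)"
    and W: "\<And>t. Y1 t * P2 t - P1 t * Y2 t = 1"
    and G: "\<And>t. (G has_real_derivative 1 / ((Y1 t)\<^sup>2 + (Y2 t)\<^sup>2)) (at t)"
    and init: "Y1 0 = 1" "Y2 0 = 0" "G 0 = 0"
  shows "Y1 t * cos (G t) + Y2 t * sin (G t) = sqrt ((Y1 t)\<^sup>2 + (Y2 t)\<^sup>2)"
proof -
  define R where "R t = (Y1 t)\<^sup>2 + (Y2 t)\<^sup>2" for t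
  define w where "w t = inverse (sqrt (R t))" for t
  define E where "E t = (Y1 t * cos (G t) + Y2 t * sin (G t)) * w t" for t
  have R: "R t > 0" for t
    using W[of t] unfolding R_def by (auto simp: sum_power2_gt_zero_iff)
  have G': "(G has_real_derivative 1 / R t) (at t)" for t
    using G by (simp add: R_def)
  have dR: "(R has_real_derivative 2 * (Y1 t * P1 t + Y2 t * P2 t)) (at t)" for t
    unfolding R_def[abs_def]
    by (rule derivative_eq_intros Y refl)+ (simp add: algebra_simps)
  have w: "w t * w t * R t = 1" for t
  proof -
    have "w t * sqrt (R t) = 1" using R[of t] by (simp add: w_def)
    then have "w t * w t * (sqrt (R t) * sqrt (R t)) = 1" by algebra
    then show ?thesis using R[of t] by simp
  qed
  have G'': "(G has_real_derivative w t * w t) (at t)" for t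
    using G'[of t] w[of t] R[of t] by (simp add: nonzero_eq_divide_eq[symmetric])
  have "((\<lambda>t. sqrt (R t)) has_real_derivative w t * (Y1 t * P1 t + Y2 t * P2 t)) (at t)" for t
    using DERIV_chain2[OF DERIV_real_sqrt[OF R] dR, of t] by (simp add: w_def algebra_simps)
  from DERIV_inverse'[OF this]
  have dw: "(w has_real_derivative - (Y1 t * P1 t + Y2 t * P2 t) * (w t * w t * w t)) (at t)" for t
    using R[of t] unfolding w_def[abs_def] by (simp add: algebra_simps)
  have dE: "(E has_real_derivative 0) (at t)" for t
  proof -
    define c n where "c = cos (G t)" "n = sin (G t)"
    have "(E has_real_derivative
       (P1 t * c - Y1 t * (n * (w t * w t)) + (P2 t * n + Y2 t * (c * (w t * w t)))) * w t
         - (Y1 t * c + Y2 t * n) * ((Y1 t * P1 t + Y2 t * P2 t) * (w t * w t * w t))) (at t)"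
      unfolding E_def[abs_def] c_n_def
      by (rule derivative_eq_intros Y G'' dw refl)+ (simp add: algebra_simps)
    moreover have "(P1 t * c - Y1 t * (n * (w t * w t)) + (P2 t * n + Y2 t * (c * (w t * w t)))) * w t
         - (Y1 t * c + Y2 t * n) * ((Y1 t * P1 t + Y2 t * P2 t) * (w t * w t * w t)) = 0"
      using W[of t] w[of t] unfolding R_def by algebra
    ultimately show ?thesis by simp
  qed
  have "E t = E 0"
    using DERIV_isconst_all[of E] dE by blast
  also have "E 0 = 1"
    by (simp add: E_def w_def R_def init)
  finally show ?thesis
    using R[of t] by (simp add: E_def w_def R_def field_simps)
qed

text \<open>Antiperiodicity alone makes the turning angle \<open>G pi\<close> an odd multiple of pi,
  and the larger ones would give covering maps of higher degree. By \<open>lower\<close> the angular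
  speed is at most 2, so the turning angle lies between 0 and 2 pi and must be pi.\<close>

lemma hill_projective_lift:
  assumes Y: "\<And>t. (Y1 has_real_derivative P1 t) (at t)" "\<And>t. (Y2 has_real_derivative P2 t) (at t)"
    and P: "\<And>t. (P1 has_real_derivative - (1 + F t / 2) * Y1 t) (at t)"
      "\<And>t. (P2 has_real_derivative - (1 + F t / 2) * Y2 t) (at t)"
    and W: "\<And>t. Y1 t * P2 t - P1 t * Y2 t = 1"
    and smooth: "smooth_real Y1" "smooth_real Y2"
    and init: "Y1 0 = 1" "Y2 0 = 0"
    and per: "\<And>t. Y1 (t + pi) = - Y1 t" "\<And>t. Y2 (t + pi) = - Y2 t"
    and lower: "\<And>t. 0 \<le> t \<Longrightarrow> t \<le> pi \<Longrightarrow> 1 / 2 \<le> (Y1 t)\<^sup>2 + (Y2 t)\<^sup>2"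
  shows "\<exists>G. smooth_real G \<and> (\<forall>t. deriv G t > 0) \<and> (\<forall>t. G (t + pi) = G t + pi) \<and>
    (\<forall>t. (deriv ^^ 3) G t / deriv G t - 3 / 2 * ((deriv ^^ 2) G t / deriv G t)\<^sup>2
      + 2 * (deriv G t)\<^sup>2 - 2 = F t)"
proof -
  define R where "R t = (Y1 t)\<^sup>2 + (Y2 t)\<^sup>2" for t
  have R: "R t > 0" for t
    using W[of t] unfolding R_def by (auto simp: sum_power2_gt_zero_iff)
  have sR: "smooth_real (\<lambda>t. 1 / R t)"
    unfolding R_def
    using smooth R[unfolded R_def, THEN less_imp_neq]
    by (intro smooth_real_divide smooth_real_const smooth_real_add smooth_real_power) auto
  obtain G where G0: "G 0 = 0" and dG: "\<And>t. (G has_real_derivative 1 / R t) (at t)"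
    using antiderivative_exists[OF smooth_real_continuous[OF sR], of 0]
    unfolding has_real_derivative_iff_has_vector_derivative by blast
  have dG': "(G has_real_derivative 1 / ((Y1 t)\<^sup>2 + (Y2 t)\<^sup>2)) (at t)" for t
    using dG by (simp add: R_def)
  have "smooth_real G" by (rule smooth_real_antiderivative[OF dG sR])
  have pos: "deriv G t > 0" for t
    using dG[THEN DERIV_imp_deriv] R by simp
  have "cos (G pi) = - 1"
    using hill_angle_polar[OF Y W dG' init G0, of pi] per[of 0] by (simp add: init)
  then obtain n :: int where n: "G pi = (2 * of_int n + 1) * pi"
    unfolding cos_eq_minus1 by (auto simp: algebra_simps)
  have "G 0 < G pi"
    using deriv_pos_strict_mono[OF \<open>smooth_real G\<close> pos] by (simp add: strict_mono_def)
  moreover have "G pi - G 0 \<le> 2 * pi - 2 * 0"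
  proof -
    obtain u where u: "0 < u" "u < pi" "G pi - G 0 = (pi - 0) * (1 / R u)"
      using MVT2[OF pi_gt_zero dG] by blast
    have "1 / R u \<le> 2"
      using lower[of u] u R[of u] by (simp add: R_def field_simps)
    then have "pi * (1 / R u) \<le> pi * 2" by (intro mult_left_mono) auto
    then show ?thesis using u(3) by simp
  qed
  ultimately have "0 * pi < (2 * of_int n + 1) * pi" "(2 * of_int n + 1) * pi \<le> 2 * pi"
    unfolding n G0 by auto
  then have "0 < (2 * of_int n + 1 :: real)" "(2 * of_int n + 1 :: real) \<le> 2"
    using mult_less_cancel_right_pos[OF pi_gt_zero] mult_le_cancel_right_pos[OF pi_gt_zero] by blast+
  then have "n = 0" by linarith
  then have Gpi: "G pi = pi" using n by simp
  have "G (t + pi) = G t + pi" for t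
  proof -
    have "((\<lambda>t. G (t + pi) - G t) has_real_derivative 0) (at t)" for t
    proof -
      have "((\<lambda>t. G (t + pi)) has_real_derivative 1 / R (t + pi)) (at t)"
        using dG[of "t + pi"] by (simp add: DERIV_shift)
      moreover have "R (t + pi) = R t" by (simp add: R_def per)
      ultimately show ?thesis
        using DERIV_diff[OF _ dG[of t]] by fastforce
    qed
    then have "G (t + pi) - G t = G (0 + pi) - G 0"
      using DERIV_isconst_all by blast
    then show ?thesis by (simp add: G0 Gpi)
  qed
  then show ?thesis
    using \<open>smooth_real G\<close> pos hill_angle_smooth[OF Y P W dG'] by (intro exI[of _ G]) simp
qed

text \<open>All data are parametrised by t, the argument of f; Hill's equation lives in the angle \<open>\<theta> = \<psi> t\<close>
  with \<open>d\<theta> = \<rho> dt\<close>, and the map \<open>\<phi>\<close> lifts to the inverse of \<open>\<psi>\<close>.\<close>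

lemma schwarzian_from_density:
  fixes f :: "rp1 \<Rightarrow> real"
  assumes f: "rp1_smooth f"
    and \<rho>: "smooth_real \<rho>" "\<And>t. \<rho> t > 0" and \<psi>: "\<And>t. (\<psi> has_real_derivative \<rho> t) (at t)"
      "\<And>t. \<psi> (t + pi) = \<psi> t + pi" "\<psi> t0 = 0"
    and y: "\<And>t. (y1 has_real_derivative \<rho> t * p1 t) (at t)"
      "\<And>t. (y2 has_real_derivative \<rho> t * p2 t) (at t)"
    and p: "\<And>t. (p1 has_real_derivative - \<rho> t * (1 + f (rp1_angle t) / 2) * y1 t) (at t)"
      "\<And>t. (p2 has_real_derivative - \<rho> t * (1 + f (rp1_angle t) / 2) * y2 t) (at t)"
    and W: "\<And>t. y1 t * p2 t - p1 t * y2 t = 1"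
    and smooth: "smooth_real y1" "smooth_real y2"
    and init: "y1 t0 = 1" "y2 t0 = 0"
    and per: "\<And>t. y1 (t + pi) = - y1 t" "\<And>t. y2 (t + pi) = - y2 t"
    and lower: "\<And>t. t0 \<le> t \<Longrightarrow> t \<le> t0 + pi \<Longrightarrow> 1 / 2 \<le> (y1 t)\<^sup>2 + (y2 t)\<^sup>2"
  shows "\<exists>\<phi> g. rp1_diffeomorphism \<phi> \<and> rp1_orientation_preserving \<phi> \<and>
               rp1_diffeomorphism g \<and> rp1_orientation_preserving g \<and>
               f \<circ> \<phi> = rp1_schwarzian g"
proof -
  have s\<psi>: "smooth_real \<psi>" by (rule smooth_real_antiderivative[OF \<psi>(1) \<rho>(1)])
  have d\<psi>: "deriv \<psi> t = \<rho> t" for t using \<psi>(1) by (rule DERIV_imp_deriv)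
  have pos\<psi>: "deriv \<psi> t > 0" for t by (simp add: d\<psi> \<rho>(2))
  have bij: "bij \<psi>" by (rule quasi_periodic_bij[OF s\<psi> pos\<psi> \<psi>(2)])
  then have inj: "inj \<psi>" and surj: "surj \<psi>" by (auto simp: bij_def)
  define \<omega> where "\<omega> = inv \<psi>"
  have \<omega>\<psi>: "\<omega> (\<psi> t) = t" "\<psi> (\<omega> t) = t" for t
    using inj surj by (auto simp: \<omega>_def surj_f_inv_f)
  have s\<omega>: "smooth_real \<omega>" unfolding \<omega>_def by (rule smooth_real_inv[OF s\<psi> pos\<psi> bij])
  have d\<omega>: "(\<omega> has_real_derivative inverse (\<rho> (\<omega> t))) (at t)" for t
    using has_derivative_inv_lift[OF s\<psi> pos\<psi> bij] unfolding \<omega>_def d\<psi> .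
  have pos\<omega>: "deriv \<omega> t > 0" for t
    using DERIV_imp_deriv[OF d\<omega>] \<rho>(2) by simp
  have per\<omega>: "\<omega> (t + pi) = \<omega> t + pi" for t
    using \<psi>(2)[of "\<omega> t"] \<omega>\<psi> by metis
  have \<omega>0: "\<omega> 0 = t0" "\<omega> pi = t0 + pi"
    using \<omega>\<psi>(1)[of t0] per\<omega>[of 0] \<psi>(3) by auto
  have mono: "strict_mono \<omega>" by (rule deriv_pos_strict_mono[OF s\<omega> pos\<omega>])
  \<comment> \<open>A derivative in \<open>t\<close> with the factor \<open>\<rho>\<close> becomes
    the plain derivative in the angle.\<close>
  have chain: "((\<lambda>t. k (\<omega> t)) has_real_derivative d t) (at t)"
    if "\<And>t. (k has_real_derivative k' t) (at t)" "\<And>t. k' (\<omega> t) = \<rho> (\<omega> t) * d t" for k k' d t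
    using DERIV_chain2[OF that(1)[of "\<omega> t"] d\<omega>[of t]] that(2)[of t] \<rho>(2)[of "\<omega> t"]
    by (simp add: field_simps)
  define F where "F t = f (rp1_angle (\<omega> t))" for t
  have "\<exists>G. smooth_real G \<and> (\<forall>t. deriv G t > 0) \<and> (\<forall>t. G (t + pi) = G t + pi) \<and>
    (\<forall>t. (deriv ^^ 3) G t / deriv G t - 3 / 2 * ((deriv ^^ 2) G t / deriv G t)\<^sup>2
      + 2 * (deriv G t)\<^sup>2 - 2 = F t)"
  proof (rule hill_projective_lift)
    show "((\<lambda>t. y1 (\<omega> t)) has_real_derivative p1 (\<omega> t)) (at t)"
      "((\<lambda>t. y2 (\<omega> t)) has_real_derivative p2 (\<omega> t)) (at t)" for t
      by (rule chain[OF y(1)], simp, rule chain[OF y(2)], simp)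
    show "((\<lambda>t. p1 (\<omega> t)) has_real_derivative - (1 + F t / 2) * y1 (\<omega> t)) (at t)"
      "((\<lambda>t. p2 (\<omega> t)) has_real_derivative - (1 + F t / 2) * y2 (\<omega> t)) (at t)" for t
      by (rule chain[OF p(1)], simp add: F_def algebra_simps, rule chain[OF p(2)], simp add: F_def algebra_simps)
    show "y1 (\<omega> t) * p2 (\<omega> t) - p1 (\<omega> t) * y2 (\<omega> t) = 1" for t by (rule W)
    show "smooth_real (\<lambda>t. y1 (\<omega> t))" "smooth_real (\<lambda>t. y2 (\<omega> t))"
      using smooth s\<omega> by (auto intro: smooth_real_compose)
    show "y1 (\<omega> 0) = 1" "y2 (\<omega> 0) = 0" by (simp_all add: \<omega>0 init)
    show "y1 (\<omega> (t + pi)) = - y1 (\<omega> t)" "y2 (\<omega> (t + pi)) = - y2 (\<omega> t)" for t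
      by (simp_all add: per\<omega> per)
    fix t :: real assume "0 \<le> t" "t \<le> pi"
    then have "\<omega> 0 \<le> \<omega> t" "\<omega> t \<le> \<omega> pi"
      using mono by (auto simp: strict_mono_less_eq)
    then show "1 / 2 \<le> (y1 (\<omega> t))\<^sup>2 + (y2 (\<omega> t))\<^sup>2"
      unfolding \<omega>0 by (rule lower)
  qed
  then obtain G where G: "smooth_real G" "\<And>t. deriv G t > 0" "\<And>t. G (t + pi) = G t + pi"
    "\<And>t. (deriv ^^ 3) G t / deriv G t - 3 / 2 * ((deriv ^^ 2) G t / deriv G t)\<^sup>2
      + 2 * (deriv G t)\<^sup>2 - 2 = F t" by blast
  obtain \<phi> where \<phi>: "rp1_lift \<omega> \<phi>" "rp1_diffeomorphism \<phi>" "rp1_orientation_preserving \<phi>"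
    by (rule quasi_periodic_diffeomorphism[OF s\<omega> pos\<omega> per\<omega>])
  obtain g where g: "rp1_lift G g" "rp1_diffeomorphism g" "rp1_orientation_preserving g"
    by (rule quasi_periodic_diffeomorphism[OF G(1,2,3)])
  have "f \<circ> \<phi> = rp1_schwarzian g"
  proof
    fix x
    obtain t where x: "x = rp1_angle t" using rp1_angle_surj by blast
    show "(f \<circ> \<phi>) x = rp1_schwarzian g x"
      unfolding x rp1_schwarzian_lift[OF G(1,2) g(1)] G(4)
      using \<phi>(1) by (simp add: rp1_lift_def F_def)
  qed
  with \<phi> g show ?thesis by blast
qed

section \<open>Solutions of the reparametrised Hill equation: Wronskians, smoothness,
  antiperiodicity\<close>

lemma hill_wronskian_const:
  assumes y: "\<And>t. (y has_real_derivative \<rho> t * p t) (at t)"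
      "\<And>t. (p has_real_derivative - \<rho> t * k t * y t) (at t)"
    and u: "\<And>t. (u has_real_derivative \<rho> t * v t) (at t)"
      "\<And>t. (v has_real_derivative - \<rho> t * k t * u t) (at t)"
  shows "u t * p t - v t * y t = u s * p s - v s * y s"
proof -
  have "((\<lambda>t. u t * p t - v t * y t) has_real_derivative 0) (at t)" for t
    by (rule derivative_eq_intros y u refl)+ (simp add: algebra_simps)
  then show ?thesis
    using DERIV_isconst_all[of "\<lambda>t. u t * p t - v t * y t" t s] by blast
qed

text \<open>Bootstrapping for the pair: the derivative of each of \<open>y\<close> and
  \<open>p\<close> is a smooth multiple of the other.\<close>

lemma hill_smooth:
  assumes \<rho>: "smooth_real \<rho>" and k: "smooth_real k"
    and y: "\<And>t. (y has_real_derivative \<rho> t * p t) (at t)"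
      "\<And>t. (p has_real_derivative - \<rho> t * k t * y t) (at t)"
  shows "smooth_real y"
proof (rule smooth_gen_smooth[of "{y, p}"])
  show "smooth_gen {y, p} y" by (rule smooth_gen.gen) simp
  fix h assume "h \<in> {y, p}"
  then consider "h = y" | "h = p" by blast
  then show "\<exists>h'. (\<forall>x. (h has_real_derivative h' x) (at x)) \<and> smooth_gen {y, p} h'"
  proof cases
    case 1
    have "smooth_gen {y, p} (\<lambda>t. \<rho> t * p t)"
      by (rule smooth_gen.mult[OF smooth_gen.base[OF \<rho>] smooth_gen.gen]) simp
    with 1 y(1) show ?thesis by (intro exI[of _ "\<lambda>t. \<rho> t * p t"]) simp
  next
    case 2
    have "smooth_real (\<lambda>t. (-1) * \<rho> t * k t)"
      by (intro smooth_real_mult smooth_real_const \<rho> k)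
    from smooth_gen.mult[OF smooth_gen.base[OF this] smooth_gen.gen[of y]]
    have "smooth_gen {y, p} (\<lambda>t. (-1) * \<rho> t * k t * y t)" by simp
    then have "smooth_gen {y, p} (\<lambda>t. - \<rho> t * k t * y t)" by simp
    with 2 y(2) show ?thesis by (intro exI[of _ "\<lambda>t. - \<rho> t * k t * y t"]) simp
  qed
qed

text \<open>Uniqueness in Wronskian form: \<open>u (t + c)\<close> and \<open>- u t\<close> solve
  the same system with the same data at \<open>s\<close>, so their constant Wronskians with
  \<open>y1\<close> and with \<open>y2\<close> agree, and these determine a solution.\<close>

lemma hill_antiperiodic:
  assumes \<rho>: "\<And>t. \<rho> (t + c) = \<rho> t" and k: "\<And>t. k (t + c) = k t"
    and y: "\<And>t. (y1 has_real_derivative \<rho> t * p1 t) (at t)"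
      "\<And>t. (p1 has_real_derivative - \<rho> t * k t * y1 t) (at t)"
      "\<And>t. (y2 has_real_derivative \<rho> t * p2 t) (at t)"
      "\<And>t. (p2 has_real_derivative - \<rho> t * k t * y2 t) (at t)"
    and u: "\<And>t. (u has_real_derivative \<rho> t * v t) (at t)"
      "\<And>t. (v has_real_derivative - \<rho> t * k t * u t) (at t)"
    and W: "\<And>t. y1 t * p2 t - p1 t * y2 t = 1"
    and s: "u (s + c) = - u s" "v (s + c) = - v s"
  shows "u (t + c) = - u t"
proof -
  have shift: "((\<lambda>t. h (t + c)) has_real_derivative h' (t + c)) (at t)"
    if "\<And>t. (h has_real_derivative h' t) (at t)" for h h' t
    using that[of "t + c"] by (simp add: DERIV_shift)
  have du: "((\<lambda>t. u (t + c)) has_real_derivative \<rho> t * v (t + c)) (at t)"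
    "((\<lambda>t. v (t + c)) has_real_derivative - \<rho> t * k t * u (t + c)) (at t)" for t
    using shift[OF u(1)] shift[OF u(2)] by (simp_all add: \<rho> k)
  have c: "u (t + c) * p t - v (t + c) * y t = - (u t * p t - v t * y t)"
    if y: "\<And>t. (y has_real_derivative \<rho> t * p t) (at t)"
      "\<And>t. (p has_real_derivative - \<rho> t * k t * y t) (at t)" for y p
    using hill_wronskian_const[OF y du, of t s] hill_wronskian_const[OF y u, of t s] s by simp
  \<comment> \<open>Cramer's rule: the value is recovered from its Wronskians with the basis
    \<open>y1\<close>, \<open>y2\<close>.\<close>
  have "u (t + c) * (y1 t * p2 t - p1 t * y2 t) = - u t * (y1 t * p2 t - p1 t * y2 t)"
    using c[OF y(1,2)] c[OF y(3,4)] by algebra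
  then show ?thesis by (simp add: W)
qed

text \<open>Variation of constants: \<open>y + \<i> y' = z cis (- \<psi>)\<close>, so that z is constant where f vanishes and
  trivial monodromy of z means monodromy -1 of y. The Wronskian makes \<open>Im (z2 (t0 + pi)) = 1\<close> automatic.\<close>

lemma schwarzian_from_system:
  fixes f :: "rp1 \<Rightarrow> real"
  assumes f: "rp1_smooth f"
    and \<rho>: "smooth_real \<rho>" "\<And>t. \<rho> t > 0" "\<And>t. \<rho> (t + pi) = \<rho> t"
    and \<psi>: "\<And>t. (\<psi> has_real_derivative \<rho> t) (at t)" "\<And>t. \<psi> (t + pi) = \<psi> t + pi" "\<psi> t0 = 0"
    and P: "\<And>t. P t = - \<i> * of_real (\<rho> t * f (rp1_angle t) / 4)"
    and z: "\<And>t. (z1 has_vector_derivative P t * z1 t + P t * cis (2 * \<psi> t) * cnj (z1 t)) (at t)"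
      "\<And>t. (z2 has_vector_derivative P t * z2 t + P t * cis (2 * \<psi> t) * cnj (z2 t)) (at t)"
    and init: "z1 t0 = 1" "z2 t0 = \<i>"
    and final: "z1 (t0 + pi) = 1" "Re (z2 (t0 + pi)) = 0"
    and close: "\<And>t. t \<in> {t0..t0 + pi} \<Longrightarrow> norm (z1 t - 1) \<le> 1 / 16"
      "\<And>t. t \<in> {t0..t0 + pi} \<Longrightarrow> norm (z2 t - \<i>) \<le> 1 / 16"
  shows "\<exists>\<phi> g. rp1_diffeomorphism \<phi> \<and> rp1_orientation_preserving \<phi> \<and>
               rp1_diffeomorphism g \<and> rp1_orientation_preserving g \<and>
               f \<circ> \<phi> = rp1_schwarzian g"
proof -
  define k where "k t = 1 + f (rp1_angle t) / 2" for t
  define y where "y z t = Re (z t * cis (- \<psi> t))" for z :: "real \<Rightarrow> complex" and t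
  define p where "p z t = Im (z t * cis (- \<psi> t))" for z :: "real \<Rightarrow> complex" and t
  have dy: "(y z has_real_derivative \<rho> t * p z t) (at t)"
    and dp: "(p z has_real_derivative - \<rho> t * k t * y z t) (at t)"
    if z: "\<And>t. (z has_vector_derivative P t * z t + P t * cis (2 * \<psi> t) * cnj (z t)) (at t)"
    for z t
  proof -
    define a b where "a t = Re (z t)" "b t = Im (z t)" for t
    have da: "(a has_real_derivative
        \<rho> t * f (rp1_angle t) / 4 * (b t + sin (2 * \<psi> t) * a t - cos (2 * \<psi> t) * b t)) (at t)"
      using bounded_linear.has_vector_derivative[OF bounded_linear_Re z[of t]]
      unfolding has_real_derivative_iff_has_vector_derivative a_b_def[abs_def]
      by (simp add: P algebra_simps add_divide_distrib diff_divide_distrib)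
    have db: "(b has_real_derivative
        - \<rho> t * f (rp1_angle t) / 4 * (a t + cos (2 * \<psi> t) * a t + sin (2 * \<psi> t) * b t)) (at t)"
      using bounded_linear.has_vector_derivative[OF bounded_linear_Im z[of t]]
      unfolding has_real_derivative_iff_has_vector_derivative a_b_def[abs_def]
      by (simp add: P algebra_simps add_divide_distrib diff_divide_distrib)
    define c n q where "c = cos (\<psi> t)" "n = sin (\<psi> t)" "q = f (rp1_angle t) / 4"
    have sc: "n * n = 1 - c * c"
      using sin_cos_squared_add[of "\<psi> t"] by (simp add: c_n_q_def power2_eq_square)
    have yeq: "y z = (\<lambda>t. a t * cos (\<psi> t) + b t * sin (\<psi> t))"
      and peq: "p z = (\<lambda>t. b t * cos (\<psi> t) - a t * sin (\<psi> t))"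
      by (simp_all add: y_def p_def a_b_def fun_eq_iff algebra_simps)
    have k: "k t = 1 + 2 * q" "f (rp1_angle t) = 4 * q" by (simp_all add: k_def c_n_q_def)
    have eq: "\<rho> t * q * (b t + 2 * n * c * a t - (c * c - n * n) * b t) * c - a t * (n * \<rho> t)
          + (- \<rho> t * q * (a t + (c * c - n * n) * a t + 2 * n * c * b t) * n + b t * (c * \<rho> t))
        = \<rho> t * (b t * c - a t * n)"
      "- \<rho> t * q * (a t + (c * c - n * n) * a t + 2 * n * c * b t) * c - b t * (n * \<rho> t)
          - (\<rho> t * q * (b t + 2 * n * c * a t - (c * c - n * n) * b t) * n + a t * (c * \<rho> t))
        = - \<rho> t * (1 + 2 * q) * (a t * c + b t * n)"
      using sc by algebra+
    show "(y z has_real_derivative \<rho> t * p z t) (at t)"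
      unfolding yeq peq
      by (rule derivative_eq_intros da db \<psi>(1) refl)+
         (use eq(1) in \<open>simp add: k(2) sin_double cos_double power2_eq_square flip: c_n_q_def; simp add: algebra_simps\<close>)
    show "(p z has_real_derivative - \<rho> t * k t * y z t) (at t)"
      unfolding yeq peq
      by (rule derivative_eq_intros da db \<psi>(1) refl)+
         (use eq(2) in \<open>simp add: k sin_double cos_double power2_eq_square flip: c_n_q_def; simp add: algebra_simps\<close>)
  qed
  note d = dy[OF z(1)] dp[OF z(1)] dy[OF z(2)] dp[OF z(2)]
  have smooth_k: "smooth_real k"
    using f unfolding k_def rp1_smooth_def comp_def
    by (intro smooth_real_add smooth_real_divide smooth_real_const) auto
  have per_k: "k (t + pi) = k t" for t
    using rp1_angle_shift[of t 1] by (simp add: k_def)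
  have W: "y z1 t * p z2 t - p z1 t * y z2 t = 1" for t
    using hill_wronskian_const[OF d(3,4) d(1,2), of t t0] by (simp add: y_def p_def init \<psi>(3))
  have e0: "y z1 t0 = 1" "p z1 t0 = 0" "y z2 t0 = 0" "p z2 t0 = 1"
    by (simp_all add: y_def p_def init \<psi>(3))
  \<comment> \<open>The rotating frame makes half a turn per period; this is the sign that turns
    trivial monodromy of \<open>z\<close> into antiperiodicity of \<open>y\<close>.\<close>
  have "cis (- \<psi> (t0 + pi)) = - 1"
    using cis_pi by (simp add: \<psi>(2,3) cis_cnj[symmetric])
  then have e1: "y z1 (t0 + pi) = - 1" "p z1 (t0 + pi) = 0" "y z2 (t0 + pi) = 0"
    by (simp_all add: y_def p_def final)
  then have e2: "p z2 (t0 + pi) = - 1"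
    using W[of "t0 + pi"] by simp
  show ?thesis
  proof (rule schwarzian_from_density[OF f \<rho>(1,2) \<psi> d(1,3) d(2,4)[unfolded k_def] W])
    show "y z1 (t + pi) = - y z1 t" "y z2 (t + pi) = - y z2 t" for t
      by (rule hill_antiperiodic[OF \<rho>(3) per_k d _ _ W, where s = t0], (rule d)+, simp_all add: e0 e1 e2)+
    show "smooth_real (y z1)" "smooth_real (y z2)"
      by (rule hill_smooth[OF \<rho>(1) smooth_k d(1,2)], rule hill_smooth[OF \<rho>(1) smooth_k d(3,4)])
    fix t assume t: "t0 \<le> t" "t \<le> t0 + pi"
    \<comment> \<open>The deviations from the unperturbed solutions cos and sin of the angle. With
      the bound 1/16 the squared length is at least 1 - 4/16, well above 1/2.\<close>
    define a b where "a = y z1 t - cos (\<psi> t)" "b = y z2 t - sin (\<psi> t)"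
    have "a = Re ((z1 t - 1) * cis (- \<psi> t))" "b = Re ((z2 t - \<i>) * cis (- \<psi> t))"
      by (simp_all add: a_b_def y_def algebra_simps)
    then have "\<bar>a\<bar> \<le> norm ((z1 t - 1) * cis (- \<psi> t))" "\<bar>b\<bar> \<le> norm ((z2 t - \<i>) * cis (- \<psi> t))"
      using abs_Re_le_cmod by metis+
    then have ab: "\<bar>a\<bar> \<le> 1 / 16" "\<bar>b\<bar> \<le> 1 / 16"
      using close[of t] t by (auto simp: norm_mult)
    have "\<bar>cos (\<psi> t) * a\<bar> \<le> 1 * (1 / 16)" "\<bar>sin (\<psi> t) * b\<bar> \<le> 1 * (1 / 16)"
      unfolding abs_mult by (intro mult_mono ab abs_cos_le_one abs_sin_le_one; simp)+
    moreover have "(y z1 t)\<^sup>2 + (y z2 t)\<^sup>2 = 1 + 2 * (cos (\<psi> t) * a) + 2 * (sin (\<psi> t) * b) + a\<^sup>2 + b\<^sup>2"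
      using sin_cos_squared_add[of "\<psi> t"] unfolding a_b_def by algebra
    ultimately show "1 / 2 \<le> (y z1 t)\<^sup>2 + (y z2 t)\<^sup>2"
      using zero_le_power2[of a] zero_le_power2[of b] by linarith
  qed (rule e0)+
qed

section \<open>Concentrated densities\<close>

lemma cos_sq_le:
  assumes "0 \<le> \<eta>" "\<eta> \<le> pi / 2" "\<eta> \<le> \<bar>x\<bar>" "\<bar>x\<bar> \<le> pi - \<eta>"
  shows "(cos x)\<^sup>2 \<le> (cos \<eta>)\<^sup>2"
proof -
  have "cos \<bar>x\<bar> \<le> cos \<eta>" "cos (pi - \<eta>) \<le> cos \<bar>x\<bar>"
    using assms by (intro cos_monotone_0_pi_le; linarith)+
  then have "\<bar>cos x\<bar> \<le> \<bar>cos \<eta>\<bar>" by simp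
  then show ?thesis by (simp add: abs_le_square_iff)
qed

lemma antiderivative_diff_le:
  assumes "\<And>t. (A has_real_derivative B t) (at t)" "s \<le> t" "\<And>x. s \<le> x \<Longrightarrow> x \<le> t \<Longrightarrow> B x \<le> D"
  shows "A t - A s \<le> (t - s) * D"
proof (cases "s = t")
  case False
  then obtain x where "s < x" "x < t" "A t - A s = (t - s) * B x"
    using MVT2[of s t A B] assms(1,2) by auto
  then show ?thesis
    using assms(2) assms(3)[of x] by (auto intro!: mult_left_mono)
qed simp

lemma antiderivative_diff_ge:
  assumes "\<And>t. (A has_real_derivative B t) (at t)" "s \<le> t" "\<And>x. s \<le> x \<Longrightarrow> x \<le> t \<Longrightarrow> D \<le> B x"
  shows "(t - s) * D \<le> A t - A s"
  using antiderivative_diff_le[of "\<lambda>t. - A t" "\<lambda>t. - B t" s t "- D"] assms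
  by (simp add: DERIV_minus)

text \<open>A density on the circle of length pi together with its distribution function
  \<open>\<Phi>\<close>: unit mass per period, and in the period starting at \<open>t0\<close> mass
  at most \<open>\<eta>\<close> on either side of the window around \<open>p\<close>. Concentration
  is stated through \<open>\<Phi>\<close> because the same function later contributes to the angle
  \<open>\<psi>\<close>.\<close>

definition bump :: "real \<Rightarrow> real \<Rightarrow> real \<Rightarrow> (real \<Rightarrow> real) \<Rightarrow> (real \<Rightarrow> real) \<Rightarrow> bool" where
  "bump t0 \<eta> p \<beta> \<Phi> \<longleftrightarrow> smooth_real \<beta> \<and> (\<forall>t. \<beta> t > 0) \<and> (\<forall>t. \<beta> (t + pi) = \<beta> t) \<and>
     (\<forall>t. (\<Phi> has_real_derivative \<beta> t) (at t)) \<and> \<Phi> t0 = 0 \<and> (\<forall>t. \<Phi> (t + pi) = \<Phi> t + 1) \<and>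
     \<Phi> (p - \<eta>) \<le> \<eta> \<and> 1 - \<eta> \<le> \<Phi> (p + \<eta>)"

text \<open>The normalised powers of 1 + cos^2 (t - p) concentrate at p; the summand 1 keeps them positive.\<close>

lemma bump_exists:
  assumes \<eta>: "0 < \<eta>" and p: "t0 \<le> p - \<eta>" "p + \<eta> \<le> t0 + pi"
  shows "\<exists>\<beta> \<Phi>. bump t0 \<eta> p \<beta> \<Phi>"
proof -
  have \<eta>2: "\<eta> \<le> pi / 2" using p by simp
  define b where "b t = 1 + (cos (t - p))\<^sup>2" for t
  \<comment> \<open>Outside the window \<open>b\<close> is at most \<open>u\<close>; within half its
    radius \<open>b\<close> is at least \<open>w\<close>. The power \<open>n\<close> is chosen so
    that the outer mass, at most \<open>pi * u ^ n\<close>, is at most the fraction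
    \<open>\<eta>\<close> of the inner mass, at least \<open>\<eta> * w ^ n\<close>.\<close>
  define u where "u = b (p + \<eta>)"
  define w where "w = b (p + \<eta> / 2)"
  have b1: "b t \<ge> 1" for t by (simp add: b_def)
  have uw: "u < w"
  proof -
    have "cos \<eta> < cos (\<eta> / 2)" using \<eta> \<eta>2 by (intro cos_monotone_0_pi) auto
    moreover have "0 \<le> cos \<eta>" using \<eta> \<eta>2 by (intro cos_ge_zero) auto
    ultimately show ?thesis by (simp add: u_def w_def b_def power_strict_mono)
  qed
  have u1: "1 \<le> u" by (simp add: u_def b1)
  obtain n where n: "(u / w) ^ n < \<eta>\<^sup>2 / pi"
    using real_arch_pow_inv[of "\<eta>\<^sup>2 / pi" "u / w"] \<eta> uw u1 by auto
  have nw: "pi * u ^ n \<le> \<eta> * (\<eta> * w ^ n)"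
    using n u1 uw by (simp add: power_divide field_simps power2_eq_square)
  define B where "B t = b t ^ n" for t
  have sB: "smooth_real B"
    unfolding B_def b_def
    by (intro smooth_real_power smooth_real_add smooth_real_const smooth_real_cos smooth_real_diff
        smooth_real_ident)
  have B0: "B t > 0" for t using b1[of t] by (simp add: B_def)
  have Bper: "B (t + pi) = B t" for t
    using cos_periodic_pi[of "t - p"] by (simp add: B_def b_def algebra_simps)
  obtain A where A0: "A t0 = 0" and dA: "\<And>t. (A has_real_derivative B t) (at t)"
    using antiderivative_exists[OF smooth_real_continuous[OF sB], of t0]
    unfolding has_real_derivative_iff_has_vector_derivative by blast
  define c where "c = A (t0 + pi)"
  have Aper: "A (t + pi) = A t + c" for t
  proof -
    have "((\<lambda>t. A (t + pi) - A t) has_real_derivative 0) (at t)" for t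
    proof -
      have "((\<lambda>t. A (t + pi)) has_real_derivative B t) (at t)"
        using dA[of "t + pi"] by (simp add: DERIV_shift Bper)
      from DERIV_diff[OF this dA] show ?thesis by simp
    qed
    then have "A (t + pi) - A t = A (t0 + pi) - A t0"
      using DERIV_isconst_all[of "\<lambda>t. A (t + pi) - A t" t t0] by blast
    then show ?thesis by (simp add: A0 c_def)
  qed
  have mono: "A s \<le> A t" if "s \<le> t" for s t
    using antiderivative_diff_ge[OF dA that, of 0] B0 by (simp add: less_imp_le)
  have "\<eta> * w ^ n \<le> A (p + \<eta> / 2) - A (p - \<eta> / 2)"
  proof -
    have "w ^ n \<le> B x" if "p - \<eta> / 2 \<le> x" "x \<le> p + \<eta> / 2" for x
    proof -
      have "\<bar>x - p\<bar> \<le> \<eta> / 2" using that by linarith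
      then have "cos (\<eta> / 2) \<le> cos \<bar>x - p\<bar>"
        using \<eta> \<eta>2 by (intro cos_monotone_0_pi_le) auto
      then have "(cos (\<eta> / 2))\<^sup>2 \<le> (cos (x - p))\<^sup>2"
        using \<eta> \<eta>2 by (intro power_mono cos_ge_zero) auto
      then show ?thesis
        unfolding B_def using b1[of "p + \<eta> / 2"] by (intro power_mono) (auto simp: w_def b_def)
    qed
    then show ?thesis
      using antiderivative_diff_ge[OF dA, of "p - \<eta> / 2" "p + \<eta> / 2" "w ^ n"] \<eta> by simp
  qed
  also have "\<dots> \<le> c"
    using mono[of "p + \<eta> / 2" "t0 + pi"] mono[of t0 "p - \<eta> / 2"] p \<eta> by (simp add: c_def A0)
  finally have cw: "\<eta> * w ^ n \<le> c" .
  have "0 < \<eta> * w ^ n" using \<eta> u1 uw by simp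
  with cw have c0: "c > 0" by linarith
  have tail: "(t - s) * u ^ n \<le> \<eta> * c" if "t - s \<le> pi" for s t
  proof -
    have "(t - s) * u ^ n \<le> pi * u ^ n" using that u1 by (intro mult_right_mono) auto
    also note nw
    also have "\<eta> * (\<eta> * w ^ n) \<le> \<eta> * c" using cw \<eta> by (intro mult_left_mono) auto
    finally show ?thesis .
  qed
  have Bu: "B x \<le> u ^ n" if "\<eta> \<le> \<bar>x - p\<bar>" "\<bar>x - p\<bar> \<le> pi - \<eta>" for x
    unfolding B_def u_def using cos_sq_le[OF _ \<eta>2 that] \<eta> b1[of x] by (intro power_mono) (auto simp: b_def)
  have "A (p - \<eta>) - A t0 \<le> (p - \<eta> - t0) * u ^ n"
    using p \<eta> by (intro antiderivative_diff_le[OF dA] Bu) auto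
  also have "\<dots> \<le> \<eta> * c" using p \<eta> by (intro tail) auto
  finally have left: "A (p - \<eta>) \<le> \<eta> * c" by (simp add: A0)
  have "A (t0 + pi) - A (p + \<eta>) \<le> (t0 + pi - (p + \<eta>)) * u ^ n"
    using p \<eta> by (intro antiderivative_diff_le[OF dA] Bu) auto
  also have "\<dots> \<le> \<eta> * c" using p \<eta> by (intro tail) auto
  finally have right: "c - A (p + \<eta>) \<le> \<eta> * c" by (simp add: c_def)
  have "bump t0 \<eta> p (\<lambda>t. B t / c) (\<lambda>t. A t / c)"
    unfolding bump_def
  proof (intro conjI allI)
    show "smooth_real (\<lambda>t. B t / c)"
      using c0 by (intro smooth_real_divide sB smooth_real_const) auto
    show "((\<lambda>t. A t / c) has_real_derivative B t / c) (at t)" for t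
      by (rule DERIV_cdivide[OF dA])
  qed (use c0 B0 Bper A0 Aper left right in \<open>auto simp: field_simps\<close>)
  then show ?thesis by blast
qed

lemma weighted_integral_bound:
  fixes H :: "real \<Rightarrow> 'a::{real_normed_field, banach}"
  assumes "a \<le> b" and \<Phi>: "\<And>t. (\<Phi> has_real_derivative \<beta> t) (at t)" and \<beta>: "\<And>t. 0 \<le> \<beta> t"
    and cont: "continuous_on {a..b} \<beta>" "continuous_on {a..b} H"
    and H: "\<And>t. a \<le> t \<Longrightarrow> t \<le> b \<Longrightarrow> norm (H t) \<le> D"
  shows "norm (integral {a..b} (\<lambda>t. of_real (\<beta> t) * H t)) \<le> D * (\<Phi> b - \<Phi> a)"
proof -
  have i: "((\<lambda>t. D * \<beta> t) has_integral D * (\<Phi> b - \<Phi> a)) {a..b}"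
    using \<Phi> \<open>a \<le> b\<close>
    by (intro has_integral_mult_right fundamental_theorem_of_calculus)
       (auto simp: has_real_derivative_iff_has_vector_derivative[symmetric]
         intro: has_field_derivative_at_within)
  have "norm (integral {a..b} (\<lambda>t. of_real (\<beta> t) * H t)) \<le> integral {a..b} (\<lambda>t. D * \<beta> t)"
  proof (rule integral_norm_bound_integral)
    show "(\<lambda>t. of_real (\<beta> t) * H t) integrable_on {a..b}"
      by (intro integrable_continuous_real continuous_intros cont)
    show "norm (of_real (\<beta> t) * H t) \<le> D * \<beta> t" if "t \<in> {a..b}" for t
      using mult_right_mono[OF H \<beta>, of t t] that \<beta>[of t] by (simp add: norm_mult mult.commute)
  qed (use i in blast)
  then show ?thesis using integral_unique[OF i] by metis
qed

text \<open>Integration against a bump is almost evaluation at \<open>p\<close>: the window has mass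
  at most 1 and contributes \<open>\<delta>\<close>, and each tail has mass at most
  \<open>\<eta>\<close> and contributes at most \<open>M * \<eta>\<close>.\<close>

lemma bump_integral:
  fixes H :: "real \<Rightarrow> 'a::{real_normed_field, banach}"
  assumes b: "bump t0 \<eta> p \<beta> \<Phi>" and \<eta>: "0 < \<eta>" and p: "t0 \<le> p - \<eta>" "p + \<eta> \<le> t0 + pi"
    and cont: "continuous_on {t0..t0 + pi} H"
    and near: "\<And>t. p - \<eta> \<le> t \<Longrightarrow> t \<le> p + \<eta> \<Longrightarrow> norm (H t - h) \<le> \<delta>"
    and far: "\<And>t. t0 \<le> t \<Longrightarrow> t \<le> t0 + pi \<Longrightarrow> norm (H t - h) \<le> M"
  shows "norm (integral {t0..t0 + pi} (\<lambda>t. of_real (\<beta> t) * H t) - h) \<le> \<delta> + 2 * M * \<eta>"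
proof -
  have \<beta>: "\<And>t. 0 \<le> \<beta> t" and \<Phi>: "\<And>t. (\<Phi> has_real_derivative \<beta> t) (at t)"
    and \<Phi>0: "\<Phi> t0 = 0" "\<Phi> (t0 + pi) = 1" "\<Phi> (p - \<eta>) \<le> \<eta>" "1 - \<eta> \<le> \<Phi> (p + \<eta>)" and s\<beta>: "smooth_real \<beta>"
    using b by (auto simp: bump_def less_imp_le)
  define I where "I a b = integral {a..b} (\<lambda>t. of_real (\<beta> t) * (H t - h))" for a b
  have mono: "\<Phi> s \<le> \<Phi> t" if "s \<le> t" for s t
    using antiderivative_diff_ge[OF \<Phi> that, of 0] \<beta> by simp
  have cont': "continuous_on {a..b} (\<lambda>t. H t - h)" if "{a..b} \<subseteq> {t0..t0 + pi}" for a b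
    by (intro continuous_intros continuous_on_subset[OF cont that])
  have int: "(\<lambda>t. of_real (\<beta> t) * (H t - h)) integrable_on {a..b}" if "{a..b} \<subseteq> {t0..t0 + pi}" for a b
    by (intro integrable_continuous_real continuous_on_mult cont'[OF that]
        continuous_on_of_real smooth_real_continuous[OF s\<beta>])
  have bound: "norm (I a b) \<le> D * (\<Phi> b - \<Phi> a)"
    if "a \<le> b" "{a..b} \<subseteq> {t0..t0 + pi}" "\<And>t. a \<le> t \<Longrightarrow> t \<le> b \<Longrightarrow> norm (H t - h) \<le> D" for a b D
    unfolding I_def
    by (rule weighted_integral_bound[OF that(1) \<Phi> \<beta> smooth_real_continuous[OF s\<beta>] cont'[OF that(2)] that(3)])
  have "M \<ge> 0" using order.trans[OF norm_ge_zero far[of t0]] by simp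
  have "\<delta> \<ge> 0" using order.trans[OF norm_ge_zero near[of p]] \<eta> by simp
  have i1: "((\<lambda>t. \<beta> t) has_integral 1) {t0..t0 + pi}"
    using fundamental_theorem_of_calculus[of t0 "t0 + pi" \<Phi> \<beta>] \<Phi> \<Phi>0(1,2)
    by (simp add: has_real_derivative_iff_has_vector_derivative[symmetric] has_field_derivative_at_within)
  then have i2: "((\<lambda>t. of_real (\<beta> t) * h) has_integral h) {t0..t0 + pi}"
    using has_integral_mult_left[OF has_integral_of_real[OF i1], of h] by simp
  have "I t0 (t0 + pi) = integral {t0..t0 + pi} (\<lambda>t. of_real (\<beta> t) * H t) - h"
  proof -
    have "(\<lambda>t. of_real (\<beta> t) * H t) integrable_on {t0..t0 + pi}"
      by (intro integrable_continuous_real continuous_on_mult cont continuous_on_of_real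
          smooth_real_continuous[OF s\<beta>])
    from has_integral_diff[OF integrable_integral[OF this] i2] show ?thesis
      unfolding I_def right_diff_distrib by (rule integral_unique)
  qed
  moreover have "I t0 (t0 + pi) = I t0 (p - \<eta>) + (I (p - \<eta>) (p + \<eta>) + I (p + \<eta>) (t0 + pi))"
    using Henstock_Kurzweil_Integration.integral_combine[where f = "\<lambda>t. of_real (\<beta> t) * (H t - h)" and a = t0 and c = "p - \<eta>" and b = "t0 + pi"]
      Henstock_Kurzweil_Integration.integral_combine[where f = "\<lambda>t. of_real (\<beta> t) * (H t - h)" and a = "p - \<eta>" and c = "p + \<eta>" and b = "t0 + pi"]
      int[of t0 "t0 + pi"] int[of "p - \<eta>" "t0 + pi"] p \<eta>
    by (simp add: I_def)
  moreover have "norm (I t0 (p - \<eta>)) \<le> M * \<eta>"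
  proof -
    have "norm (I t0 (p - \<eta>)) \<le> M * (\<Phi> (p - \<eta>) - \<Phi> t0)"
      using p \<eta> by (intro bound far) auto
    also have "\<dots> \<le> M * \<eta>" using \<Phi>0 \<open>M \<ge> 0\<close> by (intro mult_left_mono) auto
    finally show ?thesis .
  qed
  moreover have "norm (I (p + \<eta>) (t0 + pi)) \<le> M * \<eta>"
  proof -
    have "norm (I (p + \<eta>) (t0 + pi)) \<le> M * (\<Phi> (t0 + pi) - \<Phi> (p + \<eta>))"
      using p \<eta> by (intro bound far) auto
    also have "\<dots> \<le> M * \<eta>" using \<Phi>0 \<open>M \<ge> 0\<close> by (intro mult_left_mono) auto
    finally show ?thesis .
  qed
  moreover have "norm (I (p - \<eta>) (p + \<eta>)) \<le> \<delta>"
  proof -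
    have "norm (I (p - \<eta>) (p + \<eta>)) \<le> \<delta> * (\<Phi> (p + \<eta>) - \<Phi> (p - \<eta>))"
      using p \<eta> by (intro bound near) auto
    also have "\<dots> \<le> \<delta> * 1"
      using mono[of t0 "p - \<eta>"] mono[of "p + \<eta>" "t0 + pi"] p \<Phi>0 \<open>\<delta> \<ge> 0\<close>
      by (intro mult_left_mono) auto
    finally show ?thesis by simp
  qed
  ultimately show ?thesis
    using norm_triangle_ineq[of "I t0 (p - \<eta>)" "I (p - \<eta>) (p + \<eta>) + I (p + \<eta>) (t0 + pi)"]
      norm_triangle_ineq[of "I (p - \<eta>) (p + \<eta>)" "I (p + \<eta>) (t0 + pi)"] by simp
qed

section \<open>The monodromy of a concentrated density\<close>

lemma norm_cis_diff_le: "norm (cis a - cis b) \<le> \<bar>a - b\<bar>"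
proof -
  have "norm (cis a - cis b) \<le> 1 * norm (a - b)"
  proof (rule differentiable_bound[of UNIV cis "\<lambda>x h. h *\<^sub>R (\<i> * cis x)"])
    show "(cis has_derivative (\<lambda>h. h *\<^sub>R (\<i> * cis x))) (at x within UNIV)" for x
      by (rule has_derivative_eq_rhs) (auto intro!: derivative_eq_intros simp: fun_eq_iff)
    show "onorm (\<lambda>h. h *\<^sub>R (\<i> * cis x)) \<le> 1" for x
      by (rule onorm_le) (simp add: norm_mult)
  qed auto
  then show ?thesis by simp
qed

lemma sum_lessThan_8: "(\<Sum>k<8. g k) = (\<Sum>i<4. g (2 * i) + g (2 * i + 1 :: nat))"
  for g :: "nat \<Rightarrow> 'a::comm_monoid_add"
  by (simp add: eval_nat_numeral add_ac)

lemma sum_lessThan_4_expand: "(\<Sum>k<4. g k) = g 0 + g 1 + g 2 + g (3 :: nat)"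
  and sum_lessThan_8_expand: "(\<Sum>k<8. g k) = g 0 + g 1 + g 2 + g 3 + g 4 + g 5 + g 6 + g (7 :: nat)"
  for g :: "nat \<Rightarrow> 'a::comm_monoid_add"
  by (simp_all add: eval_nat_numeral)

text \<open>Of the eight points p k, the odd ones are zeros of f and the even ones carry its alternating signs.\<close>

locale pulses =
  fixes f :: "rp1 \<Rightarrow> real" and t0 \<eta> \<epsilon> M :: real and p :: "nat \<Rightarrow> real"
    and \<beta> \<Phi> :: "nat \<Rightarrow> real \<Rightarrow> real"
  assumes smooth_f: "rp1_smooth f"
    and bump: "\<And>k. k < 8 \<Longrightarrow> bump t0 \<eta> (p k) (\<beta> k) (\<Phi> k)"
    and \<eta>: "0 < \<eta>" "\<eta> \<le> \<epsilon>\<^sup>2"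
    and \<epsilon>: "0 < \<epsilon>" "3000 * M ^ 4 * \<epsilon> \<le> 1" and M: "1 \<le> M"
    and inside: "\<And>k. k < 8 \<Longrightarrow> t0 \<le> p k - \<eta>" "\<And>k. k < 8 \<Longrightarrow> p k + \<eta> \<le> t0 + pi"
    and sep: "\<And>j k. j < k \<Longrightarrow> k < 8 \<Longrightarrow> p j + \<eta> \<le> p k - \<eta>"
    and bound: "\<And>t. t \<in> {t0..t0 + pi} \<Longrightarrow> \<bar>f (rp1_angle t)\<bar> \<le> M"
    and near: "\<And>k t. k < 8 \<Longrightarrow> \<bar>t - p k\<bar> \<le> \<eta> \<Longrightarrow> \<bar>f (rp1_angle t) - f (rp1_angle (p k))\<bar> \<le> \<epsilon>\<^sup>2"
    and zero: "\<And>k. k < 8 \<Longrightarrow> odd k \<Longrightarrow> f (rp1_angle (p k)) = 0"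
    and nonzero: "\<And>k. k < 8 \<Longrightarrow> even k \<Longrightarrow> 1 \<le> M * \<bar>f (rp1_angle (p k))\<bar>"
begin

section \<open>The system belonging to a choice of weights, its solutions and their dependence on
  the weights\<close>

definition F :: "real \<Rightarrow> real" where "F t = f (rp1_angle t)"
definition \<rho> :: "(nat \<Rightarrow> real) \<Rightarrow> real \<Rightarrow> real" where "\<rho> w t = (\<Sum>k<8. w k * \<beta> k t)"
definition \<psi> :: "(nat \<Rightarrow> real) \<Rightarrow> real \<Rightarrow> real" where "\<psi> w t = (\<Sum>k<8. w k * \<Phi> k t)"
definition P :: "(nat \<Rightarrow> real) \<Rightarrow> real \<Rightarrow> complex" where
  "P w t = - \<i> * of_real (\<rho> w t * F t / 4)"
definition rhs :: "(nat \<Rightarrow> real) \<Rightarrow> real \<Rightarrow> complex \<Rightarrow> complex" where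
  "rhs w t z = P w t * z + P w t * cis (2 * \<psi> w t) * cnj z"
definition sol :: "(nat \<Rightarrow> real) \<Rightarrow> complex \<Rightarrow> real \<Rightarrow> complex" where
  "sol w v = (SOME z. z t0 = v \<and> (\<forall>t. (z has_vector_derivative rhs w t (z t)) (at t)))"
text \<open>The operator norm bound for \<open>rhs\<close>: twice the modulus of \<open>P\<close>,
  once for z and once for its conjugate.\<close>

definition b :: "(nat \<Rightarrow> real) \<Rightarrow> real \<Rightarrow> real" where "b w t = \<rho> w t * (\<bar>F t\<bar> / 2)"
definition I :: "real set" where "I = {t0..t0 + pi}"
definition adm :: "(nat \<Rightarrow> real) \<Rightarrow> bool" where
  "adm w \<longleftrightarrow> (\<forall>k<8. 0 \<le> w k \<and> w k \<le> 1)"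

lemma F_bound: "t \<in> I \<Longrightarrow> \<bar>F t\<bar> \<le> M"
  using bound by (simp add: F_def I_def)

lemma smooth_F: "smooth_real F"
  using smooth_f by (simp add: rp1_smooth_def comp_def F_def[abs_def])

lemma bumpD:
  assumes "k < 8"
  shows "smooth_real (\<beta> k)" "\<beta> k t > 0" "\<beta> k (t + pi) = \<beta> k t"
    "(\<Phi> k has_real_derivative \<beta> k t) (at t)" "\<Phi> k t0 = 0" "\<Phi> k (t + pi) = \<Phi> k t + 1"
    "\<Phi> k (p k - \<eta>) \<le> \<eta>" "1 - \<eta> \<le> \<Phi> k (p k + \<eta>)"
  using bump[OF assms] by (auto simp: bump_def)

lemma \<Phi>_mono: "k < 8 \<Longrightarrow> s \<le> t \<Longrightarrow> \<Phi> k s \<le> \<Phi> k t"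
  using antiderivative_diff_ge[OF bumpD(4), of k s t 0] bumpD(2) by (simp add: less_imp_le)

lemma \<Phi>_range: "k < 8 \<Longrightarrow> t \<in> I \<Longrightarrow> 0 \<le> \<Phi> k t \<and> \<Phi> k t \<le> 1"
  using \<Phi>_mono[of k t0 t] \<Phi>_mono[of k t "t0 + pi"] bumpD(5)[of k] bumpD(6)[of k t0]
  by (simp add: I_def)

lemma smooth_\<rho>: "smooth_real (\<rho> w)"
  unfolding \<rho>_def by (intro smooth_real_sum smooth_real_mult smooth_real_const bumpD) simp

lemma \<psi>_deriv: "(\<psi> w has_real_derivative \<rho> w t) (at t)"
  unfolding \<psi>_def[abs_def] \<rho>_def by (intro DERIV_sum DERIV_cmult bumpD(4)) simp

lemma \<rho>_nonneg: "adm w \<Longrightarrow> 0 \<le> \<rho> w t"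
  unfolding \<rho>_def adm_def by (intro sum_nonneg mult_nonneg_nonneg less_imp_le[OF bumpD(2)]) auto

lemma \<rho>_periodic: "\<rho> w (t + pi) = \<rho> w t"
  unfolding \<rho>_def using bumpD(3) by simp

lemma \<psi>_quasi_periodic: "\<psi> w (t + pi) = \<psi> w t + (\<Sum>k<8. w k)"
  unfolding \<psi>_def using bumpD(6) by (simp add: distrib_left sum.distrib)

lemma \<psi>_init: "\<psi> w t0 = 0"
  unfolding \<psi>_def using bumpD(5) by simp

lemma cont_F: "continuous_on A F" and cont_\<beta>: "k < 8 \<Longrightarrow> continuous_on A (\<beta> k)"
  and cont_\<rho>: "continuous_on A (\<rho> w)"
  using smooth_F bumpD(1) smooth_\<rho> by (auto intro: smooth_real_continuous)

lemma cont_\<psi>: "continuous_on A (\<psi> w)"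
  by (rule DERIV_continuous_on[of A _ "\<rho> w"]) (rule has_field_derivative_at_within[OF \<psi>_deriv])

lemma cont_P: "continuous_on A (P w)"
  unfolding P_def by (intro continuous_intros cont_F cont_\<rho>) simp

lemma cont_b: "continuous_on A (b w)"
  unfolding b_def by (intro continuous_intros cont_F cont_\<rho>) auto

lemma cont_rhs: "continuous_on A z \<Longrightarrow> continuous_on A (\<lambda>t. rhs w t (z t))"
  unfolding rhs_def by (intro continuous_intros cont_P cont_\<psi>)

lemma b_nonneg: "adm w \<Longrightarrow> 0 \<le> b w t"
  using \<rho>_nonneg by (simp add: b_def)

lemma norm_rhs: "adm w \<Longrightarrow> norm (rhs w t z) \<le> b w t * norm z"
  unfolding rhs_def
  by (rule order.trans[OF norm_triangle_ineq])
     (use \<rho>_nonneg[of w t] in \<open>simp add: norm_mult P_def b_def abs_mult\<close>)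

lemma rhs_diff: "rhs w t (x - y) = rhs w t x - rhs w t y"
  by (simp add: rhs_def algebra_simps)

lemma sol: "sol w v t0 = v" "(sol w v has_vector_derivative rhs w t (sol w v t)) (at t)"
proof -
  have "continuous_on UNIV (\<lambda>t. P w t * cis (2 * \<psi> w t))"
    by (intro continuous_intros cont_P cont_\<psi>)
  from plane_ode_exists[OF cont_P this, of t0 v]
  have "\<exists>z. z t0 = v \<and> (\<forall>t. (z has_vector_derivative rhs w t (z t)) (at t))"
    by (simp add: rhs_def)
  from someI_ex[OF this] show "sol w v t0 = v" "(sol w v has_vector_derivative rhs w t (sol w v t)) (at t)"
    unfolding sol_def by blast+
qed

lemma cont_sol: "continuous_on A (sol w v)"
  by (rule continuous_at_imp_continuous_on) (blast intro: has_vector_derivative_continuous[OF sol(2)])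

text \<open>Apply \<open>small_system_bound\<close> to the deviation from \<open>v\<close>; since
  \<open>v\<close> has norm 1, it enters as an inhomogeneity of size \<open>b w\<close>.\<close>

lemma sol_close:
  assumes w: "adm w" and small: "integral I (b w) \<le> 1 / 2" and v: "norm v = 1" and t: "t \<in> I"
  shows "norm (sol w v t - v) \<le> 2 * integral I (b w)"
  unfolding I_def
proof (rule small_system_bound)
  show "((\<lambda>t. sol w v t - v) has_vector_derivative rhs w \<tau> (sol w v \<tau>)) (at \<tau>)" for \<tau>
    using has_vector_derivative_diff[OF sol(2)[of w v \<tau>] has_vector_derivative_const[of v]] by simp
  show "norm (rhs w \<tau> (sol w v \<tau>)) \<le> b w \<tau> * norm (sol w v \<tau> - v) + b w \<tau>" for \<tau>
  proof -
    have "norm (sol w v \<tau>) \<le> norm (sol w v \<tau> - v) + 1"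
      using norm_triangle_sub[of "sol w v \<tau>" v] v by simp
    from mult_left_mono[OF this b_nonneg[OF w, of \<tau>]] show ?thesis
      using norm_rhs[OF w, of \<tau> "sol w v \<tau>"] by (simp add: algebra_simps)
  qed
qed (use small t b_nonneg[OF w] cont_b sol(1) in \<open>auto simp: I_def\<close>)

text \<open>Freezing the solution at its initial value leaves, by linearity, the integral of
  \<open>rhs\<close> applied to the deviation from \<open>v\<close>. By \<open>sol_close\<close> the
  deviation is itself of the size of the mass, so the error is quadratic.\<close>

lemma sol_first_order:
  assumes w: "adm w" and small: "integral I (b w) \<le> 1 / 2" and v: "norm v = 1"
  shows "norm (sol w v (t0 + pi) - v - integral I (\<lambda>t. rhs w t v)) \<le> 2 * (integral I (b w))\<^sup>2"
proof -
  define B where "B = integral I (b w)"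
  have i: "((\<lambda>t. rhs w t (sol w v t)) has_integral (sol w v (t0 + pi) - sol w v t0)) I"
    unfolding I_def
  proof (rule fundamental_theorem_of_calculus)
    show "(sol w v has_vector_derivative rhs w t (sol w v t)) (at t within {t0..t0 + pi})" for t
      by (rule has_vector_derivative_at_within[OF sol(2)])
  qed simp
  have j: "(\<lambda>t. rhs w t v) integrable_on I"
    unfolding I_def by (intro integrable_continuous_real cont_rhs continuous_on_const)
  have bi: "b w integrable_on I"
    unfolding I_def by (intro integrable_continuous_real cont_b)
  have k: "(\<lambda>t. rhs w t (sol w v t - v)) integrable_on I"
    unfolding I_def
    by (intro integrable_continuous_real cont_rhs continuous_on_diff cont_sol continuous_on_const)
  have eq: "sol w v (t0 + pi) - v - integral I (\<lambda>t. rhs w t v) = integral I (\<lambda>t. rhs w t (sol w v t - v))"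
    using has_integral_diff[OF i integrable_integral[OF j]] sol(1)[of w v]
    unfolding rhs_diff[symmetric] by (simp add: integral_unique)
  have "norm (integral I (\<lambda>t. rhs w t (sol w v t - v))) \<le> integral I (\<lambda>t. b w t * (2 * B))"
  proof (rule integral_norm_bound_integral[OF k])
    show "norm (rhs w t (sol w v t - v)) \<le> b w t * (2 * B)" if "t \<in> I" for t
      using norm_rhs[OF w, of t "sol w v t - v"]
        mult_left_mono[OF sol_close[OF w small v that] b_nonneg[OF w, of t]] by (simp add: B_def)
  qed (rule integrable_on_mult_left[OF bi])
  also have "\<dots> = 2 * B\<^sup>2"
    by (simp add: B_def power2_eq_square)
  finally show ?thesis unfolding eq by (simp add: B_def)
qed

text \<open>This supplies the continuity that Brouwer's theorem needs. The difference of two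
  solutions solves the system for \<open>w\<close> with an inhomogeneity, namely the difference of
  the two right-hand sides along the second solution.\<close>

lemma sol_lipschitz:
  "\<exists>C. \<forall>w w' v. adm w \<longrightarrow> adm w' \<longrightarrow> integral I (b w) \<le> 1 / 2 \<longrightarrow> integral I (b w') \<le> 1 / 2 \<longrightarrow>
     norm v = 1 \<longrightarrow> norm (sol w v (t0 + pi) - sol w' v (t0 + pi)) \<le> C * (\<Sum>k<8. \<bar>w k - w' k\<bar>)"
proof -
  have "compact I" by (simp add: I_def)
  have "continuous_on I (\<lambda>t. \<Sum>k<8. \<beta> k t)"
    by (intro continuous_on_sum cont_\<beta>) simp
  from compact_imp_bounded[OF compact_continuous_image[OF this \<open>compact I\<close>]]
  obtain B where B: "\<And>t. t \<in> I \<Longrightarrow> \<bar>\<Sum>k<8. \<beta> k t\<bar> \<le> B"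
    unfolding bounded_iff by auto
  have \<beta>B: "\<beta> k t \<le> B" if "t \<in> I" "k < 8" for k t
    using member_le_sum[of k "{..<8}" "\<lambda>k. \<beta> k t"] bumpD(2) B[OF that(1)] that(2)
    by (auto simp: less_imp_le)
  have B0: "B \<ge> 0"
    using B[of t0] by (auto simp: I_def intro: order.trans[OF abs_ge_zero])
  show ?thesis
  proof (intro exI[of _ "18 * pi * M * B"] allI impI)
    fix w w' v
    assume w: "adm w" and w': "adm w'" and s: "integral I (b w) \<le> 1 / 2" "integral I (b w') \<le> 1 / 2"
      and v: "norm (v :: complex) = 1"
    define D where "D = (\<Sum>k<8. \<bar>w k - w' k\<bar>)"
    have D0: "D \<ge> 0" by (simp add: D_def sum_nonneg)
    \<comment> \<open>For vectors of norm at most 2 the change of \<open>P\<close> contributes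
      \<open>M * B * D\<close> and the change of the phase \<open>8 * M * B * D\<close>.\<close>
    define r where "r = 9 * M * B * D"
    have d\<rho>: "\<bar>\<rho> w t - \<rho> w' t\<bar> \<le> B * D" if "t \<in> I" for t
    proof -
      have "\<bar>\<rho> w t - \<rho> w' t\<bar> = \<bar>\<Sum>k<8. (w k - w' k) * \<beta> k t\<bar>"
        by (simp add: \<rho>_def sum_subtractf algebra_simps)
      also have "\<dots> \<le> (\<Sum>k<8. \<bar>w k - w' k\<bar> * B)"
        using \<beta>B[OF that] bumpD(2)
        by (intro order.trans[OF sum_abs] sum_mono) (auto simp: abs_mult less_imp_le intro!: mult_left_mono)
      finally show ?thesis by (simp add: D_def sum_distrib_left mult.commute)
    qed
    have d\<psi>: "\<bar>\<psi> w t - \<psi> w' t\<bar> \<le> D" if "t \<in> I" for t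
    proof -
      have "\<bar>\<psi> w t - \<psi> w' t\<bar> = \<bar>\<Sum>k<8. (w k - w' k) * \<Phi> k t\<bar>"
        by (simp add: \<psi>_def sum_subtractf algebra_simps)
      also have "\<dots> \<le> (\<Sum>k<8. \<bar>w k - w' k\<bar> * 1)"
        using \<Phi>_range[OF _ that]
        by (intro order.trans[OF sum_abs] sum_mono) (auto simp: abs_mult mult_left_le)
      finally show ?thesis by (simp add: D_def)
    qed
    have \<rho>B: "\<rho> w' t \<le> 8 * B" if "t \<in> I" for t
    proof -
      have "\<rho> w' t \<le> (\<Sum>k<8::nat. 1 * B)"
        unfolding \<rho>_def using \<beta>B[OF that] w' bumpD(2) B0
        by (intro sum_mono mult_mono) (auto simp: adm_def less_imp_le)
      then show ?thesis by simp
    qed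
    have dP: "norm (P w t - P w' t) \<le> M * B * D / 4" if t: "t \<in> I" for t
    proof -
      have "P w t - P w' t = - \<i> * of_real ((\<rho> w t - \<rho> w' t) * F t / 4)"
        by (simp add: P_def algebra_simps diff_divide_distrib)
      then have "norm (P w t - P w' t) = \<bar>\<rho> w t - \<rho> w' t\<bar> * \<bar>F t\<bar> / 4"
        by (simp only: norm_mult norm_of_real norm_minus_cancel norm_ii) (simp add: abs_mult)
      also have "\<dots> \<le> (B * D) * M / 4"
        using d\<rho>[OF t] F_bound[OF t] B0 D0 by (intro divide_right_mono mult_mono) auto
      finally show ?thesis by (simp add: algebra_simps)
    qed
    have P': "norm (P w' t) \<le> 2 * M * B" if t: "t \<in> I" for t
    proof -
      have "norm (P w' t) = \<rho> w' t * \<bar>F t\<bar> / 4"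
        using \<rho>_nonneg[OF w', of t] by (simp add: P_def norm_mult abs_mult)
      also have "\<dots> \<le> (8 * B) * M / 4"
        using \<rho>B[OF t] F_bound[OF t] B0 by (intro divide_right_mono mult_mono) auto
      finally show ?thesis by (simp add: algebra_simps)
    qed
    have drhs: "norm (rhs w t z - rhs w' t z) \<le> r" if t: "t \<in> I" and z: "norm z \<le> 2" for t z
    proof -
      have eq: "rhs w t z - rhs w' t z = (P w t - P w' t) * (z + cis (2 * \<psi> w t) * cnj z)
          + P w' t * ((cis (2 * \<psi> w t) - cis (2 * \<psi> w' t)) * cnj z)"
        by (simp add: rhs_def algebra_simps)
      have "norm (rhs w t z - rhs w' t z) \<le> (M * B * D / 4) * (2 + 1 * 2) + (2 * M * B) * ((2 * D) * 2)"
        unfolding eq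
      proof (rule norm_triangle_le, rule add_mono)
        have "norm (z + cis (2 * \<psi> w t) * cnj z) \<le> 2 + 1 * 2"
          by (rule norm_triangle_le) (use z in \<open>simp add: norm_mult\<close>)
        then show "norm ((P w t - P w' t) * (z + cis (2 * \<psi> w t) * cnj z)) \<le> (M * B * D / 4) * (2 + 1 * 2)"
          unfolding norm_mult[of "P w t - P w' t"] using dP[OF t] M B0 D0 by (intro mult_mono) auto
        have "norm (cis (2 * \<psi> w t) - cis (2 * \<psi> w' t)) \<le> 2 * D"
          using norm_cis_diff_le[of "2 * \<psi> w t" "2 * \<psi> w' t"] d\<psi>[OF t] by linarith
        then show "norm (P w' t * ((cis (2 * \<psi> w t) - cis (2 * \<psi> w' t)) * cnj z)) \<le> (2 * M * B) * ((2 * D) * 2)"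
          unfolding norm_mult using P'[OF t] z M B0 D0 by (intro mult_mono) auto
      qed
      also have "\<dots> = r" by (simp add: r_def)
      finally show ?thesis .
    qed
    have r0: "r \<ge> 0" using M B0 D0 by (simp add: r_def)
    have "norm (sol w v (t0 + pi) - sol w' v (t0 + pi)) \<le> 2 * integral {t0..t0 + pi} (\<lambda>_. r)"
    proof (rule small_system_bound[where b = "b w"])
      show "((\<lambda>t. sol w v t - sol w' v t) has_vector_derivative
          rhs w \<tau> (sol w v \<tau>) - rhs w' \<tau> (sol w' v \<tau>)) (at \<tau>)" for \<tau>
        by (rule has_vector_derivative_diff[OF sol(2) sol(2)])
      fix \<tau> assume "\<tau> \<in> {t0..t0 + pi}"
      then have \<tau>: "\<tau> \<in> I" by (simp add: I_def)
      have "norm (sol w' v \<tau>) \<le> 2"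
        using sol_close[OF w' s(2) v \<tau>] s(2) v norm_triangle_sub[of "sol w' v \<tau>" v] by simp
      then have "norm (rhs w \<tau> (sol w' v \<tau>) - rhs w' \<tau> (sol w' v \<tau>)) \<le> r"
        by (rule drhs[OF \<tau>])
      moreover have eq: "rhs w \<tau> (sol w v \<tau>) - rhs w' \<tau> (sol w' v \<tau>)
          = rhs w \<tau> (sol w v \<tau> - sol w' v \<tau>) + (rhs w \<tau> (sol w' v \<tau>) - rhs w' \<tau> (sol w' v \<tau>))"
        by (simp add: rhs_diff)
      ultimately show "norm (rhs w \<tau> (sol w v \<tau>) - rhs w' \<tau> (sol w' v \<tau>))
          \<le> b w \<tau> * norm (sol w v \<tau> - sol w' v \<tau>) + r"
        using norm_rhs[OF w, of \<tau> "sol w v \<tau> - sol w' v \<tau>"] unfolding eq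
        by (intro norm_triangle_le) linarith
    qed (use s(1) r0 b_nonneg[OF w] cont_b sol(1) in \<open>auto simp: I_def\<close>)
    then show "norm (sol w v (t0 + pi) - sol w' v (t0 + pi)) \<le> 18 * pi * M * B * (\<Sum>k<8. \<bar>w k - w' k\<bar>)"
      unfolding D_def[symmetric] by (simp add: r_def mult_ac)
  qed
qed

section \<open>The total size of the system\<close>

lemma integral_weighted:
  fixes H :: "real \<Rightarrow> 'a::{real_normed_field, banach}"
  assumes "continuous_on I H"
  shows "integral I (\<lambda>t. of_real (\<rho> w t) * H t)
    = (\<Sum>k<8. of_real (w k) * integral I (\<lambda>t. of_real (\<beta> k t) * H t))"
proof -
  have "((\<lambda>t. \<Sum>k<8. of_real (w k) * (of_real (\<beta> k t) * H t)) has_integral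
      (\<Sum>k<8. of_real (w k) * integral I (\<lambda>t. of_real (\<beta> k t) * H t))) I"
  proof (intro has_integral_sum has_integral_mult_right integrable_integral)
    show "(\<lambda>t. of_real (\<beta> k t) * H t) integrable_on I" if "k \<in> {..<8}" for k
      using assms that unfolding I_def
      by (intro integrable_continuous_real continuous_on_mult continuous_on_of_real cont_\<beta>) auto
  qed simp
  moreover have "(\<lambda>t. \<Sum>k<8. of_real (w k) * (of_real (\<beta> k t) * H t)) = (\<lambda>t. of_real (\<rho> w t) * H t)"
    by (simp add: \<rho>_def sum_distrib_right mult.assoc)
  ultimately show ?thesis by (simp add: integral_unique)
qed

lemma \<epsilon>_small: "\<epsilon> \<le> 1 / 3000" "\<epsilon>\<^sup>2 \<le> \<epsilon>" "\<eta> \<le> \<epsilon>" "3000 * (M * \<epsilon>) \<le> 1" "3000 * (M\<^sup>2 * \<epsilon>) \<le> 1"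
proof -
  have "3000 * (M ^ j * \<epsilon>) \<le> 1" if "j \<le> 4" for j
  proof -
    have "M ^ j * \<epsilon> \<le> M ^ 4 * \<epsilon>"
      using that M \<epsilon>(1) by (intro mult_right_mono power_increasing) auto
    then show ?thesis using \<epsilon>(2) by linarith
  qed
  from this[of 0] this[of 1] this[of 2]
  show 1: "\<epsilon> \<le> 1 / 3000" and "3000 * (M * \<epsilon>) \<le> 1" "3000 * (M\<^sup>2 * \<epsilon>) \<le> 1" by auto
  show 2: "\<epsilon>\<^sup>2 \<le> \<epsilon>"
    using mult_right_mono[of \<epsilon> 1 \<epsilon>] 1 \<epsilon>(1) by (simp add: power2_eq_square)
  show "\<eta> \<le> \<epsilon>" using 2 \<eta>(2) by linarith
qed

text \<open>Even pulses are small by their weights. Odd pulses are small because \<open>f\<close>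
  vanishes at their centres: only \<open>\<epsilon>\<^sup>2\<close> from the window and
  \<open>M * \<eta>\<close> from the tails remain. Each of the eight contributes at most
  \<open>2 * M\<^sup>2 * \<epsilon>\<close>.\<close>

lemma mass_bound:
  assumes w: "adm w" and even: "\<And>k. k < 8 \<Longrightarrow> even k \<Longrightarrow> w k \<le> 3 / 2 * M * \<epsilon>"
  shows "integral I (b w) \<le> 16 * M\<^sup>2 * \<epsilon>"
proof -
  define J where "J k = integral I (\<lambda>t. \<beta> k t * (\<bar>F t\<bar> / 2))" for k
  have cont: "continuous_on A (\<lambda>t. \<bar>F t\<bar> / 2)" for A
    by (intro continuous_intros cont_F) auto
  have "integral I (b w) = (\<Sum>k<8. w k * J k)"
    using integral_weighted[OF cont, of w] by (simp add: b_def[abs_def] J_def)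
  also have "\<dots> \<le> (\<Sum>k<8::nat. M\<^sup>2 * \<epsilon> * 2)"
  proof (rule sum_mono)
    fix k :: nat assume "k \<in> {..<8}"
    then have k: "k < 8" by simp
    have wk: "0 \<le> w k" "w k \<le> 1" using w k by (auto simp: adm_def)
    show "w k * J k \<le> M\<^sup>2 * \<epsilon> * 2"
    proof (cases "even k")
      case True
      have "norm (J k) \<le> M / 2 * (\<Phi> k (t0 + pi) - \<Phi> k t0)"
        using weighted_integral_bound[where a = t0 and b = "t0 + pi" and \<Phi> = "\<Phi> k" and \<beta> = "\<beta> k"
            and H = "\<lambda>t. \<bar>F t\<bar> / 2" and D = "M / 2"] bumpD(2,4)[OF k] cont cont_\<beta>[OF k] F_bound
        by (simp add: J_def I_def less_imp_le)
      then have "J k \<le> M / 2"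
        using bumpD(5)[OF k] bumpD(6)[OF k, of t0] by simp
      then have "w k * J k \<le> (3 / 2 * M * \<epsilon>) * (M / 2)"
        using even[OF k True] wk M \<epsilon>(1)
        by (intro order.trans[OF mult_left_mono[of "J k" "M / 2" "w k"] mult_right_mono]) auto
      also have "\<dots> = 3 / 4 * (M\<^sup>2 * \<epsilon>)" by (simp add: power2_eq_square)
      also have "\<dots> \<le> M\<^sup>2 * \<epsilon> * 2" using M \<epsilon>(1) by simp
      finally show ?thesis .
    next
      case False
      have "norm (integral {t0..t0 + pi} (\<lambda>t. of_real (\<beta> k t) * (\<bar>F t\<bar> / 2)) - 0) \<le> \<epsilon>\<^sup>2 / 2 + 2 * (M / 2) * \<eta>"
      proof (rule bump_integral[OF bump[OF k] \<eta>(1) inside(1)[OF k] inside(2)[OF k] cont])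
        show "norm (\<bar>F t\<bar> / 2 - 0) \<le> \<epsilon>\<^sup>2 / 2" if "p k - \<eta> \<le> t" "t \<le> p k + \<eta>" for t
          using near[OF k, of t] zero[OF k False] that by (simp add: F_def abs_le_iff)
        show "norm (\<bar>F t\<bar> / 2 - 0) \<le> M / 2" if "t0 \<le> t" "t \<le> t0 + pi" for t
          using F_bound[of t] that by (simp add: I_def)
      qed
      then have "J k \<le> \<epsilon>\<^sup>2 / 2 + M * \<eta>" by (simp add: J_def I_def)
      also have "\<dots> \<le> M * \<epsilon>\<^sup>2 * 2"
      proof -
        have "M * \<eta> \<le> M * \<epsilon>\<^sup>2" "\<epsilon>\<^sup>2 \<le> M * \<epsilon>\<^sup>2"
          using \<eta>(2) M mult_right_mono[OF M, of "\<epsilon>\<^sup>2"] by auto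
        then show ?thesis using zero_le_power2[of \<epsilon>] by linarith
      qed
      also have "\<dots> \<le> M\<^sup>2 * \<epsilon> * 2"
        using M \<epsilon>_small(2) by (intro mult_right_mono mult_mono) (auto simp: power2_eq_square)
      finally have "J k \<le> M\<^sup>2 * \<epsilon> * 2" .
      then have "w k * J k \<le> 1 * (M\<^sup>2 * \<epsilon> * 2)"
        using wk M \<epsilon>(1) by (intro order.trans[OF mult_left_mono mult_right_mono]) auto
      then show ?thesis by simp
    qed
  qed
  finally show ?thesis by simp
qed

text \<open>The first order effect on the solution starting at v of a unit pulse at the angle \<open>i * pi / 4\<close>.\<close>

definition kick :: "complex \<Rightarrow> nat \<Rightarrow> complex" where
  "kick v i = - (\<i> / 2) * (v + \<i> ^ i * cnj v)"

definition total :: "(nat \<Rightarrow> real) \<Rightarrow> real" where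
  "total u = (\<Sum>i<4. \<epsilon> * u i / \<bar>F (p (2 * i))\<bar>)"

text \<open>Dividing by \<open>\<bar>F (p k)\<bar>\<close> makes \<open>\<epsilon> * u i\<close> the strength of the i-th pulse; the odd weights complete
  the total mass to pi.\<close>

definition wt :: "(nat \<Rightarrow> real) \<Rightarrow> nat \<Rightarrow> real" where
  "wt u k = (if even k then \<epsilon> * u (k div 2) / \<bar>F (p k)\<bar> else (pi - total u) / 4)"

text \<open>The strengths within distance 1/2 of the balanced value 1. They keep all eight weights
  positive, which makes the angle increasing, and the Brouwer box maps into them.\<close>

definition good :: "(nat \<Rightarrow> real) \<Rightarrow> bool" where
  "good u \<longleftrightarrow> (\<forall>i<4. 1 / 2 \<le> u i \<and> u i \<le> 3 / 2)"

section \<open>The pulse weights and the angles at which the pulses act\<close>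

lemma wt_even:
  assumes u: "good u" and k: "k < 8" "even k"
  shows "0 < wt u k" "wt u k \<le> 3 / 2 * M * \<epsilon>"
proof -
  have u': "1 / 2 \<le> u (k div 2)" "u (k div 2) \<le> 3 / 2" using u k by (auto simp: good_def)
  have F: "1 \<le> M * \<bar>F (p k)\<bar>" using nonzero[OF k] by (simp add: F_def)
  then have F0: "\<bar>F (p k)\<bar> > 0" by (cases "F (p k) = 0") auto
  show "0 < wt u k"
    unfolding wt_def using k(2) F0 u' \<epsilon>(1) by simp
  have "u (k div 2) * 1 \<le> 3 / 2 * (M * \<bar>F (p k)\<bar>)"
    using u' F by (intro mult_mono) auto
  then have "\<epsilon> * (u (k div 2) * 1) \<le> \<epsilon> * (3 / 2 * (M * \<bar>F (p k)\<bar>))"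
    using \<epsilon>(1) by (intro mult_left_mono) auto
  then show "wt u k \<le> 3 / 2 * M * \<epsilon>"
    unfolding wt_def using k(2) F0 by (simp add: pos_divide_le_eq mult_ac)
qed

lemma total_eq: "total u = wt u 0 + wt u 2 + wt u 4 + wt u 6"
  unfolding total_def sum_lessThan_4_expand by (simp add: wt_def)

lemma total_bound:
  assumes "good u"
  shows "0 \<le> total u" "total u \<le> 6 * (M * \<epsilon>)"
  using wt_even[OF assms, of 0] wt_even[OF assms, of 2] wt_even[OF assms, of 4] wt_even[OF assms, of 6]
  unfolding total_eq by auto

lemma wt_odd:
  assumes u: "good u" and k: "odd k"
  shows "wt u k = (pi - total u) / 4" "0 < wt u k" "wt u k \<le> 1"
  using total_bound[OF u] \<epsilon>_small(4) k pi_gt3 pi_less_4 by (auto simp: wt_def)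

lemma wt_pos: "good u \<Longrightarrow> k < 8 \<Longrightarrow> 0 < wt u k"
  using wt_even wt_odd by (cases "even k") auto

lemma adm_wt: "good u \<Longrightarrow> adm (wt u)"
  unfolding adm_def
proof (intro allI impI conjI)
  fix k :: nat assume u: "good u" and k: "k < 8"
  show "0 \<le> wt u k" using wt_pos[OF u k] by simp
  show "wt u k \<le> 1"
    using wt_even(2)[OF u k] wt_odd(3)[OF u, of k] \<epsilon>_small(4) by (cases "even k") auto
qed

lemma sum_wt: "good u \<Longrightarrow> (\<Sum>k<8. wt u k) = pi"
  using wt_odd(1)[of u 1] wt_odd(1)[of u 3] wt_odd(1)[of u 5] wt_odd(1)[of u 7]
  unfolding sum_lessThan_8_expand by (simp add: total_eq)

text \<open>In the window of \<open>p j\<close> the earlier bumps have spent almost all their mass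
  and the later ones almost none. How much of bump \<open>j\<close> itself is spent is unknown,
  hence the extra 1.\<close>

lemma \<Phi>_near:
  assumes j: "j < 8" "k < 8" and t: "\<bar>t - p j\<bar> \<le> \<eta>"
  shows "\<bar>\<Phi> k t - (if k < j then 1 else 0)\<bar> \<le> \<eta> + (if k = j then 1 else 0)"
proof -
  have tI: "t \<in> I" using t inside[OF j(1)] by (auto simp: I_def abs_le_iff)
  have r: "0 \<le> \<Phi> k t" "\<Phi> k t \<le> 1" using \<Phi>_range[OF j(2) tI] by auto
  consider "k < j" | "k = j" | "j < k" by linarith
  then show ?thesis
  proof cases
    case 1
    have "\<Phi> k (p k + \<eta>) \<le> \<Phi> k t"
      using sep[OF 1 j(1)] t by (intro \<Phi>_mono j) (auto simp: abs_le_iff)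
    with 1 r bumpD(8)[OF j(2)] show ?thesis by simp
  next
    case 2
    with r \<eta>(1) show ?thesis by simp
  next
    case 3
    have "\<Phi> k t \<le> \<Phi> k (p k - \<eta>)"
      using sep[OF 3 j(2)] t by (intro \<Phi>_mono j) (auto simp: abs_le_iff)
    with 3 r bumpD(7)[OF j(2)] show ?thesis by simp
  qed
qed

text \<open>Before pulse \<open>i\<close> there are \<open>i\<close> rests of about pi / 4. The
  error collects the tails (4), the pulse's own unspent or spent mass (3/2) and the even weights
  (6), in units of \<open>M * \<epsilon>\<close>.\<close>

lemma phase:
  assumes u: "good u" and i: "i < 4" and t: "\<bar>t - p (2 * i)\<bar> \<le> \<eta>"
  shows "\<bar>\<psi> (wt u) t - of_nat i * (pi / 4)\<bar> \<le> 12 * (M * \<epsilon>)"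
proof -
  define c :: "nat \<Rightarrow> real" where "c k = (if k < 2 * i then 1 else 0)" for k
  have "\<bar>\<psi> (wt u) t - (\<Sum>k<8. wt u k * c k)\<bar> = \<bar>\<Sum>k<8. wt u k * (\<Phi> k t - c k)\<bar>"
    by (simp add: \<psi>_def sum_subtractf algebra_simps)
  also have "\<dots> \<le> (\<Sum>k<8. wt u k * \<eta> + (if k = 2 * i then wt u k else 0))"
  proof (intro order.trans[OF sum_abs] sum_mono)
    fix k :: nat assume "k \<in> {..<8}"
    then have k: "k < 8" by simp
    have "2 * i < 8" using i by simp
    from mult_left_mono[OF \<Phi>_near[OF this k t] less_imp_le[OF wt_pos[OF u k]]]
    show "\<bar>wt u k * (\<Phi> k t - c k)\<bar> \<le> wt u k * \<eta> + (if k = 2 * i then wt u k else 0)"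
      unfolding abs_mult c_def using wt_pos[OF u k] by (auto simp: distrib_left split: if_splits)
  qed
  also have "\<dots> = pi * \<eta> + wt u (2 * i)"
    using i by (simp add: sum.distrib sum_distrib_right[symmetric] sum_wt[OF u])
  also have "\<dots> \<le> 4 * (M * \<epsilon>) + 3 / 2 * (M * \<epsilon>)"
  proof (rule add_mono)
    have "pi * \<eta> \<le> 4 * \<epsilon>"
      using pi_less_4 \<epsilon>_small(3) \<eta>(1) by (intro mult_mono) auto
    also have "4 * \<epsilon> \<le> 4 * (M * \<epsilon>)"
      using M \<epsilon>(1) by simp
    finally show "pi * \<eta> \<le> 4 * (M * \<epsilon>)" .
    show "wt u (2 * i) \<le> 3 / 2 * (M * \<epsilon>)" using wt_even(2)[OF u, of "2 * i"] i by simp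
  qed
  finally have 1: "\<bar>\<psi> (wt u) t - (\<Sum>k<8. wt u k * c k)\<bar> \<le> 11 / 2 * (M * \<epsilon>)" by simp
  \<comment> \<open>The rests fall short of \<open>i * pi / 4\<close> by
    \<open>i * total u / 4\<close> with i at most 3, while the even weights already passed add at
    most \<open>total u\<close>; these errors have opposite signs.\<close>
  have "\<bar>(\<Sum>k<8. wt u k * c k) - of_nat i * (pi / 4)\<bar> \<le> total u"
  proof -
    have o: "wt u 1 = (pi - total u) / 4" "wt u 3 = (pi - total u) / 4" "wt u 5 = (pi - total u) / 4"
      by (simp_all add: wt_odd(1)[OF u])
    have e: "0 < wt u 0" "0 < wt u 2" "0 < wt u 4" "0 < wt u 6"
      by (simp_all add: wt_pos[OF u])
    consider "i = 0" | "i = 1" | "i = 2" | "i = 3" using i by linarith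
    then show ?thesis
      unfolding sum_lessThan_8_expand c_def
      by cases (use o e total_eq[of u] in \<open>simp_all add: field_simps abs_le_iff\<close>)
  qed
  then show ?thesis using 1 total_bound(2)[OF u] by linarith
qed

section \<open>First order approximation of the monodromy\<close>

lemma norm_kick: "norm v = 1 \<Longrightarrow> norm (v + cis x * cnj v) \<le> 2"
  by (rule norm_triangle_le) (simp add: norm_mult)

text \<open>Even pulses have weight of order \<open>\<epsilon>\<close> and an integral known up to
  order \<open>\<epsilon>\<close>; odd ones have weight of order 1 but an integral of order
  \<open>\<epsilon>\<^sup>2\<close>. Either way a pulse costs at most
  \<open>14 * (M ^ 4 * \<epsilon>\<^sup>2)\<close>, and there are eight.\<close>

lemma first_order_term:
  assumes u: "good u" and v: "norm v = 1"
  shows "norm (integral I (\<lambda>t. rhs (wt u) t v)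
    - (\<Sum>i<4. of_real (\<epsilon> * u i * sgn (F (p (2 * i))) / 2) * kick v i)) \<le> 112 * (M ^ 4 * \<epsilon>\<^sup>2)"
proof -
  define H where "H t = - \<i> * of_real (F t / 4) * (v + cis (2 * \<psi> (wt u) t) * cnj v)" for t
  define h where "h k = (if even k then of_real (F (p k) / 2) * kick v (k div 2) else 0)" for k
  define J where "J k = integral I (\<lambda>t. of_real (\<beta> k t) * H t)" for k
  have contH: "continuous_on A H" for A
    unfolding H_def by (intro continuous_intros cont_F cont_\<psi>) simp
  have "integral I (\<lambda>t. rhs (wt u) t v) = (\<Sum>k<8. of_real (wt u k) * J k)"
    using integral_weighted[OF contH, of "wt u"]
    by (simp add: J_def H_def rhs_def P_def algebra_simps)
  moreover have "(\<Sum>i<4. of_real (\<epsilon> * u i * sgn (F (p (2 * i))) / 2) * kick v i)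
      = (\<Sum>k<8. of_real (wt u k) * h k)"
    unfolding sum_lessThan_8
    by (intro sum.cong refl) (simp add: h_def wt_def sgn_real_def)
  ultimately have eq: "integral I (\<lambda>t. rhs (wt u) t v)
      - (\<Sum>i<4. of_real (\<epsilon> * u i * sgn (F (p (2 * i))) / 2) * kick v i)
      = (\<Sum>k<8. of_real (wt u k) * (J k - h k))"
    by (simp add: sum_subtractf algebra_simps)
  have pI: "p k \<in> I" if "k < 8" for k
    using inside[OF that] \<eta>(1) by (auto simp: I_def)
  have H_le: "norm (H t) \<le> M / 2" if "t \<in> I" for t
  proof -
    have "norm (H t) = \<bar>F t\<bar> / 4 * norm (v + cis (2 * \<psi> (wt u) t) * cnj v)"
      by (simp add: H_def norm_mult)
    also have "\<dots> \<le> M / 4 * 2"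
      using F_bound[OF that] norm_kick[OF v] M by (intro mult_mono) auto
    finally show ?thesis by simp
  qed
  \<comment> \<open>The power of the imaginary unit in \<open>kick\<close> is the factor
    \<open>cis (2 * \<psi>)\<close> at the ideal angle of pulse \<open>i\<close>.\<close>
  have i_cis: "\<i> ^ i = cis (2 * (of_nat i * (pi / 4)))" for i
  proof -
    have "\<i> ^ i = cis (pi / 2) ^ i" by simp
    moreover have "of_nat i * (pi / 2) = 2 * (of_nat i * (pi / 4))" by simp
    ultimately show ?thesis by (simp only: Complex.DeMoivre)
  qed
  have h_le: "norm (h k) \<le> M / 2" if "k < 8" for k
  proof -
    have "norm (h k) \<le> \<bar>F (p k)\<bar> / 4 * norm (v + \<i> ^ (k div 2) * cnj v)"
      by (simp add: h_def kick_def norm_mult norm_divide)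
    also have "\<dots> \<le> M / 4 * 2"
      unfolding i_cis using F_bound[OF pI[OF that]] norm_kick[OF v] M by (intro mult_mono) auto
    finally show ?thesis by simp
  qed
  have far: "norm (H t - h k) \<le> M" if "k < 8" "t0 \<le> t" "t \<le> t0 + pi" for k t
    using norm_triangle_ineq4[of "H t" "h k"] H_le[of t] h_le[of k] that by (simp add: I_def)
  have M2: "1 \<le> M\<^sup>2" "M \<le> M\<^sup>2" using M by (simp_all add: power2_eq_square mult_mono[of 1 M 1 M, simplified])
  have \<epsilon>M: "\<epsilon> \<le> M\<^sup>2 * \<epsilon>" "M * \<epsilon> \<le> M\<^sup>2 * \<epsilon>"
    using mult_right_mono[OF M2(1), of \<epsilon>] mult_right_mono[OF M2(2), of \<epsilon>] \<epsilon>(1) by auto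
  have M4: "M ^ 3 \<le> M ^ 4" "M \<le> M ^ 4"
    using power_increasing[of 3 4 M] power_increasing[of 1 4 M] M by auto
  have "norm (of_real (wt u k) * (J k - h k)) \<le> 14 * (M ^ 4 * \<epsilon>\<^sup>2)" if k: "k < 8" for k
  proof (cases "even k")
    case True
    then obtain i where i: "k = 2 * i" by blast
    with k have i4: "i < 4" by simp
    have "norm (J k - h k) \<le> 7 * (M\<^sup>2 * \<epsilon>) + 2 * M * \<eta>"
      unfolding J_def I_def
    proof (rule bump_integral[OF bump[OF k] \<eta>(1) inside(1)[OF k] inside(2)[OF k] contH])
      fix t assume "p k - \<eta> \<le> t" "t \<le> p k + \<eta>"
      then have t: "\<bar>t - p k\<bar> \<le> \<eta>" by (simp add: abs_le_iff)
      define x where "x = 2 * \<psi> (wt u) t"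
      define y where "y = 2 * (of_nat i * (pi / 4))"
      \<comment> \<open>The error splits into the variation of \<open>f\<close> over the window and
        the deviation of the phase from its ideal value.\<close>
      have "H t - h k = - \<i> * of_real ((F t - F (p k)) / 4) * (v + cis x * cnj v)
          + (- \<i> * of_real (F (p k) / 4)) * ((cis x - cis y) * cnj v)"
        unfolding H_def h_def kick_def i_cis i x_def[symmetric]
        by (simp add: y_def field_simps)
      moreover have "norm (- \<i> * of_real ((F t - F (p k)) / 4) * (v + cis x * cnj v)) \<le> \<epsilon>\<^sup>2 / 4 * 2"
      proof -
        have "norm (- \<i> * of_real ((F t - F (p k)) / 4) * (v + cis x * cnj v))
            = \<bar>F t - F (p k)\<bar> / 4 * norm (v + cis x * cnj v)"
          by (simp only: norm_mult norm_minus_cancel norm_ii norm_of_real) simp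
        also have "\<dots> \<le> \<epsilon>\<^sup>2 / 4 * 2"
          using near[OF k t] norm_kick[OF v] by (intro mult_mono) (auto simp: F_def)
        finally show ?thesis .
      qed
      moreover have "norm ((- \<i> * of_real (F (p k) / 4)) * ((cis x - cis y) * cnj v)) \<le> M / 4 * (24 * (M * \<epsilon>))"
      proof -
        have "norm ((- \<i> * of_real (F (p k) / 4)) * ((cis x - cis y) * cnj v))
            = \<bar>F (p k)\<bar> / 4 * norm (cis x - cis y)"
          using v by (simp add: norm_mult)
        also have "\<dots> \<le> M / 4 * (24 * (M * \<epsilon>))"
        proof (rule mult_mono)
          show "norm (cis x - cis y) \<le> 24 * (M * \<epsilon>)"
            using norm_cis_diff_le[of x y] phase[OF u i4 t[unfolded i]] unfolding x_def y_def by linarith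
        qed (use F_bound[OF pI[OF k]] M in auto)
        finally show ?thesis .
      qed
      ultimately have "norm (H t - h k) \<le> \<epsilon>\<^sup>2 / 4 * 2 + M / 4 * (24 * (M * \<epsilon>))"
        by (metis norm_triangle_mono)
      also have "\<dots> = \<epsilon>\<^sup>2 / 2 + 6 * (M\<^sup>2 * \<epsilon>)" by (simp add: power2_eq_square)
      also have "\<dots> \<le> 7 * (M\<^sup>2 * \<epsilon>)" using \<epsilon>_small(2) \<epsilon>M(1) \<epsilon>(1) by linarith
      finally show "norm (H t - h k) \<le> 7 * (M\<^sup>2 * \<epsilon>)" .
    qed (use far[OF k] in auto)
    also have "\<dots> \<le> 9 * (M\<^sup>2 * \<epsilon>)"
    proof -
      have "M * \<eta> \<le> M * \<epsilon>" using \<epsilon>_small(3) M by (intro mult_left_mono) auto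
      then show ?thesis using \<epsilon>M(2) by linarith
    qed
    finally have J: "norm (J k - h k) \<le> 9 * (M\<^sup>2 * \<epsilon>)" .
    have "norm (of_real (wt u k) * (J k - h k)) = wt u k * norm (J k - h k)"
      using wt_pos[OF u k] by (simp add: norm_mult)
    also have "\<dots> \<le> (3 / 2 * M * \<epsilon>) * (9 * (M\<^sup>2 * \<epsilon>))"
      using wt_even[OF u k True] J M \<epsilon>(1) by (intro mult_mono) auto
    also have "\<dots> = 27 / 2 * (M ^ 3 * \<epsilon>\<^sup>2)"
      by (simp add: power2_eq_square power3_eq_cube)
    also have "\<dots> \<le> 14 * (M ^ 4 * \<epsilon>\<^sup>2)"
      using M4(1) M by (intro mult_mono) auto
    finally show ?thesis .
  next
    case False
    have "norm (J k - h k) \<le> \<epsilon>\<^sup>2 / 2 + 2 * M * \<eta>"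
      unfolding J_def I_def
    proof (rule bump_integral[OF bump[OF k] \<eta>(1) inside(1)[OF k] inside(2)[OF k] contH])
      fix t assume "p k - \<eta> \<le> t" "t \<le> p k + \<eta>"
      then have t: "\<bar>F t\<bar> \<le> \<epsilon>\<^sup>2"
        using near[OF k, of t] zero[OF k False] by (simp add: F_def abs_le_iff)
      have "norm (H t - h k) = \<bar>F t\<bar> / 4 * norm (v + cis (2 * \<psi> (wt u) t) * cnj v)"
        using False by (simp add: H_def h_def norm_mult)
      also have "\<dots> \<le> \<epsilon>\<^sup>2 / 4 * 2"
        using t norm_kick[OF v] by (intro mult_mono) auto
      finally show "norm (H t - h k) \<le> \<epsilon>\<^sup>2 / 2" by simp
    qed (use far[OF k] in auto)
    also have "\<dots> \<le> 3 * (M ^ 4 * \<epsilon>\<^sup>2)"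
    proof -
      have "M * \<eta> \<le> M * \<epsilon>\<^sup>2" using \<eta>(2) M by (intro mult_left_mono) auto
      moreover have "M * \<epsilon>\<^sup>2 \<le> M ^ 4 * \<epsilon>\<^sup>2" using M4(2) by (intro mult_right_mono) auto
      moreover have "\<epsilon>\<^sup>2 \<le> M * \<epsilon>\<^sup>2" using mult_right_mono[OF M, of "\<epsilon>\<^sup>2"] by simp
      ultimately show ?thesis using zero_le_power2[of \<epsilon>] by linarith
    qed
    finally have J: "norm (J k - h k) \<le> 3 * (M ^ 4 * \<epsilon>\<^sup>2)" .
    have "norm (of_real (wt u k) * (J k - h k)) = wt u k * norm (J k - h k)"
      using wt_pos[OF u k] by (simp add: norm_mult)
    also have "\<dots> \<le> 1 * (3 * (M ^ 4 * \<epsilon>\<^sup>2))"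
      using wt_odd[OF u False] J by (intro mult_mono) auto
    also have "\<dots> \<le> 14 * (M ^ 4 * \<epsilon>\<^sup>2)"
      using M by simp
    finally show ?thesis .
  qed
  then have "(\<Sum>k<8. norm (of_real (wt u k) * (J k - h k))) \<le> (\<Sum>k<8::nat. 14 * (M ^ 4 * \<epsilon>\<^sup>2))"
    by (intro sum_mono) auto
  then show ?thesis
    unfolding eq by (intro order.trans[OF norm_sum]) simp
qed

lemma mass_small:
  assumes "good u"
  shows "integral I (b (wt u)) \<le> 16 * (M\<^sup>2 * \<epsilon>)" "integral I (b (wt u)) \<le> 1 / 32"
    "0 \<le> integral I (b (wt u))"
proof -
  show 1: "integral I (b (wt u)) \<le> 16 * (M\<^sup>2 * \<epsilon>)"
    using mass_bound[OF adm_wt[OF assms] wt_even(2)[OF assms]] by simp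
  then show "integral I (b (wt u)) \<le> 1 / 32" using \<epsilon>_small(5) by linarith
  show "0 \<le> integral I (b (wt u))"
    using b_nonneg[OF adm_wt[OF assms]]
    by (intro integral_nonneg) (auto simp: I_def intro: integrable_continuous_real cont_b)
qed

lemma monodromy_estimate:
  assumes u: "good u" and v: "norm v = 1"
  shows "norm (sol (wt u) v (t0 + pi) - v
    - (\<Sum>i<4. of_real (\<epsilon> * u i * sgn (F (p (2 * i))) / 2) * kick v i)) \<le> \<epsilon> / 4"
proof -
  define X where "X = integral I (\<lambda>t. rhs (wt u) t v)"
  define Y where "Y = (\<Sum>i<4. of_real (\<epsilon> * u i * sgn (F (p (2 * i))) / 2) * kick v i)"
  define Z where "Z = sol (wt u) v (t0 + pi) - v"
  have "norm (Z - X) \<le> 2 * (integral I (b (wt u)))\<^sup>2"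
    unfolding Z_def X_def
    by (rule sol_first_order[OF adm_wt[OF u] _ v]) (use mass_small(2)[OF u] in simp)
  also have "\<dots> \<le> 2 * (16 * (M\<^sup>2 * \<epsilon>))\<^sup>2"
    using mass_small[OF u] by (intro mult_left_mono power_mono) auto
  also have "\<dots> = 512 * (M ^ 4 * \<epsilon>\<^sup>2)"
    by (simp add: power2_eq_square power4_eq_xxxx mult_ac)
  finally have 1: "norm (Z - X) \<le> 512 * (M ^ 4 * \<epsilon>\<^sup>2)" .
  have "norm (X - Y) \<le> 112 * (M ^ 4 * \<epsilon>\<^sup>2)"
    unfolding X_def Y_def by (rule first_order_term[OF u v])
  then have "norm (Z - Y) \<le> 624 * (M ^ 4 * \<epsilon>\<^sup>2)"
    using 1 norm_triangle_ineq[of "Z - X" "X - Y"] by simp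
  \<comment> \<open>The source of the constant 3000 in the locale: 4 * 624 = 2496 has to be
    dominated.\<close>
  also have "\<dots> \<le> \<epsilon> / 4"
    using mult_right_mono[OF \<epsilon>(2), of \<epsilon>] \<epsilon>(1) by (simp add: power2_eq_square mult_ac)
  finally show ?thesis by (simp add: Y_def Z_def)
qed

end

section \<open>Closing the monodromy\<close>

context pulses
begin

text \<open>The equal strengths (1, 1, 1, 1) satisfy the linearised closing conditions; the three
  perturbations enter one each into \<open>Re z1\<close>, \<open>Re z2\<close> and \<open>Im z1\<close>.\<close>

definition profile :: "real \<times> real \<times> real \<Rightarrow> nat \<Rightarrow> real" where
  "profile w i = (if i = 0 then 1 + snd (snd w) else if i = 1 then 1 + fst w
     else if i = 2 then 1 + fst (snd w) else 1 - fst w)"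

definition box :: "(real \<times> real \<times> real) set" where
  "box = {- 1 / 2..1 / 2} \<times> {- 1 / 2..1 / 2} \<times> {- 1 / 2..1 / 2}"

lemma good_profile: "w \<in> box \<Longrightarrow> good (profile w)"
  unfolding good_def profile_def box_def by auto

lemma continuous_profile: "continuous_on A (\<lambda>w. profile w i)"
proof -
  have "continuous_on A (\<lambda>w :: real \<times> real \<times> real. 1 + snd (snd w))"
    "continuous_on A (\<lambda>w :: real \<times> real \<times> real. 1 + fst w)"
    "continuous_on A (\<lambda>w :: real \<times> real \<times> real. 1 + fst (snd w))"
    "continuous_on A (\<lambda>w :: real \<times> real \<times> real. 1 - fst w)"
    by (intro continuous_intros)+
  then show ?thesis
    unfolding profile_def by (cases "i = 0"; cases "i = 1"; cases "i = 2") simp_all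
qed

lemma continuous_wt: "continuous_on A (\<lambda>w. wt (profile w) k)"
proof -
  have "continuous_on A (\<lambda>w. total (profile w))"
    unfolding total_def divide_inverse
    by (intro continuous_on_sum continuous_on_mult[OF continuous_on_mult] continuous_on_const
        continuous_profile)
  then have "continuous_on A (\<lambda>w. (pi - total (profile w)) / 4)"
    unfolding divide_inverse
    by (rule continuous_on_mult[OF continuous_on_diff[OF continuous_on_const] continuous_on_const])
  moreover have "continuous_on A (\<lambda>w. \<epsilon> * profile w (k div 2) / \<bar>F (p k)\<bar>)"
    unfolding divide_inverse
    by (intro continuous_on_mult[OF continuous_on_mult] continuous_on_const continuous_profile)
  ultimately show ?thesis
    by (cases "even k") (simp_all add: wt_def)
qed

lemma continuous_monodromy:
  assumes v: "norm v = 1"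
  shows "continuous_on box (\<lambda>w. sol (wt (profile w)) v (t0 + pi))"
proof -
  obtain C where C: "\<And>w w'. adm w \<Longrightarrow> adm w' \<Longrightarrow> integral I (b w) \<le> 1 / 2 \<Longrightarrow> integral I (b w') \<le> 1 / 2 \<Longrightarrow>
      norm (sol w v (t0 + pi) - sol w' v (t0 + pi)) \<le> C * (\<Sum>k<8. \<bar>w k - w' k\<bar>)"
    using sol_lipschitz v by blast
  have small: "integral I (b (wt (profile w))) \<le> 1 / 2" "adm (wt (profile w))" if "w \<in> box" for w
    using mass_small(2)[OF good_profile[OF that]] adm_wt[OF good_profile[OF that]] by auto
  show ?thesis
    unfolding continuous_on_def
  proof
    fix w0 assume w0: "w0 \<in> box"
    have "((\<lambda>w. C * (\<Sum>k<8. \<bar>wt (profile w) k - wt (profile w0) k\<bar>)) \<longlongrightarrow>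
        C * (\<Sum>k<8. \<bar>wt (profile w0) k - wt (profile w0) k\<bar>)) (at w0 within box)"
      using continuous_wt w0 by (intro tendsto_intros) (auto simp: continuous_on_def)
    then have lim: "((\<lambda>w. C * (\<Sum>k<8. \<bar>wt (profile w) k - wt (profile w0) k\<bar>)) \<longlongrightarrow> 0) (at w0 within box)"
      by simp
    have ev: "\<forall>\<^sub>F w in at w0 within box.
        norm (sol (wt (profile w)) v (t0 + pi) - sol (wt (profile w0)) v (t0 + pi))
          \<le> C * (\<Sum>k<8. \<bar>wt (profile w) k - wt (profile w0) k\<bar>)"
      using C small w0 by (auto simp: eventually_at_filter)
    show "((\<lambda>w. sol (wt (profile w)) v (t0 + pi)) \<longlongrightarrow> sol (wt (profile w0)) v (t0 + pi)) (at w0 within box)"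
      using Lim_null_comparison[OF ev lim] by (simp add: LIM_zero_iff)
  qed
qed

lemma kick_values:
  "kick 1 0 = - \<i>" "kick 1 1 = (1 - \<i>) / 2" "kick 1 2 = 0" "kick 1 3 = (- 1 - \<i>) / 2"
  "kick \<i> 0 = 0" "kick \<i> 1 = (1 - \<i>) / 2" "kick \<i> 2 = 1" "kick \<i> 3 = (1 + \<i>) / 2"
  by (simp_all add: kick_def complex_eq_iff power3_eq_cube)

text \<open>The errors of the first order approximation, divided by the small parameter, map the box into
  itself; a fixed point in the sense of Brouwer closes the monodromy exactly.\<close>

lemma closed_monodromy_exists:
  assumes s: "s\<^sup>2 = 1" and alt: "\<And>i. i < 4 \<Longrightarrow> sgn (F (p (2 * i))) = s * (- 1) ^ i"
  obtains u where "good u" "sol (wt u) 1 (t0 + pi) = 1" "Re (sol (wt u) \<i> (t0 + pi)) = 0"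
proof -
  define z1 where "z1 w = sol (wt (profile w)) 1 (t0 + pi)" for w
  define z2 where "z2 w = sol (wt (profile w)) \<i> (t0 + pi)" for w
  \<comment> \<open>The identity plus the closing defects, rescaled by the inverse of the linear
    coefficient \<open>\<epsilon> * s / 2\<close>; the fixed points are exactly the zeros of the
    defects. The middle sign differs because \<open>y\<close> enters \<open>Re (z2 w)\<close> with
    the opposite sign.\<close>
  define T where "T w = (fst w + 2 * s / \<epsilon> * (Re (z1 w) - 1),
      fst (snd w) - 2 * s / \<epsilon> * Re (z2 w), snd (snd w) + 2 * s / \<epsilon> * Im (z1 w))" for w
  have "s = 1 \<or> s = - 1" using s by (simp add: power2_eq_1_iff)
  then have s1: "\<bar>s\<bar> = 1" "s * s = 1" by auto
  have "continuous_on box z1" "continuous_on box z2"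
    unfolding z1_def z2_def by (intro continuous_monodromy; simp)+
  then have cont: "continuous_on box T"
    unfolding T_def by (intro continuous_intros)
  have "T \<in> box \<rightarrow> box"
  proof
    fix w assume w: "w \<in> box"
    obtain x y z where xyz: "w = (x, y, z)" by (cases w) auto
    note g = good_profile[OF w]
    define X where "X v = (\<Sum>i<4. of_real (\<epsilon> * profile w i * sgn (F (p (2 * i))) / 2) * kick v i)" for v
    have e1: "norm (z1 w - 1 - X 1) \<le> \<epsilon> / 4" and e2: "norm (z2 w - \<i> - X \<i>) \<le> \<epsilon> / 4"
      unfolding z1_def z2_def X_def by (rule monodromy_estimate[OF g]; simp)+
    have alt': "sgn (F (p 0)) = s" "sgn (F (p 2)) = - s" "sgn (F (p 4)) = s" "sgn (F (p 6)) = - s"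
      using alt[of 0] alt[of 1] alt[of 2] alt[of 3] by simp_all
    have X1: "Re (X 1) = - (\<epsilon> * s / 2) * x" "Im (X 1) = - (\<epsilon> * s / 2) * z" "Re (X \<i>) = \<epsilon> * s / 2 * y"
      unfolding X_def sum_lessThan_4_expand
      unfolding xyz profile_def mult_0_right mult_1_right alt'
      by (simp_all add: alt' kick_values kick_values[unfolded One_nat_def] field_simps)
    \<comment> \<open>The rescaled linear part cancels the coordinate, and what is left is 2 /
      \<open>\<epsilon>\<close> times the error \<open>\<epsilon> / 4\<close>: exactly the half side
      of the box.\<close>
    have est: "\<bar>a + 2 * s / \<epsilon> * c\<bar> \<le> 1 / 2" if "\<bar>c + \<epsilon> * s / 2 * a\<bar> \<le> \<epsilon> / 4" for a c
    proof -
      have "a + 2 * s / \<epsilon> * c = 2 * s / \<epsilon> * (c + \<epsilon> * s / 2 * a)"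
        using s1(2) \<epsilon>(1) by (simp add: distrib_left)
      then have "\<bar>a + 2 * s / \<epsilon> * c\<bar> = 2 / \<epsilon> * \<bar>c + \<epsilon> * s / 2 * a\<bar>"
        using s1(1) \<epsilon>(1) by (simp add: abs_mult)
      also have "\<dots> \<le> 2 / \<epsilon> * (\<epsilon> / 4)"
        using that \<epsilon>(1) by (intro mult_left_mono) auto
      finally show ?thesis using \<epsilon>(1) by simp
    qed
    have "\<bar>x + 2 * s / \<epsilon> * (Re (z1 w) - 1)\<bar> \<le> 1 / 2"
      by (rule est) (use order.trans[OF abs_Re_le_cmod e1] X1(1) in simp)
    moreover have "\<bar>z + 2 * s / \<epsilon> * Im (z1 w)\<bar> \<le> 1 / 2"
      by (rule est) (use order.trans[OF abs_Im_le_cmod e1] X1(2) in simp)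
    moreover have "\<bar>- y + 2 * s / \<epsilon> * Re (z2 w)\<bar> \<le> 1 / 2"
      by (rule est) (use order.trans[OF abs_Re_le_cmod e2] X1(3) in simp)
    ultimately show "T w \<in> box"
      unfolding T_def box_def mem_Times_iff fst_conv snd_conv atLeastAtMost_iff abs_le_iff
      by (simp only: xyz fst_conv snd_conv) (elim conjE, intro conjI TrueI; linarith)
  qed
  have "compact box" "convex box" "box \<noteq> {}"
    unfolding box_def by (intro compact_Times compact_Icc, intro convex_Times convex_real_interval, simp)
  then obtain w where w: "w \<in> box" "T w = w"
    using \<open>T \<in> box \<rightarrow> box\<close> by (rule brouwer[OF _ _ _ cont])
  have "s \<noteq> 0" using s1(1) by auto
  then have "Re (z1 w) = 1" "Im (z1 w) = 0" "Re (z2 w) = 0"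
    using w(2) \<epsilon>(1) by (auto simp: T_def prod_eq_iff)
  then show ?thesis
    using that[OF good_profile[OF w(1)]] by (auto simp: z1_def z2_def complex_eq_iff)
qed

lemma schwarzian_realised:
  assumes "s\<^sup>2 = 1" and "\<And>i. i < 4 \<Longrightarrow> sgn (F (p (2 * i))) = s * (- 1) ^ i"
  shows "\<exists>\<phi> g. rp1_diffeomorphism \<phi> \<and> rp1_orientation_preserving \<phi> \<and>
               rp1_diffeomorphism g \<and> rp1_orientation_preserving g \<and>
               f \<circ> \<phi> = rp1_schwarzian g"
proof -
  obtain u where u: "good u" "sol (wt u) 1 (t0 + pi) = 1" "Re (sol (wt u) \<i> (t0 + pi)) = 0"
    using closed_monodromy_exists[OF assms] by blast
  \<comment> \<open>\<open>sol_close\<close> doubles the mass, which is at most 1/32.\<close>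
  have close: "norm (sol (wt u) v t - v) \<le> 1 / 16" if "norm v = 1" "t \<in> {t0..t0 + pi}" for v t
    using sol_close[OF adm_wt[OF u(1)] _ that(1), of t] mass_small(2)[OF u(1)] that(2)
    by (simp add: I_def)
  show ?thesis
  proof (rule schwarzian_from_system[OF smooth_f smooth_\<rho>[of "wt u"] _ \<rho>_periodic \<psi>_deriv _ \<psi>_init
        P_def[unfolded F_def] sol(2)[unfolded rhs_def] sol(2)[unfolded rhs_def] sol(1) sol(1) u(2,3)])
    show "\<rho> (wt u) t > 0" for t
      unfolding \<rho>_def using wt_pos[OF u(1)] bumpD(2) by (intro sum_pos) (auto simp: lessThan_empty_iff)
    show "\<psi> (wt u) (t + pi) = \<psi> (wt u) t + pi" for t
      by (simp add: \<psi>_quasi_periodic sum_wt[OF u(1)])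
  qed (use close in auto)
qed

end

section \<open>Choice of the points and constants\<close>

lemma zero_between:
  fixes F :: "real \<Rightarrow> real"
  assumes "a < b" "continuous_on {a..b} F" "F a * F b < 0"
  obtains z where "a < z" "z < b" "F z = 0"
proof -
  have "\<exists>z. a \<le> z \<and> z \<le> b \<and> F z = 0"
    using assms IVT'[of F a 0 b] IVT2'[of F b 0 a] by (auto simp: mult_less_0_iff)
  then obtain z where z: "a \<le> z" "z \<le> b" "F z = 0" by blast
  then have "z \<noteq> a" "z \<noteq> b" using assms(3) by auto
  then show ?thesis using that[of z] z by simp
qed

theorem theorem2:
  fixes f :: "rp1 \<Rightarrow> real"
  assumes "rp1_smooth f"
    and "at_least_four_sign_changes f"
  shows "\<exists>\<phi> g. rp1_diffeomorphism \<phi> \<and> rp1_orientation_preserving \<phi> \<and>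
               rp1_diffeomorphism g \<and> rp1_orientation_preserving g \<and>
               f \<circ> \<phi> = rp1_schwarzian g"
proof -
  define F where "F t = f (rp1_angle t)" for t
  note angle_F = F_def
  have cont: "continuous_on A F" for A
    using smooth_real_continuous assms(1) by (simp add: rp1_smooth_def comp_def F_def[abs_def])
  obtain a b c d where abcd: "a < b" "b < c" "c < d" "d < a + pi"
    and sgn: "F a * F b < 0" "F b * F c < 0" "F c * F d < 0" "F d * F a < 0"
    using assms(2) unfolding at_least_four_sign_changes_def F_def by blast
  \<comment> \<open>The fourth, cyclic sign change becomes one on the interval from \<open>d\<close>
    to \<open>a + pi\<close>.\<close>
  have "F (a + pi) = F a" using rp1_angle_shift[of a 1] by (simp add: F_def)
  then have sgn': "F d * F (a + pi) < 0" using sgn(4) by simp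
  obtain z1 where z1: "a < z1" "z1 < b" "F z1 = 0" by (rule zero_between[OF abcd(1) cont sgn(1)])
  obtain z2 where z2: "b < z2" "z2 < c" "F z2 = 0" by (rule zero_between[OF abcd(2) cont sgn(2)])
  obtain z3 where z3: "c < z3" "z3 < d" "F z3 = 0" by (rule zero_between[OF abcd(3) cont sgn(3)])
  obtain z4 where z4: "d < z4" "z4 < a + pi" "F z4 = 0" by (rule zero_between[OF abcd(4) cont sgn'])
  note z = z1 z2 z3 z4
  \<comment> \<open>The midpoint between the last zero shifted back by a period and
    \<open>a\<close>, so that all eight points lie in the open period starting at
    \<open>t0\<close>.\<close>
  define t0 where "t0 = (a + (z4 - pi)) / 2"
  define p where "p k = [a, z1, b, z2, c, z3, d, z4] ! k" for k
  have p: "p 0 = a" "p 1 = z1" "p 2 = b" "p 3 = z2" "p 4 = c" "p 5 = z3" "p 6 = d" "p 7 = z4"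
    by (simp_all add: p_def)
  have lt8: "k < 8 \<longleftrightarrow> k = 0 \<or> k = 1 \<or> k = 2 \<or> k = 3 \<or> k = 4 \<or> k = 5 \<or> k = 6 \<or> k = 7" for k :: nat
    by linarith
  have mono: "p j < p k" if "j < k" "k < 8" for j k
  proof -
    have "j < 8" using that by simp
    with that show ?thesis
      unfolding lt8 using z abcd by (elim disjE) (simp_all add: p p[simplified])
  qed
  have inside: "t0 < p k" "p k < t0 + pi" if "k < 8" for k
  proof -
    have "p 0 \<le> p k" "p k \<le> p 7"
      using mono[of 0 k] mono[of k 7] that by (cases "k = 0"; cases "k = 7"; auto)+
    moreover have "t0 < p 0" "p 7 < t0 + pi"
      using z(11) by (simp_all add: p t0_def field_simps)
    ultimately show "t0 < p k" "p k < t0 + pi" by auto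
  qed
  have "bounded (F ` {t0..t0 + pi})"
    by (intro compact_imp_bounded compact_continuous_image cont compact_Icc)
  then obtain B where B: "\<And>t. t \<in> {t0..t0 + pi} \<Longrightarrow> \<bar>F t\<bar> \<le> B"
    unfolding bounded_iff by (metis imageI real_norm_def)
  \<comment> \<open>The sum makes \<open>M\<close> dominate the reciprocals of the nonzero values at
    the pulses. At the zeros \<open>inverse 0 = 0\<close> keeps the summand harmless.\<close>
  define M where "M = 1 + \<bar>B\<bar> + (\<Sum>k<8. inverse \<bar>F (p k)\<bar>)"
  have s0: "0 \<le> (\<Sum>k<8. inverse \<bar>F (p k)\<bar>)" by (intro sum_nonneg) auto
  then have M: "1 \<le> M" "B \<le> M" by (auto simp: M_def)
  have MF: "1 \<le> M * \<bar>F (p k)\<bar>" if "k < 8" "F (p k) \<noteq> 0" for k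
  proof -
    have "inverse \<bar>F (p k)\<bar> \<le> (\<Sum>k<8. inverse \<bar>F (p k)\<bar>)"
      using that(1) by (intro member_le_sum) auto
    then have "inverse \<bar>F (p k)\<bar> \<le> M" by (simp add: M_def)
    from mult_right_mono[OF this, of "\<bar>F (p k)\<bar>"] show ?thesis using that(2) by simp
  qed
  define \<epsilon> where "\<epsilon> = 1 / (3000 * M ^ 4)"
  have \<epsilon>: "0 < \<epsilon>" "3000 * M ^ 4 * \<epsilon> \<le> 1" using M(1) by (simp_all add: \<epsilon>_def)
  have gap: "\<forall>\<^sub>F \<eta> in at_right 0. x + \<eta> \<le> y - \<eta>" if "x < y" for x y :: real
    using that by (intro eventually_at_rightI[of 0 "(y - x) / 2"]) auto
  \<comment> \<open>Each of the finitely many requirements holds for all sufficiently small positive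
    \<open>\<eta>\<close>, so one value meets them all.\<close>
  have "\<forall>\<^sub>F \<eta> in at_right 0. 0 < \<eta> \<and> \<eta> \<le> \<epsilon>\<^sup>2 \<and>
      (\<forall>k\<in>{..<8}. t0 + \<eta> \<le> p k - \<eta> \<and> p k + \<eta> \<le> t0 + pi - \<eta> \<and>
        (\<forall>j\<in>{..<k}. p j + \<eta> \<le> p k - \<eta>) \<and> (\<forall>t. \<bar>t - p k\<bar> \<le> \<eta> \<longrightarrow> \<bar>F t - F (p k)\<bar> \<le> \<epsilon>\<^sup>2))"
  proof (intro eventually_conj eventually_ball_finite ballI finite_lessThan)
    show "\<forall>\<^sub>F \<eta> in at_right (0 :: real). 0 < \<eta>" by (simp add: eventually_at_right_less)
    show "\<forall>\<^sub>F \<eta> in at_right 0. \<eta> \<le> \<epsilon>\<^sup>2"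
      using \<epsilon>(1) by (intro eventually_at_rightI[of 0 "\<epsilon>\<^sup>2"]) auto
    fix k :: nat assume "k \<in> {..<8}"
    then have k: "k < 8" by simp
    show "\<forall>\<^sub>F \<eta> in at_right 0. t0 + \<eta> \<le> p k - \<eta>" "\<forall>\<^sub>F \<eta> in at_right 0. p k + \<eta> \<le> t0 + pi - \<eta>"
      by (intro gap inside k)+
    show "\<forall>\<^sub>F \<eta> in at_right 0. p j + \<eta> \<le> p k - \<eta>" if "j \<in> {..<k}" for j
      using that k by (intro gap mono) auto
    have "isCont F (p k)" using cont[of UNIV] by (simp add: continuous_on_eq_continuous_at)
    then obtain r where r: "r > 0" "\<And>t. \<bar>t - p k\<bar> < r \<Longrightarrow> \<bar>F t - F (p k)\<bar> < \<epsilon>\<^sup>2"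
      using \<epsilon>(1) unfolding continuous_at_eps_delta dist_real_def by (metis zero_less_power)
    show "\<forall>\<^sub>F \<eta> in at_right 0. \<forall>t. \<bar>t - p k\<bar> \<le> \<eta> \<longrightarrow> \<bar>F t - F (p k)\<bar> \<le> \<epsilon>\<^sup>2"
      using r by (intro eventually_at_rightI[of 0 r]) (auto intro!: less_imp_le)
  qed
  then obtain \<eta> where \<eta>: "0 < \<eta>" "\<eta> \<le> \<epsilon>\<^sup>2"
    and \<eta>p: "\<And>k. k < 8 \<Longrightarrow> t0 + \<eta> \<le> p k - \<eta>" "\<And>k. k < 8 \<Longrightarrow> p k + \<eta> \<le> t0 + pi - \<eta>"
      "\<And>j k. j < k \<Longrightarrow> k < 8 \<Longrightarrow> p j + \<eta> \<le> p k - \<eta>"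
      "\<And>k t. k < 8 \<Longrightarrow> \<bar>t - p k\<bar> \<le> \<eta> \<Longrightarrow> \<bar>F t - F (p k)\<bar> \<le> \<epsilon>\<^sup>2"
    using eventually_happens'[OF trivial_limit_at_right_real] by blast
  have "\<forall>k. \<exists>\<beta> \<Phi>. k < 8 \<longrightarrow> bump t0 \<eta> (p k) \<beta> \<Phi>"
  proof
    fix k show "\<exists>\<beta> \<Phi>. k < 8 \<longrightarrow> bump t0 \<eta> (p k) \<beta> \<Phi>"
      using bump_exists[OF \<eta>(1), of t0 "p k"] \<eta>p(1,2)[of k] \<eta>(1) by (cases "k < 8") auto
  qed
  then obtain \<beta> \<Phi> where bumps: "\<And>k. k < 8 \<Longrightarrow> bump t0 \<eta> (p k) (\<beta> k) (\<Phi> k)" by metis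
  have Fodd: "F (p k) = 0" if "k < 8" "odd k" for k
    using that z unfolding lt8 by (elim disjE) (simp_all add: p p[simplified])
  have Feven: "F (p k) \<noteq> 0" if "k < 8" "even k" for k
    using that sgn unfolding lt8 by (elim disjE) (auto simp: p p[simplified])
  interpret pulses f t0 \<eta> \<epsilon> M p \<beta> \<Phi>
  proof
    show "t0 \<le> p k - \<eta>" "p k + \<eta> \<le> t0 + pi" if "k < 8" for k
      using \<eta>p(1,2)[OF that] \<eta>(1) by auto
    show "\<bar>f (rp1_angle t)\<bar> \<le> M" if "t \<in> {t0..t0 + pi}" for t
      using B[OF that] M(2) by (simp add: F_def)
  qed (use assms(1) bumps \<eta> \<epsilon> M \<eta>p Fodd Feven MF in \<open>auto simp: F_def\<close>)
  have "(sgn (F a))\<^sup>2 = 1" using sgn(1) by (auto simp: sgn_real_def)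
  moreover have "sgn (F (p (2 * i))) = sgn (F a) * (- 1) ^ i" if "i < 4" for i
  proof -
    have "i = 0 \<or> i = 1 \<or> i = 2 \<or> i = 3" using that by linarith
    then show ?thesis
      using sgn by (elim disjE) (auto simp: p sgn_real_def mult_less_0_iff)
  qed
  ultimately show ?thesis
    by (intro schwarzian_realised[of "sgn (F a)"]) (simp_all add: angle_F F_def)
qed

end
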